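(* There exists a sequence $(\gamma_t)_{t\ge 1}$ such that, for every positive integer $t$, $\gamma_t$ is a $t$-design curve in $\mathbb{S}^2$, and $\ell(\gamma_t)\asymp t$; that is, there are constants $0<c\le C$ independent of $t$ with $c\,t\le \ell(\gamma_t)\le C\,t$ for all $t\ge 1$.
   Context: $\mathbb{S}^2=\{x\in\mathbb{R}^{3}:\|x\|=1\}$, and $\int_{\mathbb{S}^2}$ denotes integration with respect to the surface measure normalized so that $\int_{\mathbb{S}^2}1=1$. $\Pi_t$ is the space of algebraic polynomials in $3$ real variables of total degree at most $t$. A curve is a continuous, piecewise smooth map $\gamma:[0,1]\to\mathbb{S}^2$ with at most finitely many self-intersections (all but finitely many points of $\gamma([0,1))$ are attained exactly once on $[0,1)$); all curves are closed, i.e. $\gamma(0)=\gamma(1)$. Its length is $\ell(\gamma)=\int_0^1\|\dot\gamma(s)\|\,ds$, assumed positive, and $\int_\gamma f=\int_0^1 f(\gamma(s))\|\dot\gamma(s)\|\,ds$. A curve $\gamma$ is a $t$-design curve in $\mathbb{S}^2$ if $\frac{1}{\ell(\gamma)}\int_\gamma f=\int_{\mathbb{S}^2}f$ for all $f\in\Pi_t$. *)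

theory Defs
  imports "HOL-Analysis.Analysis"
begin

definition spherical_point :: "real \<Rightarrow> real \<Rightarrow> real ^ 3" where
  "spherical_point \<theta> \<phi> = vector [sin \<theta> * cos \<phi>, sin \<theta> * sin \<phi>, cos \<theta>]"

(* Surface measure of the unit sphere, computed in the standard parametrization by colatitude
   and longitude. The area element is sin theta (lemma spherical_area_element), and the total
   area 4 * pi is normalized to 1 (lemma emeasure_sphere_measure_space). *)
definition sphere_measure :: "(real ^ 3) measure" where
  "sphere_measure =
     distr
       (density lborel
         (\<lambda>(\<theta>, \<phi>). ennreal (sin \<theta> / (4 * pi)) * indicator ({0..pi} \<times> {0..2 * pi}) (\<theta>, \<phi>)))
       borel (\<lambda>(\<theta>, \<phi>). spherical_point \<theta> \<phi>)"

(* Polynomial functions of total degree at most t; an exponent vector is a function k on the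
   three-element index type. *)
definition polys_upto :: "nat \<Rightarrow> (real ^ 3 \<Rightarrow> real) set" where
  "polys_upto t =
     {f. \<exists>c :: (3 \<Rightarrow> nat) \<Rightarrow> real.
           f = (\<lambda>x. \<Sum>k | (\<Sum>i\<in>UNIV. k i) \<le> t. c k * (\<Prod>i\<in>UNIV. (x $ i) ^ k i))}"

(* C-infinity on the closed interval, with one-sided derivatives of all orders at the endpoints;
   D n is the n-th derivative. *)
definition smooth_on_Icc :: "real \<Rightarrow> real \<Rightarrow> (real \<Rightarrow> 'a::real_normed_vector) \<Rightarrow> bool" where
  "smooth_on_Icc a b g \<longleftrightarrow>
     (\<exists>D :: nat \<Rightarrow> real \<Rightarrow> 'a.
        (\<forall>s\<in>{a..b}. D 0 s = g s) \<and>
        (\<forall>n. \<forall>s\<in>{a..b}. (D n has_vector_derivative D (Suc n) s) (at s within {a..b})))"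

definition piecewise_smooth :: "(real \<Rightarrow> 'a::real_normed_vector) \<Rightarrow> bool" where
  "piecewise_smooth g \<longleftrightarrow>
     (\<exists>S. finite S \<and> {0, 1} \<subseteq> S \<and> S \<subseteq> {0..1} \<and>
        (\<forall>a\<in>S. \<forall>b\<in>S. a < b \<and> {a<..<b} \<inter> S = {} \<longrightarrow> smooth_on_Icc a b g))"

(* The velocity may be undefined at the finitely many break points, which form a null set. *)
definition curve_integral :: "(real \<Rightarrow> real ^ 3) \<Rightarrow> (real ^ 3 \<Rightarrow> real) \<Rightarrow> real" where
  "curve_integral \<gamma> f =
     integral {0..1} (\<lambda>s. f (\<gamma> s) * norm (vector_derivative \<gamma> (at s within {0..1})))"

definition curve_length :: "(real \<Rightarrow> real ^ 3) \<Rightarrow> real" where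
  "curve_length \<gamma> = integral {0..1} (\<lambda>s. norm (vector_derivative \<gamma> (at s within {0..1})))"

definition closed_sphere_curve :: "(real \<Rightarrow> real ^ 3) \<Rightarrow> bool" where
  "closed_sphere_curve \<gamma> \<longleftrightarrow>
     path \<gamma> \<and> piecewise_smooth \<gamma> \<and> path_image \<gamma> \<subseteq> sphere 0 1 \<and> closed_path \<gamma> \<and>
     finite {p \<in> \<gamma> ` {0..<1}. \<not> (\<exists>!s. s \<in> {0..<1} \<and> \<gamma> s = p)} \<and>
     curve_length \<gamma> > 0"

definition design_curve :: "nat \<Rightarrow> (real \<Rightarrow> real ^ 3) \<Rightarrow> bool" where
  "design_curve t \<gamma> \<longleftrightarrow>
     closed_sphere_curve \<gamma> \<and>
     (\<forall>f\<in>polys_upto t.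
        1 / curve_length \<gamma> * curve_integral \<gamma> f = (\<integral>x. f x \<partial>sphere_measure))"

lemma norm_spherical_point: "norm (spherical_point \<theta> \<phi>) = 1"
proof -
  have "(sin \<theta> * cos \<phi>)\<^sup>2 + (sin \<theta> * sin \<phi>)\<^sup>2 + (cos \<theta>)\<^sup>2
      = (sin \<theta>)\<^sup>2 * ((cos \<phi>)\<^sup>2 + (sin \<phi>)\<^sup>2) + (cos \<theta>)\<^sup>2"
    by (simp only: power_mult_distrib distrib_left)
  then show ?thesis
    by (simp add: norm_vec_def L2_set_def spherical_point_def sum_3)
qed

lemma spherical_area_element:
  assumes "\<theta> \<in> {0..pi}"
  shows "\<exists>u v. ((\<lambda>a. spherical_point a \<phi>) has_vector_derivative u) (at \<theta>) \<and>
               ((\<lambda>b. spherical_point \<theta> b) has_vector_derivative v) (at \<phi>) \<and>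
               norm (cross3 u v) = sin \<theta>"
proof -
  define u :: "real ^ 3" where "u = vector [cos \<theta> * cos \<phi>, cos \<theta> * sin \<phi>, - sin \<theta>]"
  define v :: "real ^ 3" where "v = vector [- (sin \<theta> * sin \<phi>), sin \<theta> * cos \<phi>, 0]"
  have sp: "spherical_point a b = (sin a * cos b) *\<^sub>R axis 1 1 + (sin a * sin b) *\<^sub>R axis 2 1
      + cos a *\<^sub>R axis 3 1" for a b
    by (simp add: spherical_point_def vec_eq_iff forall_3 axis_def)
  have 1: "((\<lambda>a. spherical_point a \<phi>) has_vector_derivative u) (at \<theta>)"
    unfolding sp
    by (rule derivative_eq_intros refl | simp)+
       (simp add: u_def vec_eq_iff forall_3 axis_def)
  have 2: "((\<lambda>b. spherical_point \<theta> b) has_vector_derivative v) (at \<phi>)"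
    unfolding sp
    by (rule derivative_eq_intros refl | simp)+
       (simp add: v_def vec_eq_iff forall_3 axis_def)
  have c: "cross3 u v = sin \<theta> *\<^sub>R spherical_point \<theta> \<phi>"
  proof -
    have "cos \<phi> * (cos \<phi> * (cos \<theta> * sin \<theta>)) + cos \<theta> * (sin \<phi> * (sin \<phi> * sin \<theta>))
        = cos \<theta> * sin \<theta> * ((cos \<phi>)\<^sup>2 + (sin \<phi>)\<^sup>2)"
      by (simp only: power2_eq_square distrib_left mult_ac)
    then have "cos \<phi> * (cos \<phi> * (cos \<theta> * sin \<theta>)) + cos \<theta> * (sin \<phi> * (sin \<phi> * sin \<theta>))
        = cos \<theta> * sin \<theta>"
      by simp
    then show ?thesis
      by (simp add: cross3_def u_def v_def spherical_point_def vec_eq_iff forall_3 power2_eq_square mult_ac)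
  qed
  have "norm (cross3 u v) = sin \<theta>"
    using assms by (simp add: c norm_spherical_point sin_ge_zero)
  with 1 2 show ?thesis by blast
qed

lemma continuous_on_spherical_point: "continuous_on UNIV (\<lambda>(\<theta>, \<phi>). spherical_point \<theta> \<phi>)"
proof -
  have "(\<lambda>(\<theta>, \<phi>). spherical_point \<theta> \<phi>) = (\<lambda>p. (sin (fst p) * cos (snd p)) *\<^sub>R axis 1 1
      + (sin (fst p) * sin (snd p)) *\<^sub>R axis 2 1 + cos (fst p) *\<^sub>R axis 3 1)"
    by (auto simp: spherical_point_def vec_eq_iff forall_3 axis_def)
  then show ?thesis by (auto intro!: continuous_intros)
qed

lemma emeasure_sphere_measure_space: "emeasure sphere_measure (space sphere_measure) = 1"
proof -
  define h where "h = (\<lambda>(\<theta>::real, \<phi>::real).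
    ennreal (sin \<theta> / (4 * pi)) * indicator ({0..pi} \<times> {0..2 * pi}) (\<theta>, \<phi>))"
  have sin_meas: "(\<lambda>p::real \<times> real. ennreal (sin (fst p) / (4 * pi))) \<in> borel_measurable borel"
    by (intro measurable_compose[OF _ measurable_ennreal] borel_measurable_continuous_onI
          continuous_intros) auto
  have hm: "h \<in> borel_measurable (borel :: (real \<times> real) measure)"
    unfolding h_def case_prod_beta
    by (intro borel_measurable_times_ennreal sin_meas borel_measurable_indicator)
       (simp add: borel_closed closed_Times)
  have pm: "(\<lambda>(\<theta>, \<phi>). spherical_point \<theta> \<phi>) \<in> borel_measurable borel"
    by (rule borel_measurable_continuous_onI[OF continuous_on_spherical_point])
  have in1: "(\<integral>\<^sup>+ \<phi>. h (\<theta>, \<phi>) \<partial>lborel) = ennreal (sin \<theta> / 2) * indicator {0..pi} \<theta>" for \<theta>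
  proof -
    have "(\<integral>\<^sup>+ \<phi>. h (\<theta>, \<phi>) \<partial>lborel)
        = (\<integral>\<^sup>+ \<phi>. (ennreal (sin \<theta> / (4 * pi)) * indicator {0..pi} \<theta>) * indicator {0..2 * pi} \<phi> \<partial>lborel)"
      by (intro nn_integral_cong) (auto simp: h_def indicator_def)
    also have "\<dots> = (ennreal (sin \<theta> / (4 * pi)) * indicator {0..pi} \<theta>) * ennreal (2 * pi)"
      by (subst nn_integral_cmult_indicator) auto
    also have "\<dots> = ennreal (sin \<theta> / 2) * indicator {0..pi} \<theta>"
      by (auto simp: indicator_def sin_ge_zero simp flip: ennreal_mult)
    finally show ?thesis .
  qed
  have "emeasure sphere_measure (space sphere_measure) = (\<integral>\<^sup>+ p. h p \<partial>lborel)"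
    unfolding sphere_measure_def h_def[symmetric]
    using pm hm by (simp add: emeasure_distr emeasure_density)
  also have "\<dots> = (\<integral>\<^sup>+ \<theta>. \<integral>\<^sup>+ \<phi>. h (\<theta>, \<phi>) \<partial>lborel \<partial>lborel)"
    using hm by (subst lborel_prod[symmetric], subst lborel.nn_integral_fst[symmetric])
      (auto simp: lborel_prod)
  also have "\<dots> = (\<integral>\<^sup>+ \<theta>. ennreal (sin \<theta> / 2) * indicator {0..pi} \<theta> \<partial>lborel)"
    by (simp add: in1)
  also have "\<dots> = ennreal ((- cos pi / 2) - (- cos 0 / 2))"
    by (rule nn_integral_FTC_Icc[where F = "\<lambda>x. - cos x / 2"])
       (auto intro!: derivative_eq_intros simp: sin_ge_zero)
  finally show ?thesis by simp
qed

lemma finite_exponents: "finite {k :: 3 \<Rightarrow> nat. (\<Sum>i\<in>UNIV. k i) \<le> t}"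
proof (rule finite_subset)
  show "{k :: 3 \<Rightarrow> nat. (\<Sum>i\<in>UNIV. k i) \<le> t} \<subseteq> UNIV \<rightarrow>\<^sub>E {..t}"
  proof (clarsimp simp: PiE_def)
    fix k :: "3 \<Rightarrow> nat" and i
    assume "sum k UNIV \<le> t"
    moreover have "k i \<le> sum k UNIV" by (rule member_le_sum) auto
    ultimately show "k i \<le> t" by simp
  qed
  show "finite (UNIV \<rightarrow>\<^sub>E {..t} :: (3 \<Rightarrow> nat) set)"
    by (intro finite_PiE) auto
qed

end

theory Submission
  imports Defs
begin

text \<open>
  The curve is a connected union of finitely many circles on the sphere, run through in the manner
  of an Euler tour.  Distinct circles meet in at most two points, so if each circle is traversed
  exactly once the self-intersections are finite in number, and the integral along the curve is the
  sum of the integrals over the circles (\<open>circles_tour\<close>).  It remains to find a connected union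
  of circles, of total length of order \<open>t\<close>, whose arc length measure integrates \<open>\<Pi>\<^sub>t\<close> exactly.

  A circle of latitude averages exactly over the longitude.  A union of circles of colatitudes
  \<open>\<theta>\<^sub>j\<close> is therefore a design as soon as their lengths, which are proportional to \<open>sin \<theta>\<^sub>j\<close>,
  form a quadrature rule for \<open>dz\<close>, exact for polynomials of degree at most \<open>t\<close> in \<open>z = cos \<theta>\<close>.
  No usual rule has precisely these weights.  Fejer's second rule at \<open>\<theta>\<^sub>j = j\<pi>/(2m)\<close>, where
  \<open>m = t + 1\<close>, comes close: for the mean value over \<open>[-1, 1]\<close> its weights are \<open>sin \<theta>\<^sub>j / m\<close> times a partial sum of the Fourier series of
  a square wave, and these partial sums are bounded below by a positive constant at the nodes
  (\<open>odd_sine_sum_nodes\<close>).  Hence a multiple of the rule by a constant times \<open>m\<close> dominates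
  \<open>2 sin \<theta>\<^sub>j\<close> at every node.

  The missing weight at \<open>\<theta>\<^sub>j\<close> is supplied by beads: \<open>M\<close> small circles of equal radius, centred at
  equally spaced points of the circle of latitude.  If \<open>M > t\<close>, averaging over the \<open>M\<close> positions
  is the same as averaging over all longitudes, so the beads are as good as a rotationally
  symmetric measure.  If their total length is kept fixed while \<open>M\<close> tends to infinity, that
  measure tends to a point mass in \<open>z\<close>; for large \<open>M\<close> the radii which make the quadrature exact are
  a small perturbation of those for the point masses, and are found by a contraction argument
  (\<open>perturbed_weights\<close>, \<open>weighted_latitudes\<close>).

  Distinct circles of latitude are disjoint.  To connect them, the family is joined with its image
  under the exchange of the first and third coordinates, which preserves the integral of every
  polynomial over the sphere (\<open>sphere_moment_swap\<close>): the great circle \<open>x = 0\<close> meets every circle of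
  latitude, the equator meets all their images, and every bead meets its own circle of latitude.
  The two families use different numbers of beads, so that no circle occurs twice.  The total length
  is \<open>160 \<pi> (t + 1)\<close>.
\<close>

section \<open>Concatenating piecewise smooth curves\<close>

text \<open>
  A triple \<open>(p, a, b)\<close> encodes the circle with centre \<open>p\<close> in the plane spanned by the directions
  \<open>a\<close> and \<open>b\<close>, together with its parametrization by the angle.
\<close>

type_synonym circle = "(real ^ 3) \<times> (real ^ 3) \<times> (real ^ 3)"

fun circle_point :: "circle \<Rightarrow> real \<Rightarrow> real ^ 3" where
  "circle_point (p, a, b) u = p + cos u *\<^sub>R a + sin u *\<^sub>R b"

text \<open>
  The triples that parametrize a genuine circle of the unit sphere at constant speed.
\<close>

fun circle_frame :: "circle \<Rightarrow> bool" where
  "circle_frame (p, a, b) \<longleftrightarrow> p \<bullet> a = 0 \<and> p \<bullet> b = 0 \<and> a \<bullet> b = 0 \<and> norm b = norm a \<and>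
     0 < norm a \<and> (norm p)\<^sup>2 + (norm a)\<^sup>2 = 1"

fun circle_radius :: "circle \<Rightarrow> real" where
  "circle_radius (p, a, b) = norm a"

abbreviation fibre :: "circle \<Rightarrow> real \<Rightarrow> real \<Rightarrow> real ^ 3 \<Rightarrow> real set" where
  "fibre C \<alpha> \<beta> p \<equiv> {u \<in> {\<alpha>..<\<beta>}. circle_point C u = p}"

abbreviation arc_integral :: "circle \<Rightarrow> real \<Rightarrow> real \<Rightarrow> (real ^ 3 \<Rightarrow> real) \<Rightarrow> real" where
  "arc_integral C \<alpha> \<beta> f \<equiv> circle_radius C * integral {\<alpha>..\<beta>} (\<lambda>u. f (circle_point C u))"

text \<open>
  All that is needed of a curve under concatenation: its integrals are given by \<open>I\<close>, and \<open>n\<close>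
  counts how often it visits each point.  Both are additive, which is why the visits are counted on
  the half-open interval.  The velocity is kept as a separate function \<open>D\<close>, since the derivative
  need not exist at the break points.
\<close>

definition traces :: "(real \<Rightarrow> real ^ 3) \<Rightarrow> ((real ^ 3 \<Rightarrow> real) \<Rightarrow> real) \<Rightarrow> (real ^ 3 \<Rightarrow> nat) \<Rightarrow> bool" where
  "traces \<gamma> I n \<longleftrightarrow> path \<gamma> \<and> piecewise_smooth \<gamma> \<and> path_image \<gamma> \<subseteq> sphere 0 1 \<and>
     (\<exists>S D. finite S \<and> (\<forall>s\<in>{0..1} - S. (\<gamma> has_vector_derivative D s) (at s)) \<and>
        (\<forall>f. continuous_on UNIV f \<longrightarrow> ((\<lambda>s. f (\<gamma> s) * norm (D s)) has_integral I f) {0..1})) \<and>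
     (\<forall>p. finite {s \<in> {0..<1}. \<gamma> s = p} \<and> card {s \<in> {0..<1}. \<gamma> s = p} = n p)"

lemma smooth_on_Icc_cong:
  assumes "smooth_on_Icc a b g" "\<And>s. s \<in> {a..b} \<Longrightarrow> g s = h s"
  shows "smooth_on_Icc a b h"
  using assms unfolding smooth_on_Icc_def by metis

lemma smooth_on_Icc_affine:
  assumes "smooth_on_Icc (c * a + d) (c * b + d) g" "c > 0"
  shows "smooth_on_Icc a b (\<lambda>s. g (c * s + d))"
proof -
  from assms obtain D where D0: "\<And>s. s \<in> {c * a + d..c * b + d} \<Longrightarrow> D 0 s = g s"
    and D: "\<And>n s. s \<in> {c * a + d..c * b + d} \<Longrightarrow>
       (D n has_vector_derivative D (Suc n) s) (at s within {c * a + d..c * b + d})"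
    unfolding smooth_on_Icc_def by metis
  have im: "c * s + d \<in> {c * a + d..c * b + d}" if "s \<in> {a..b}" for s
    using that assms(2) by auto
  show ?thesis unfolding smooth_on_Icc_def
  proof (intro exI[of _ "\<lambda>n s. c ^ n *\<^sub>R D n (c * s + d)"] conjI ballI allI)
    fix s assume "s \<in> {a..b}" then show "c ^ 0 *\<^sub>R D 0 (c * s + d) = g (c * s + d)"
      using D0 im by simp
  next
    fix n s assume s: "s \<in> {a..b}"
    have 1: "((\<lambda>s. c * s + d) has_vector_derivative c) (at s within {a..b})"
      by (auto intro!: derivative_eq_intros)
    have 2: "(D n has_vector_derivative D (Suc n) (c * s + d)) (at (c * s + d) within (\<lambda>s. c * s + d) ` {a..b})"
      by (rule has_vector_derivative_within_subset[OF D[OF im[OF s]]]) (use im in auto)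
    have "((D n \<circ> (\<lambda>s. c * s + d)) has_vector_derivative c *\<^sub>R D (Suc n) (c * s + d)) (at s within {a..b})"
      by (rule vector_diff_chain_within[OF 1 2])
    then have "((\<lambda>s. c ^ n *\<^sub>R (D n \<circ> (\<lambda>s. c * s + d)) s) has_vector_derivative c ^ n *\<^sub>R (c *\<^sub>R D (Suc n) (c * s + d))) (at s within {a..b})"
      by (rule has_vector_derivative_scaleR[OF DERIV_const, THEN has_vector_derivative_eq_rhs]) simp
    then show "((\<lambda>s. c ^ n *\<^sub>R D n (c * s + d)) has_vector_derivative c ^ Suc n *\<^sub>R D (Suc n) (c * s + d)) (at s within {a..b})"
      by (simp add: mult.commute)
  qed
qed

text \<open>
  Each differentiation advances the angle of the direction vector by a quarter turn.
\<close>

lemma circle_point_smooth: "smooth_on_Icc a b (circle_point C)"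
proof (cases C)
  case (fields p e e')
  show ?thesis unfolding smooth_on_Icc_def
  proof (intro exI[of _ "\<lambda>n u. (if n = 0 then p else 0) + cos (u + real n * (pi / 2)) *\<^sub>R e
        + sin (u + real n * (pi / 2)) *\<^sub>R e'"] conjI ballI allI)
    fix n u
    have c: "cos (u + real (Suc n) * (pi / 2)) = - sin (u + real n * (pi / 2))"
            "sin (u + real (Suc n) * (pi / 2)) = cos (u + real n * (pi / 2))"
      using cos_add[of "u + real n * (pi / 2)" "pi / 2"] sin_add[of "u + real n * (pi / 2)" "pi / 2"]
      by (simp_all add: algebra_simps add_divide_distrib)
    show "((\<lambda>u. (if n = 0 then p else 0) + cos (u + real n * (pi / 2)) *\<^sub>R e
        + sin (u + real n * (pi / 2)) *\<^sub>R e') has_vector_derivative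
        (if Suc n = 0 then p else 0) + cos (u + real (Suc n) * (pi / 2)) *\<^sub>R e
        + sin (u + real (Suc n) * (pi / 2)) *\<^sub>R e') (at u within {a..b})"
      unfolding c
      by (auto intro!: derivative_eq_intros has_vector_derivative_scaleR[THEN has_vector_derivative_eq_rhs])
  qed (simp add: fields)
qed

text \<open>
  The break points of the two pieces are halved and put side by side.  The point \<open>1/2\<close> is always
  among them, so an interval between consecutive break points lies in one half.
\<close>

lemma piecewise_smooth_join:
  assumes "piecewise_smooth g" "piecewise_smooth h" "g 1 = h 0"
  shows "piecewise_smooth (g +++ h)"
proof -
  obtain S where S: "finite S" "{0,1} \<subseteq> S" "S \<subseteq> {0..1}"
    and Ss: "\<And>a b. a \<in> S \<Longrightarrow> b \<in> S \<Longrightarrow> a < b \<Longrightarrow> {a<..<b} \<inter> S = {} \<Longrightarrow> smooth_on_Icc a b g"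
    using assms(1) unfolding piecewise_smooth_def by metis
  obtain T where T: "finite T" "{0,1} \<subseteq> T" "T \<subseteq> {0..1}"
    and Ts: "\<And>a b. a \<in> T \<Longrightarrow> b \<in> T \<Longrightarrow> a < b \<Longrightarrow> {a<..<b} \<inter> T = {} \<Longrightarrow> smooth_on_Icc a b h"
    using assms(2) unfolding piecewise_smooth_def by metis
  define R where "R = (\<lambda>s. s / 2) ` S \<union> (\<lambda>s. (s + 1) / 2) ` T"
  have R1: "x \<in> R \<longleftrightarrow> 2 * x \<in> S" if "x \<le> 1/2" for x
  proof
    assume "x \<in> R"
    then consider s where "s \<in> S" "x = s / 2" | s where "s \<in> T" "x = (s + 1) / 2"
      unfolding R_def by blast
    then show "2 * x \<in> S"
    proof cases
      case 2
      then have "2 * x = 1" using T(3) \<open>x \<le> 1/2\<close> by fastforce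
      then show ?thesis using S(2) by simp
    qed (auto simp: mult.commute)
  next
    assume "2 * x \<in> S"
    then have "2 * x / 2 \<in> R" unfolding R_def by blast
    then show "x \<in> R" by simp
  qed
  have R2: "x \<in> R \<longleftrightarrow> 2 * x - 1 \<in> T" if "x \<ge> 1/2" for x
  proof
    assume "x \<in> R"
    then consider s where "s \<in> S" "x = s / 2" | s where "s \<in> T" "x = (s + 1) / 2"
      unfolding R_def by blast
    then show "2 * x - 1 \<in> T"
    proof cases
      case 1
      then have "2 * x - 1 = 0" using S(3) \<open>x \<ge> 1/2\<close> by fastforce
      then show ?thesis using T(2) by simp
    qed (simp add: field_simps)
  next
    assume "2 * x - 1 \<in> T"
    then have "((2 * x - 1) + 1) / 2 \<in> R" unfolding R_def by blast
    then show "x \<in> R" by simp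
  qed
  have half: "1/2 \<in> R" using R1[of "1/2"] S by auto
  show ?thesis unfolding piecewise_smooth_def
  proof (intro exI[of _ R] conjI ballI impI)
    show "finite R" using S T by (simp add: R_def)
    show "{0,1} \<subseteq> R" using R1[of 0] R2[of 1] S T by auto
    show "R \<subseteq> {0..1}" using S T by (auto simp: R_def)
    fix a b assume ab: "a \<in> R" "b \<in> R" "a < b \<and> {a<..<b} \<inter> R = {}"
    have "1/2 \<notin> {a<..<b}" using half ab by blast
    then consider "b \<le> 1/2" | "a \<ge> 1/2" by force
    then show "smooth_on_Icc a b (g +++ h)"
    proof cases
      case 1
      have "{2 * a<..<2 * b} \<inter> S = {}"
      proof safe
        fix x assume x: "x \<in> {2 * a<..<2 * b}" "x \<in> S"
        then have "x/2 \<in> R" using R1[of "x/2"] 1 by auto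
        moreover have "x/2 \<in> {a<..<b}" using x by auto
        ultimately show "x \<in> {}" using ab by blast
      qed
      then have "smooth_on_Icc (2 * a) (2 * b) g" using ab 1 R1 by (intro Ss) auto
      then have "smooth_on_Icc a b (\<lambda>s. g (2 * s + 0))" by (intro smooth_on_Icc_affine) auto
      then show ?thesis by (rule smooth_on_Icc_cong) (use 1 in \<open>auto simp: joinpaths_def\<close>)
    next
      case 2
      have "{2 * a-1<..<2 * b-1} \<inter> T = {}"
      proof safe
        fix x assume x: "x \<in> {2 * a-1<..<2 * b-1}" "x \<in> T"
        then have "(x+1)/2 \<in> R" using R2[of "(x+1)/2"] 2 by (auto simp: field_simps)
        moreover have "(x+1)/2 \<in> {a<..<b}" using x by auto
        ultimately show "x \<in> {}" using ab by blast
      qed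
      then have "smooth_on_Icc (2 * a-1) (2 * b-1) h" using ab 2 R2 by (intro Ts) auto
      then have "smooth_on_Icc a b (\<lambda>s. h (2 * s + (-1)))" by (intro smooth_on_Icc_affine) auto
      then show ?thesis
      proof (rule smooth_on_Icc_cong)
        fix s assume "s \<in> {a..b}"
        then show "h (2 * s + (-1)) = (g +++ h) s"
          using 2 assms(3) by (cases "s = 1/2") (auto simp: joinpaths_def simp del: eq_divide_eq_numeral1)
      qed
    qed
  qed
qed

lemma traces_join:
  assumes g: "traces g I n" and h: "traces h J m" and gh: "pathfinish g = pathstart h"
  shows "traces (g +++ h) (\<lambda>f. I f + J f) (\<lambda>p. n p + m p)"
proof -
  obtain S D where S: "finite S" "\<And>s. s \<in> {0..1} - S \<Longrightarrow> (g has_vector_derivative D s) (at s)"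
    and I: "\<And>f. continuous_on UNIV f \<Longrightarrow> ((\<lambda>s. f (g s) * norm (D s)) has_integral I f) {0..1}"
    using g unfolding traces_def by blast
  obtain T E where T: "finite T" "\<And>s. s \<in> {0..1} - T \<Longrightarrow> (h has_vector_derivative E s) (at s)"
    and J: "\<And>f. continuous_on UNIV f \<Longrightarrow> ((\<lambda>s. f (h s) * norm (E s)) has_integral J f) {0..1}"
    using h unfolding traces_def by blast
  define F where "F s = (if s \<le> 1/2 then 2 *\<^sub>R D (2 * s) else 2 *\<^sub>R E (2 * s - 1))" for s
  define R where "R = insert (1/2) ((\<lambda>s. s / 2) ` S \<union> (\<lambda>s. (s + 1) / 2) ` T)"
  have der: "((g +++ h) has_vector_derivative F s) (at s)" if s: "s \<in> {0..1} - R" for s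
  proof (cases "s < 1/2")
    case True
    have "2 * s \<notin> S"
    proof
      assume "2 * s \<in> S"
      then have "2 * s / 2 \<in> R" unfolding R_def by blast
      then show False using s by simp
    qed
    then have "(g has_vector_derivative D (2 * s)) (at (2 * s))" using s True by (intro S) auto
    moreover have "((\<lambda>s::real. 2 * s) has_vector_derivative 2) (at s)"
      by (auto intro!: derivative_eq_intros)
    ultimately have "((g \<circ> (\<lambda>s. 2 * s)) has_vector_derivative 2 *\<^sub>R D (2 * s)) (at s)"
      by (intro vector_diff_chain_at) auto
    then have "((g +++ h) has_vector_derivative 2 *\<^sub>R D (2 * s)) (at s)"
      by (rule has_vector_derivative_transform_within_open[of _ _ _ "{..<1/2}"])
         (use True in \<open>auto simp: joinpaths_def\<close>)
    then show ?thesis using True by (simp add: F_def)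
  next
    case False
    then have s2: "s > 1/2" using s by (cases "s = 1/2") (auto simp: R_def)
    have "2 * s - 1 \<notin> T"
    proof
      assume "2 * s - 1 \<in> T"
      then have "((2 * s - 1) + 1) / 2 \<in> R" unfolding R_def by blast
      then show False using s by simp
    qed
    then have "(h has_vector_derivative E (2 * s-1)) (at (2 * s-1))" using s s2 by (intro T) auto
    moreover have "((\<lambda>s::real. 2 * s - 1) has_vector_derivative 2) (at s)"
      by (auto intro!: derivative_eq_intros)
    ultimately have "((h \<circ> (\<lambda>s. 2 * s - 1)) has_vector_derivative 2 *\<^sub>R E (2 * s-1)) (at s)"
      by (intro vector_diff_chain_at) auto
    then have "((g +++ h) has_vector_derivative 2 *\<^sub>R E (2 * s - 1)) (at s)"
      by (rule has_vector_derivative_transform_within_open[of _ _ _ "{1/2<..}"])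
         (use s2 in \<open>auto simp: joinpaths_def\<close>)
    then show ?thesis using s2 by (simp add: F_def)
  qed
  have int: "((\<lambda>s. f ((g +++ h) s) * norm (F s)) has_integral I f + J f) {0..1}"
    if f: "continuous_on UNIV f" for f
  proof (rule has_integral_combine[where c = "1/2"])
    have "((\<lambda>s. f (g (2 * s + 0)) * norm (D (2 * s + 0))) has_integral (1 / \<bar>2\<bar>) *\<^sub>R I f) ((\<lambda>s. (1/2) * s + - ((1/2) * 0)) ` {0..1})"
      using has_integral_affinity[of "\<lambda>s. f (g s) * norm (D s)" "I f" 0 1 2 0] I[OF f] by simp
    moreover have "(\<lambda>s. (1/2) * s + - ((1/2) * 0)) ` {0..1} = {0..1/2::real}" by (auto simp: image_iff intro!: bexI[of _ "2 * _"])
    ultimately have "((\<lambda>s. 2 * (f (g (2 * s)) * norm (D (2 * s)))) has_integral 2 * (I f / 2)) {0..1/2}"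
      by (intro has_integral_mult_right) simp
    then show "((\<lambda>s. f ((g +++ h) s) * norm (F s)) has_integral I f) {0..1/2}"
      by (rule has_integral_eq_rhs[OF has_integral_eq, rotated]) (auto simp: F_def joinpaths_def)
  next
    have "((\<lambda>s. f (h (2 * s + -1)) * norm (E (2 * s + -1))) has_integral (1 / \<bar>2\<bar>) *\<^sub>R J f) ((\<lambda>s. (1/2) * s + - ((1/2) * - 1)) ` {0..1})"
      using has_integral_affinity[of "\<lambda>s. f (h s) * norm (E s)" "J f" 0 1 2 "-1"] J[OF f] by simp
    moreover have "(\<lambda>s. (1/2) * s + - ((1/2) * - 1)) ` {0..1} = {1/2..1::real}"
      by (auto simp: image_iff field_simps intro!: bexI[of _ "2 * _ - 1"])
    ultimately have 1: "((\<lambda>s. 2 * (f (h (2 * s - 1)) * norm (E (2 * s - 1)))) has_integral 2 * (J f / 2)) {1/2..1}"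
      by (intro has_integral_mult_right) simp
    have "((\<lambda>s. f ((g +++ h) s) * norm (F s)) has_integral 2 * (J f / 2)) {1/2..1}"
      by (rule has_integral_spike_finite[OF _ _ 1, of "{1/2}"]) (auto simp: F_def joinpaths_def)
    then show "((\<lambda>s. f ((g +++ h) s) * norm (F s)) has_integral J f) {1/2..1}" by simp
  qed auto
  have cnt: "finite {s \<in> {0..<1}. (g +++ h) s = p} \<and> card {s \<in> {0..<1}. (g +++ h) s = p} = n p + m p" for p
  proof -
    have eq: "{s \<in> {0..<1}. (g +++ h) s = p} =
       (\<lambda>s. s / 2) ` {s \<in> {0..<1}. g s = p} \<union> (\<lambda>s. (s + 1) / 2) ` {s \<in> {0..<1}. h s = p}" (is "?L = ?A \<union> ?B")
    proof (intro equalityI subsetI)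
      fix s assume s: "s \<in> ?L"
      show "s \<in> ?A \<union> ?B"
      proof (cases "s < 1/2")
        case True
        then show ?thesis using s by (auto simp: joinpaths_def image_iff mult.commute intro!: bexI[of _ "2 * s"])
      next
        case False
        then have "(g +++ h) s = h (2 * s-1)" using gh
          by (cases "s = 1/2") (auto simp: joinpaths_def pathfinish_def pathstart_def simp del: eq_divide_eq_numeral1)
        then have "s = ((2 * s - 1) + 1) / 2" "2 * s - 1 \<in> {s \<in> {0..<1}. h s = p}" using s False by auto
        then have "s \<in> ?B" by (rule image_eqI)
        then show ?thesis by blast
      qed
    next
      fix s assume "s \<in> ?A \<union> ?B"
      then consider u where "u \<in> {0..<1}" "g u = p" "s = u/2" | u where "u \<in> {0..<1}" "h u = p" "s = (u+1)/2" by blast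
      then show "s \<in> ?L"
      proof cases
        case 1 then show ?thesis by (auto simp: joinpaths_def mult.commute)
      next
        case 2
        have "(2 * u + 2) / 2 - 1 = u" by (simp add: field_simps)
        then have "(g +++ h) ((u + 1) / 2) = h u" using gh 2(1)
          by (cases "u = 0") (auto simp: joinpaths_def pathfinish_def pathstart_def)
        then show ?thesis unfolding 2(3) using 2(1,2) by auto
      qed
    qed
    have fin: "finite {s \<in> {0..<1}. g s = p}" "finite {s \<in> {0..<1}. h s = p}"
      "card {s \<in> {0..<1}. g s = p} = n p" "card {s \<in> {0..<1}. h s = p} = m p"
      using g h unfolding traces_def by auto
    have "?A \<inter> ?B = {}" by (auto simp: field_simps)
    then have "card (?A \<union> ?B) = card ?A + card ?B" using fin by (intro card_Un_disjoint) auto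
    moreover have "card ?A = n p" using fin by (subst card_image) (auto simp: inj_on_def)
    moreover have "card ?B = m p" using fin by (subst card_image) (auto simp: inj_on_def)
    ultimately show ?thesis unfolding eq using fin by auto
  qed
  have "path_image (g +++ h) \<subseteq> sphere 0 1"
    using g h path_image_join_subset[of g h] unfolding traces_def by blast
  moreover have "path (g +++ h)" using g h gh unfolding traces_def by auto
  moreover have "piecewise_smooth (g +++ h)"
    using g h gh unfolding traces_def pathfinish_def pathstart_def by (auto intro: piecewise_smooth_join)
  moreover have "finite R" using S T by (simp add: R_def)
  ultimately show ?thesis unfolding traces_def using der int cnt by blast
qed

section \<open>Arcs of circles and Euler tours\<close>

lemma norm_circle_point:
  assumes "circle_frame C" shows "norm (circle_point C u) = 1"
proof (cases C)
  case (fields p a b)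
  have o: "p \<bullet> a = 0" "p \<bullet> b = 0" "a \<bullet> b = 0" "norm b = norm a" "(norm p)\<^sup>2 + (norm a)\<^sup>2 = 1"
    using assms fields by auto
  have bb: "b \<bullet> b = a \<bullet> a" using o(4) by (simp flip: power2_norm_eq_inner)
  have o': "a \<bullet> p = 0" "b \<bullet> p = 0" "b \<bullet> a = 0" using o by (simp_all only: inner_commute)
  have "(norm (circle_point C u))\<^sup>2 = (norm p)\<^sup>2 + ((cos u)\<^sup>2 * (norm a)\<^sup>2 + (sin u)\<^sup>2 * (norm a)\<^sup>2)"
    unfolding fields power2_norm_eq_inner
    by (simp add: inner_add_left inner_add_right o(1-3) o' bb power2_eq_square)
  also have "\<dots> = 1" using o(5) by (simp flip: distrib_right)
  finally show ?thesis by (metis norm_ge_zero one_power2 power2_eq_imp_eq zero_le_one)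
qed

lemma circle_point_has_derivative:
  assumes "circle_frame C"
  shows "\<exists>D. \<forall>u. (circle_point C has_vector_derivative D u) (at u) \<and> norm (D u) = circle_radius C"
proof (cases C)
  case (fields p a b)
  define D where "D u = cos u *\<^sub>R b - sin u *\<^sub>R a" for u
  have o: "a \<bullet> b = 0" "norm b = norm a" using assms fields by auto
  have n: "norm (D u) = norm a" for u
  proof -
    have bb: "b \<bullet> b = a \<bullet> a" using o(2) by (simp flip: power2_norm_eq_inner)
    have o': "b \<bullet> a = 0" using o by (simp only: inner_commute)
    have "(norm (D u))\<^sup>2 = (cos u)\<^sup>2 * (norm a)\<^sup>2 + (sin u)\<^sup>2 * (norm a)\<^sup>2"
      unfolding D_def power2_norm_eq_inner
      by (simp add: inner_diff_left inner_diff_right o(1) o' bb power2_eq_square)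
    also have "\<dots> = (norm a)\<^sup>2" by (simp flip: distrib_right)
    finally show ?thesis by (metis norm_ge_zero power2_eq_imp_eq)
  qed
  have d: "(circle_point C has_vector_derivative D u) (at u)" for u
    unfolding fields circle_point.simps[abs_def] D_def
    by (auto intro!: derivative_eq_intros has_vector_derivative_scaleR[THEN has_vector_derivative_eq_rhs])
  show ?thesis using n d fields by (intro exI[of _ D]) simp
qed

lemma continuous_circle_point: "continuous_on S (circle_point C)"
  by (cases C) (auto simp: circle_point.simps[abs_def] intro!: continuous_intros)

lemma circle_point_periodic: "circle_point C (u + 2 * pi * of_int n) = circle_point C u"
proof -
  have "sin (u + 2 * pi * of_int n) = sin u \<and> cos (u + 2 * pi * of_int n) = cos u"
    using sin_cos_eq_iff by blast
  then show ?thesis by (cases C) simp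
qed

lemma circle_point_eq_iff:
  assumes "circle_frame C"
  shows "circle_point C u = circle_point C v \<longleftrightarrow> (\<exists>n::int. u = v + 2 * pi * of_int n)"
proof
  assume eq: "circle_point C u = circle_point C v"
  obtain p a b where C: "C = (p, a, b)" by (cases C)
  have o: "a \<bullet> b = 0" "norm a > 0" "norm b = norm a" using assms C by auto
  have e: "cos u *\<^sub>R a + sin u *\<^sub>R b = cos v *\<^sub>R a + sin v *\<^sub>R b" using eq C by simp
  have "(cos u *\<^sub>R a + sin u *\<^sub>R b) \<bullet> a = (cos v *\<^sub>R a + sin v *\<^sub>R b) \<bullet> a"
       "(cos u *\<^sub>R a + sin u *\<^sub>R b) \<bullet> b = (cos v *\<^sub>R a + sin v *\<^sub>R b) \<bullet> b" using e by auto
  then have "cos u = cos v" "sin u = sin v"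
    using o by (auto simp: inner_add inner_commute)
  then show "\<exists>n::int. u = v + 2 * pi * of_int n" using sin_cos_eq_iff by blast
qed (auto simp: circle_point_periodic)

lemma turn_reduction:
  fixes u a :: real obtains n :: int where "u + 2 * pi * of_int n \<in> {a..<a + 2 * pi}"
proof
  define m where "m = \<lfloor>(u - a) / (2 * pi)\<rfloor>"
  have "of_int m \<le> (u - a) / (2 * pi)" "(u - a) / (2 * pi) < of_int m + 1" unfolding m_def by linarith+
  then have "of_int m * (2 * pi) \<le> u - a" "u - a < (of_int m + 1) * (2 * pi)"
    by (simp_all add: field_simps)
  then show "u + 2 * pi * of_int (- m) \<in> {a..<a + 2 * pi}" by (simp add: algebra_simps)
qed

lemma finite_circle_point_fibre:
  assumes "circle_frame C"
  shows "finite (fibre C a b p)"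
proof (cases "\<exists>v. circle_point C v = p")
  case True
  then obtain v where v: "circle_point C v = p" by blast
  have "(fibre C a b p) \<subseteq>
    (\<lambda>n::int. v + 2 * pi * of_int n) ` {\<lfloor>(a - v) / (2 * pi)\<rfloor>..\<lceil>(b - v) / (2 * pi)\<rceil>}"
  proof
    fix u assume u: "u \<in> (fibre C a b p)"
    then obtain n :: int where n: "u = v + 2 * pi * of_int n"
      using v circle_point_eq_iff[OF assms, of u v] by auto
    have "a - v \<le> of_int n * (2 * pi)" "of_int n * (2 * pi) \<le> b - v"
      using u unfolding n by (simp_all add: mult.commute)
    then have "(a - v) / (2 * pi) \<le> of_int n" "of_int n \<le> (b - v) / (2 * pi)"
      by (simp_all only: pos_divide_le_eq pos_le_divide_eq mult_pos_pos pi_gt_zero zero_less_numeral)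
    then have "\<lfloor>(a - v) / (2 * pi)\<rfloor> \<le> n" "n \<le> \<lceil>(b - v) / (2 * pi)\<rceil>"
      by linarith+
    then have "n \<in> {\<lfloor>(a - v) / (2 * pi)\<rfloor>..\<lceil>(b - v) / (2 * pi)\<rceil>}" by simp
    then show "u \<in> (\<lambda>n::int. v + 2 * pi * of_int n) ` {\<lfloor>(a - v) / (2 * pi)\<rfloor>..\<lceil>(b - v) / (2 * pi)\<rceil>}"
      using n by blast
  qed
  then show ?thesis by (rule finite_subset) auto
qed auto

lemma card_circle_point_fibre_turn:
  assumes "circle_frame C"
  shows "card (fibre C a (a + 2 * pi) p) = (if p \<in> range (circle_point C) then 1 else 0)"
proof (cases "p \<in> range (circle_point C)")
  case True
  then obtain v where v: "circle_point C v = p" by blast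
  obtain n :: int where n: "v + 2 * pi * of_int n \<in> {a..<a + 2 * pi}" using turn_reduction by blast
  have "(fibre C a (a + 2 * pi) p) = {v + 2 * pi * of_int n}" (is "?L = ?R")
  proof
    show "?L \<subseteq> ?R"
    proof
      fix u assume u: "u \<in> ?L"
      then obtain k :: int where k: "u = (v + 2 * pi * of_int n) + 2 * pi * of_int k"
        using v circle_point_eq_iff[OF assms, of u "v + 2 * pi * of_int n"] circle_point_periodic[of C v n] by auto
      have "2 * pi * of_int k < 2 * pi * 1" "2 * pi * (-1) < 2 * pi * of_int k"
        using u n unfolding k mem_Collect_eq atLeastLessThan_iff by linarith+
      then have "of_int k < (1::real)" "-1 < (of_int k :: real)"
        using mult_less_cancel_left_pos[of "2 * pi" "-1" "of_int k"] mult_less_cancel_left_pos[of "2 * pi" "of_int k" 1] by simp_all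
      then have "k = 0" by linarith
      then show "u \<in> ?R" using k by simp
    qed
    show "?R \<subseteq> ?L" using n v circle_point_periodic by auto
  qed
  then show ?thesis using True by simp
next
  case False
  then have "(fibre C a (a + 2 * pi) p) = {}" by auto
  then show ?thesis using False by (simp only: card.empty if_False)
qed

lemma traces_arc:
  assumes C: "circle_frame C" and ab: "a < b"
  shows "traces (\<lambda>s. circle_point C ((b - a) * s + a))
     (\<lambda>f. arc_integral C a b f)
     (\<lambda>p. card (fibre C a b p))"
proof -
  let ?g = "\<lambda>s. circle_point C ((b - a) * s + a)"
  obtain D where D: "\<And>u. (circle_point C has_vector_derivative D u) (at u)"
    and nD: "\<And>u. norm (D u) = circle_radius C"
    using circle_point_has_derivative[OF C] by blast
  have cont: "continuous_on {0..1} ?g"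
    by (rule continuous_on_compose2[OF continuous_circle_point[of UNIV]]) (auto intro!: continuous_intros)
  have "smooth_on_Icc ((b - a) * 0 + a) ((b - a) * 1 + a) (circle_point C)"
    by (rule circle_point_smooth)
  then have "smooth_on_Icc 0 1 ?g" using ab by (intro smooth_on_Icc_affine) auto
  then have ps: "piecewise_smooth ?g" unfolding piecewise_smooth_def
    by (intro exI[of _ "{0,1}"]) auto
  have der: "(?g has_vector_derivative (b - a) *\<^sub>R D ((b - a) * s + a)) (at s)" for s
  proof -
    have "((\<lambda>s. (b - a) * s + a) has_vector_derivative (b - a)) (at s)"
      by (auto intro!: derivative_eq_intros)
    from vector_diff_chain_at[OF this D] show ?thesis by (simp add: o_def)
  qed
  have int: "((\<lambda>s. f (?g s) * norm ((b - a) *\<^sub>R D ((b - a) * s + a))) has_integral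
      arc_integral C a b f) {0..1}"
    if f: "continuous_on UNIV f" for f
  proof -
    have "continuous_on {a..b} (\<lambda>u. f (circle_point C u))"
      by (rule continuous_on_compose2[OF f continuous_circle_point]) auto
    then have "((\<lambda>u. f (circle_point C u)) has_integral integral {a..b} (\<lambda>u. f (circle_point C u))) {a..b}"
      by (intro integrable_integral integrable_continuous_real)
    from has_integral_affinity[of "\<lambda>u. f (circle_point C u)" _ a b "b - a" a] this ab
    have "((\<lambda>s. f (?g s)) has_integral (1 / (b - a)) * integral {a..b} (\<lambda>u. f (circle_point C u)))
       ((\<lambda>x. (1 / (b - a)) *\<^sub>R x + - ((1 / (b - a)) *\<^sub>R a)) ` {a..b})" by simp
    moreover have "(\<lambda>x. (1 / (b - a)) *\<^sub>R x + - ((1 / (b - a)) *\<^sub>R a)) ` {a..b} = {0..1}"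
    proof -
      have "1 / (b - a) * b + - (1 / (b - a) * a) = 1 / (b - a) * (b - a)"
        by (simp only: right_diff_distrib minus_mult_right add_uminus_conv_diff)
      then show ?thesis using ab unfolding real_scaleR_def image_affinity_atLeastAtMost by simp
    qed
    ultimately have "((\<lambda>s. f (?g s)) has_integral (1 / (b - a)) * integral {a..b} (\<lambda>u. f (circle_point C u))) {0..1}" by simp
    from has_integral_mult_right[OF this, of "(b - a) * circle_radius C"]
    show ?thesis using ab by (simp add: nD mult_ac)
  qed
  have cnt: "finite {s \<in> {0..<1}. ?g s = p} \<and> card {s \<in> {0..<1}. ?g s = p} = card (fibre C a b p)" for p
  proof -
    have "bij_betw (\<lambda>s. (b - a) * s + a) {s \<in> {0..<1}. ?g s = p} (fibre C a b p)"
    proof (rule bij_betwI[where g = "\<lambda>u. (u - a) / (b - a)"])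
      show "(\<lambda>s. (b - a) * s + a) \<in> {s \<in> {0..<1}. ?g s = p} \<rightarrow> (fibre C a b p)"
      proof
        fix s assume s: "s \<in> {s \<in> {0..<1}. ?g s = p}"
        then have "(b - a) * s < (b - a) * 1" using ab by (intro mult_strict_left_mono) auto
        then have "(b - a) * s + a < b" by simp
        then show "(b - a) * s + a \<in> (fibre C a b p)" using s ab by auto
      qed
    qed (use ab in \<open>auto simp: divide_simps\<close>)
    from bij_betw_finite[OF this] bij_betw_same_card[OF this]
    show ?thesis using finite_circle_point_fibre[OF C, of a b p] by simp
  qed
  have img: "path_image ?g \<subseteq> sphere 0 1"
    unfolding path_image_def using norm_circle_point[OF C] by (simp add: image_subset_iff)
  show ?thesis unfolding traces_def path_def
  proof (intro conjI)
    show "\<exists>S D. finite S \<and> (\<forall>s\<in>{0..1} - S. (?g has_vector_derivative D s) (at s)) \<and>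
        (\<forall>f. continuous_on UNIV f \<longrightarrow> ((\<lambda>s. f (?g s) * norm (D s)) has_integral
          arc_integral C a b f) {0..1})"
    proof (rule exI[of _ "{}"], rule exI[of _ "\<lambda>s. (b - a) *\<^sub>R D ((b - a) * s + a)"],
        intro conjI ballI allI impI finite.emptyI)
      fix s show "(?g has_vector_derivative (b - a) *\<^sub>R D ((b - a) * s + a)) (at s)" by (rule der)
    next
      fix f :: "real ^ 3 \<Rightarrow> real" assume "continuous_on UNIV f"
      then show "((\<lambda>s. f (?g s) * norm ((b - a) *\<^sub>R D ((b - a) * s + a))) has_integral
          arc_integral C a b f) {0..1}" by (rule int)
    qed
    show "\<forall>p. finite {s \<in> {0..<1}. ?g s = p} \<and> card {s \<in> {0..<1}. ?g s = p} =
        card (fibre C a b p)"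
      by (intro allI cnt)
  qed (rule cont ps img)+
qed

text \<open>
  A list of arcs \<open>(i, a, b)\<close>, each the part of the \<open>i\<close>-th circle between the angles \<open>a\<close> and
  \<open>b\<close>, leading from \<open>x\<close> to \<open>y\<close>.
\<close>

fun chain :: "('i \<Rightarrow> circle) \<Rightarrow> real ^ 3 \<Rightarrow> ('i \<times> real \<times> real) list \<Rightarrow> real ^ 3 \<Rightarrow> bool" where
  "chain C x [] y \<longleftrightarrow> x = y"
| "chain C x ((i, a, b) # A) y \<longleftrightarrow> a < b \<and> circle_point (C i) a = x \<and> chain C (circle_point (C i) b) A y"

lemma chain_append: "chain C x (A @ B) z \<longleftrightarrow> (\<exists>y. chain C x A y \<and> chain C y B z)"
  by (induction A arbitrary: x) auto

lemma chain_traces: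
  assumes "chain C x A y" "A \<noteq> []" "\<forall>e\<in>set A. circle_frame (C (fst e))"
  shows "\<exists>\<gamma>. pathstart \<gamma> = x \<and> pathfinish \<gamma> = y \<and> traces \<gamma>
     (\<lambda>f. \<Sum>(i, a, b)\<leftarrow>A. arc_integral (C i) a b f)
     (\<lambda>p. \<Sum>(i, a, b)\<leftarrow>A. card (fibre (C i) a b p))"
  using assms
proof (induction A arbitrary: x)
  case (Cons e A)
  obtain i a b where e: "e = (i, a, b)" by (cases e)
  let ?g = "\<lambda>s. circle_point (C i) ((b - a) * s + a)"
  have ab: "a < b" and x: "circle_point (C i) a = x" and ch: "chain C (circle_point (C i) b) A y"
    using Cons.prems(1) e by auto
  have fr: "circle_frame (C i)" using Cons.prems(3) e by auto
  note arc = traces_arc[OF fr ab]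
  show ?case
  proof (cases "A = []")
    case True
    have "pathstart ?g = x" "pathfinish ?g = y"
      using ch True x by (simp_all add: pathstart_def pathfinish_def)
    from this arc show ?thesis
      unfolding True e list.map sum_list.Cons sum_list.Nil prod.case add_0_right
      by (intro exI[of _ ?g] conjI)
  next
    case False
    have "\<forall>e\<in>set A. circle_frame (C (fst e))" using Cons.prems(3) by simp
    from Cons.IH[OF ch False this] obtain \<gamma> where \<gamma>: "pathstart \<gamma> = circle_point (C i) b" "pathfinish \<gamma> = y" "traces \<gamma>
      (\<lambda>f. \<Sum>(i, a, b)\<leftarrow>A. arc_integral (C i) a b f)
      (\<lambda>p. \<Sum>(i, a, b)\<leftarrow>A. card (fibre (C i) a b p))" by (elim exE conjE)
    have "pathfinish ?g = pathstart \<gamma>" using \<gamma>(1) by (simp add: pathfinish_def)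
    note join = traces_join[OF arc \<gamma>(3) this]
    have "pathstart (?g +++ \<gamma>) = x" "pathfinish (?g +++ \<gamma>) = y"
      using \<gamma>(2) x by (simp_all add: pathstart_def[of ?g])
    from this join show ?thesis unfolding e list.map sum_list.Cons prod.case
      by (intro exI[of _ "?g +++ \<gamma>"] conjI)
  qed
qed auto

text \<open>
  Connectedness of a finite union of circles, in the form in which a tour is built: each new circle
  meets one that is already there.
\<close>

inductive linked :: "('i \<Rightarrow> circle) \<Rightarrow> 'i set \<Rightarrow> bool" for C where
  single: "linked C {i}"
| attach: "linked C I \<Longrightarrow> i \<in> I \<Longrightarrow> circle_point (C i) u = circle_point (C j) v \<Longrightarrow> linked C (insert j I)"

lemma linked_Un:
  assumes "finite J" "linked C I" "\<And>j. j \<in> J \<Longrightarrow> \<exists>i\<in>I. \<exists>u v. circle_point (C i) u = circle_point (C j) v"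
  shows "linked C (I \<union> J)"
  using assms
proof (induction J)
  case (insert j J)
  then have "linked C (I \<union> J)" by blast
  moreover obtain i u v where "i \<in> I" "circle_point (C i) u = circle_point (C j) v" using insert.prems by blast
  ultimately have "linked C (insert j (I \<union> J))" 
    by (intro linked.attach[of C "I \<union> J" i u j v]) auto
  then show ?case by simp
qed auto

text \<open>
  Functionals of arcs that are additive under subdivision and do not depend on where a full turn
  starts.  Arc length integrals and numbers of visits are of this kind, and a single statement about
  them all survives the splicing of loops in \<open>euler_tour\<close>.
\<close>

definition turn_additive :: "('i \<Rightarrow> real \<Rightarrow> real \<Rightarrow> real) \<Rightarrow> bool" where
  "turn_additive F \<longleftrightarrow> (\<forall>i a b \<gamma>. a < b \<longrightarrow> b < \<gamma> \<longrightarrow> F i a \<gamma> = F i a b + F i b \<gamma>) \<and>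
     (\<forall>i a. F i a (a + 2 * pi) = F i 0 (2 * pi))"

definition fibre_count where
  "fibre_count C p i a b = (if circle_frame (C i) then real (card (fibre (C i) a b p)) else 0)"

lemma turn_additive_fibre_count: "turn_additive (fibre_count C p)"
  unfolding turn_additive_def
proof (intro conjI allI impI)
  fix i and a b \<gamma> :: real assume ab: "a < b" "b < \<gamma>"
  have "(fibre (C i) a \<gamma> p) = (fibre (C i) a b p) \<union> (fibre (C i) b \<gamma> p)"
    using ab by auto
  moreover have "card ((fibre (C i) a b p) \<union> (fibre (C i) b \<gamma> p))
     = card (fibre (C i) a b p) + card (fibre (C i) b \<gamma> p)"
    if "circle_frame (C i)"
    using finite_circle_point_fibre[OF that] by (intro card_Un_disjoint) auto
  ultimately show "fibre_count C p i a \<gamma> = fibre_count C p i a b + fibre_count C p i b \<gamma>"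
    by (simp add: fibre_count_def)
next
  fix i a
  show "fibre_count C p i a (a + 2 * pi) = fibre_count C p i 0 (2 * pi)"
    using card_circle_point_fibre_turn[of "C i" a p] card_circle_point_fibre_turn[of "C i" 0 p]
    unfolding fibre_count_def by simp
qed

text \<open>
  A circle that meets the tour so far at a point \<open>p\<close> is inserted there as a loop: the arc through
  \<open>p\<close> is cut at \<open>p\<close>, and the closed chain is rotated so that it starts at \<open>p\<close>.  Every turn-additive
  functional grows by its value on one full turn of the new circle.
\<close>

lemma euler_tour:
  assumes "linked C I" "\<And>i. i \<in> I \<Longrightarrow> circle_frame (C i)"
  shows "finite I \<and> (\<exists>x A. A \<noteq> [] \<and> chain C x A x \<and> fst ` set A \<subseteq> I \<and>
    (\<forall>F. turn_additive F \<longrightarrow> (\<Sum>(i, a, b)\<leftarrow>A. F i a b) = (\<Sum>i\<in>I. F i 0 (2 * pi))))"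
  using assms
proof (induction I rule: linked.induct)
  case (single i)
  have "circle_point (C i) (2 * pi) = circle_point (C i) 0"
    using circle_point_periodic[of "C i" 0 1] by simp
  then show ?case
    by (intro conjI exI[of _ "circle_point (C i) 0"] exI[of _ "[(i, 0, 2 * pi)]"]) auto
next
  case (attach I i u j v)
  then obtain x A where fin: "finite I" and A: "chain C x A x" "fst ` set A \<subseteq> I"
    and FA: "\<And>F. turn_additive F \<Longrightarrow> (\<Sum>(i, a, b)\<leftarrow>A. F i a b) = (\<Sum>i\<in>I. F i 0 (2 * pi))" and A0: "A \<noteq> []"
    by auto
  show ?case
  proof (cases "j \<in> I")
    case True
    then have "insert j I = I" by blast
    show ?thesis unfolding \<open>insert j I = I\<close>
      by (intro conjI exI[of _ x] exI[of _ A] allI impI) (rule fin A0 A FA | assumption)+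
  next
    case False
    define p where "p = circle_point (C j) v"
    have "(\<Sum>(i, a, b)\<leftarrow>A. fibre_count C p i a b) = (\<Sum>i\<in>I. fibre_count C p i 0 (2 * pi))"
      by (rule FA[OF turn_additive_fibre_count])
    moreover have "(\<Sum>i\<in>I. fibre_count C p i 0 (2 * pi)) \<ge> fibre_count C p i 0 (2 * pi)"
      using fin attach.hyps by (intro member_le_sum) (auto simp: fibre_count_def)
    moreover have "p \<in> range (circle_point (C i))"
      unfolding p_def using attach.hyps(3) by (metis rangeI)
    then have "fibre_count C p i 0 (2 * pi) = 1"
      using card_circle_point_fibre_turn[of "C i" 0 p] attach.hyps attach.prems[of i]
      by (simp add: fibre_count_def)
    ultimately have "(\<Sum>(i, a, b)\<leftarrow>A. fibre_count C p i a b) \<noteq> 0" by linarith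
    moreover have "(\<Sum>(i, a, b)\<leftarrow>A. fibre_count C p i a b) = (\<Sum>e\<leftarrow>A. 0)"
      if "\<forall>(k, a, b)\<in>set A. fibre_count C p k a b = 0"
      using that by (intro arg_cong[where f = sum_list] map_cong) auto
    ultimately have "\<exists>(k, a, b)\<in>set A. fibre_count C p k a b \<noteq> 0" by fastforce
    then obtain k a b where k: "(k, a, b) \<in> set A" "fibre_count C p k a b \<noteq> 0" by blast
    then have "(fibre (C k) a b p) \<noteq> {}"
      unfolding fibre_count_def by (metis card.empty of_nat_0)
    then obtain w where w: "a \<le> w" "w < b" "circle_point (C k) w = p" by auto
    obtain A1 A2 where A12: "A = A1 @ (k, a, b) # A2" using k(1) by (meson split_list)
    obtain y where y: "chain C x A1 y" "circle_point (C k) a = y" "chain C (circle_point (C k) b) A2 x"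
      using A(1) unfolding A12 chain_append by auto
    have per: "circle_point (C j) (v + 2 * pi) = p"
      using circle_point_periodic[of "C j" v 1] p_def by simp
    \<comment> \<open>If \<open>p\<close> is already the start of its arc, no cut is made: arcs must not be degenerate.\<close>
    define T where "T = (if w = a then [] else [(k, a, w)])"
    define B where "B = (j, v, v + 2 * pi) # (k, w, b) # A2 @ A1 @ T"
    have "chain C y T p" using w y by (auto simp: T_def)
    then have ch: "chain C p B p"
      unfolding B_def using w per y by (auto simp: chain_append p_def)
    have BI: "fst ` set B \<subseteq> insert j I" using A(2) unfolding B_def A12 T_def by auto
    have BF: "(\<Sum>(i, a, b)\<leftarrow>B. F i a b) = (\<Sum>i\<in>insert j I. F i 0 (2 * pi))" if F: "turn_additive F" for F
    proof -
      have "F k a b = F k w b + (\<Sum>(i, a, b)\<leftarrow>T. F i a b)"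
        using F[unfolded turn_additive_def, THEN conjunct1, rule_format, of a w b k] w(1,2)
        by (cases "w = a") (simp_all add: T_def)
      then have "(\<Sum>(i, a, b)\<leftarrow>B. F i a b) = F j v (v + 2 * pi) + (\<Sum>(i, a, b)\<leftarrow>A. F i a b)"
        unfolding B_def A12 by simp
      then show ?thesis using FA[OF F] F fin False unfolding turn_additive_def by simp
    qed
    have B0: "B \<noteq> []" by (simp add: B_def)
    have "finite (insert j I)" using fin by simp
    then show ?thesis
      by (intro conjI exI[of _ p] exI[of _ B] allI impI) (rule B0 ch BI BF | assumption)+
  qed
qed

lemma integral_full_period:
  fixes f :: "real \<Rightarrow> real"
  assumes cont: "continuous_on UNIV f" and per: "\<And>u (n::int). f (u + 2 * pi * of_int n) = f u"
  shows "integral {\<alpha>..\<alpha> + 2 * pi} f = integral {0..2 * pi} f"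
proof -
  have c: "continuous_on S f" for S using cont continuous_on_subset by blast
  have shift: "integral {a + 2 * pi * of_int n..b + 2 * pi * of_int n} f = integral {a..b} f" for a b and n :: int
    using integral_shift[OF c, of a b "2 * pi * of_int n"] by (simp add: o_def per)
  have comb: "integral {a..b} f + integral {b..d} f = integral {a..d} f" if "a \<le> b" "b \<le> d" for a b d
    using that by (intro Henstock_Kurzweil_Integration.integral_combine integrable_continuous_real c) auto
  obtain n :: int where n: "\<alpha> + 2 * pi * of_int n \<in> {0..<0 + 2 * pi}" using turn_reduction by blast
  define a where "a = \<alpha> + 2 * pi * of_int n"
  have "integral {\<alpha>..\<alpha> + 2 * pi} f = integral {a..a + 2 * pi} f"
    using shift[of \<alpha> n "\<alpha> + 2 * pi"] unfolding a_def by (simp add: algebra_simps)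
  also have "\<dots> = integral {a..2 * pi} f + integral {2 * pi..a + 2 * pi} f"
    using n by (intro comb[symmetric]) (auto simp: a_def)
  also have "integral {2 * pi..a + 2 * pi} f = integral {0..a} f"
    using shift[of 0 1 a] by simp
  also have "integral {a..2 * pi} f + integral {0..a} f = integral {0..2 * pi} f"
    using comb[of 0 a "2 * pi"] n by (auto simp: a_def)
  finally show ?thesis .
qed

lemma turn_additive_circle_integral:
  assumes f: "continuous_on UNIV f"
  shows "turn_additive (\<lambda>i a b. arc_integral (C i) a b f)"
proof -
  have c: "continuous_on S (\<lambda>u. f (circle_point (C i) u))" for S i
    by (rule continuous_on_compose2[OF f continuous_circle_point]) auto
  show ?thesis unfolding turn_additive_def
  proof (intro conjI allI impI)
    fix i and a b \<gamma> :: real assume ab: "a < b" "b < \<gamma>"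
    have "integral {a..b} (\<lambda>u. f (circle_point (C i) u)) + integral {b..\<gamma>} (\<lambda>u. f (circle_point (C i) u))
      = integral {a..\<gamma>} (\<lambda>u. f (circle_point (C i) u))"
      using ab by (intro Henstock_Kurzweil_Integration.integral_combine integrable_continuous_real c) auto
    then show "arc_integral (C i) a \<gamma> f =
      arc_integral (C i) a b f +
      arc_integral (C i) b \<gamma> f"
      by (simp flip: distrib_left)
  next
    fix i a
    show "arc_integral (C i) a (a + 2 * pi) f =
      arc_integral (C i) 0 (2 * pi) f"
      by (subst integral_full_period[OF c]) (simp_all add: circle_point_periodic)
  qed
qed

text \<open>
  By the tour, a point is visited as many times as there are circles through it, so every multiple
  point lies on two different circles.
\<close>

theorem circles_tour:
  assumes link: "linked C I" and frame: "\<And>i. i \<in> I \<Longrightarrow> circle_frame (C i)"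
    and cross: "\<And>i j. i \<in> I \<Longrightarrow> j \<in> I \<Longrightarrow> i \<noteq> j \<Longrightarrow>
       finite (range (circle_point (C i)) \<inter> range (circle_point (C j)))"
  shows "\<exists>\<gamma>. closed_sphere_curve \<gamma> \<and> curve_length \<gamma> = 2 * pi * (\<Sum>i\<in>I. circle_radius (C i)) \<and>
     (\<forall>f. continuous_on UNIV f \<longrightarrow>
        curve_integral \<gamma> f = (\<Sum>i\<in>I. arc_integral (C i) 0 (2 * pi) f))"
proof -
  from euler_tour[OF link frame] obtain x A where fin: "finite I" and A: "A \<noteq> []" "chain C x A x" "fst ` set A \<subseteq> I"
    and FA: "\<And>F. turn_additive F \<Longrightarrow> (\<Sum>(i, a, b)\<leftarrow>A. F i a b) = (\<Sum>i\<in>I. F i 0 (2 * pi))"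
    by auto
  define J where "J f = (\<Sum>i\<in>I. arc_integral (C i) 0 (2 * pi) f)" for f
  have frA: "\<forall>e\<in>set A. circle_frame (C (fst e))" using A(3) frame by auto
  from chain_traces[OF A(2,1) frA] obtain \<gamma> where \<gamma>: "pathstart \<gamma> = x" "pathfinish \<gamma> = x" "traces \<gamma>
     (\<lambda>f. \<Sum>(i, a, b)\<leftarrow>A. arc_integral (C i) a b f)
     (\<lambda>p. \<Sum>(i, a, b)\<leftarrow>A. card (fibre (C i) a b p))"
    by (elim exE conjE)
  from \<gamma>(3) obtain S D where S: "finite S" "\<forall>s\<in>{0..1} - S. (\<gamma> has_vector_derivative D s) (at s)"
    and int0: "\<forall>f. continuous_on UNIV f \<longrightarrow> ((\<lambda>s. f (\<gamma> s) * norm (D s)) has_integral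
       (\<Sum>(i, a, b)\<leftarrow>A. arc_integral (C i) a b f)) {0..1}"
    unfolding traces_def by (elim exE conjE)
  have int: "curve_integral \<gamma> f = J f" if f: "continuous_on UNIV f" for f
  proof -
    have "((\<lambda>s. f (\<gamma> s) * norm (D s)) has_integral J f) {0..1}"
      using int0[rule_format, OF f] FA[OF turn_additive_circle_integral[OF f]] unfolding J_def by simp
    then have "((\<lambda>s. f (\<gamma> s) * norm (vector_derivative \<gamma> (at s within {0..1}))) has_integral J f) {0..1}"
    proof (rule has_integral_spike_finite[rotated -1])
      show "finite (S \<union> {0, 1})" using S by simp
      fix s assume s: "s \<in> {0..1} - (S \<union> {0, 1})"
      then have "(\<gamma> has_vector_derivative D s) (at s)" using S by simp
      then have "(\<gamma> has_vector_derivative D s) (at s within {0..1})"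
        by (rule has_vector_derivative_at_within)
      then have "vector_derivative \<gamma> (at s within {0..1}) = D s"
        using s by (intro vector_derivative_within_closed_interval) auto
      then show "f (\<gamma> s) * norm (vector_derivative \<gamma> (at s within {0..1})) = f (\<gamma> s) * norm (D s)" by simp
    qed
    then show ?thesis unfolding curve_integral_def by (rule integral_unique)
  qed
  have len: "curve_length \<gamma> = 2 * pi * (\<Sum>i\<in>I. circle_radius (C i))"
    using int[of "\<lambda>_. 1"] unfolding curve_integral_def curve_length_def J_def
    by (simp add: sum_distrib_left mult_ac)
  have rpos: "circle_radius (C i) > 0" if "i \<in> I" for i
    using frame[OF that] by (cases "C i") auto
  have "I \<noteq> {}" using link by (cases rule: linked.cases) auto
  then have pos: "curve_length \<gamma> > 0" unfolding len using fin rpos by (intro mult_pos_pos sum_pos) auto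
  have count: "finite {s \<in> {0..<1}. \<gamma> s = p} \<and> card {s \<in> {0..<1}. \<gamma> s = p} = card {i \<in> I. p \<in> range (circle_point (C i))}" for p
  proof -
    have "real (\<Sum>(i, a, b)\<leftarrow>A. card (fibre (C i) a b p)) = (\<Sum>(i, a, b)\<leftarrow>A. fibre_count C p i a b)"
      using frA by (induction A) (auto simp: fibre_count_def)
    also have "\<dots> = (\<Sum>i\<in>I. fibre_count C p i 0 (2 * pi))" by (rule FA[OF turn_additive_fibre_count])
    also have "\<dots> = (\<Sum>i\<in>I. if p \<in> range (circle_point (C i)) then 1 else 0)"
    proof (rule sum.cong[OF refl])
      fix i assume "i \<in> I"
      then show "fibre_count C p i 0 (2 * pi) = (if p \<in> range (circle_point (C i)) then 1 else 0)"
        using card_circle_point_fibre_turn[of "C i" 0 p] frame[of i] by (simp add: fibre_count_def)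
    qed
    also have "\<dots> = real (card {i \<in> I. p \<in> range (circle_point (C i))})"
      using fin by (simp add: sum.If_cases Int_def)
    finally show ?thesis using \<gamma>(3) unfolding traces_def by (metis (no_types, lifting) of_nat_eq_iff)
  qed
  have "{p \<in> \<gamma> ` {0..<1}. \<not> (\<exists>!s. s \<in> {0..<1} \<and> \<gamma> s = p)} \<subseteq>
     (\<Union>(i, j)\<in>{(i, j). i \<in> I \<and> j \<in> I \<and> i \<noteq> j}. range (circle_point (C i)) \<inter> range (circle_point (C j)))"
  proof
    fix p assume p: "p \<in> {p \<in> \<gamma> ` {0..<1}. \<not> (\<exists>!s. s \<in> {0..<1} \<and> \<gamma> s = p)}"
    let ?K = "{i \<in> I. p \<in> range (circle_point (C i))}"
    have "card {s \<in> {0..<1}. \<gamma> s = p} \<noteq> 1"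
    proof
      assume "card {s \<in> {0..<1}. \<gamma> s = p} = 1"
      then obtain s where "{s \<in> {0..<1}. \<gamma> s = p} = {s}" by (rule card_1_singletonE)
      then have "\<And>u. u \<in> {0..<1} \<and> \<gamma> u = p \<longleftrightarrow> u = s" by (metis (mono_tags, lifting) mem_Collect_eq singleton_iff)
      then show False using p by simp
    qed
    moreover have "{s \<in> {0..<1}. \<gamma> s = p} \<noteq> {}" using p by blast
    then have "card {s \<in> {0..<1}. \<gamma> s = p} \<noteq> 0" using count[THEN conjunct1, of p] by (simp only: card_eq_0_iff) simp
    ultimately have "\<not> card ?K \<le> Suc 0" using count[of p] by simp
    then obtain i j where "i \<in> ?K" "j \<in> ?K" "i \<noteq> j"
      using fin card_le_Suc0_iff_eq[of ?K] by auto
    then show "p \<in> (\<Union>(i, j)\<in>{(i, j). i \<in> I \<and> j \<in> I \<and> i \<noteq> j}. range (circle_point (C i)) \<inter> range (circle_point (C j)))"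
      by auto
  qed
  moreover have "finite (\<Union>(i, j)\<in>{(i, j). i \<in> I \<and> j \<in> I \<and> i \<noteq> j}. range (circle_point (C i)) \<inter> range (circle_point (C j)))"
  proof (rule finite_UN_I)
    show "finite {(i, j). i \<in> I \<and> j \<in> I \<and> i \<noteq> j}"
      by (rule finite_subset[of _ "I \<times> I"]) (use fin in auto)
  qed (use cross in auto)
  ultimately have self: "finite {p \<in> \<gamma> ` {0..<1}. \<not> (\<exists>!s. s \<in> {0..<1} \<and> \<gamma> s = p)}"
    by (rule finite_subset)
  have "closed_sphere_curve \<gamma>"
    using \<gamma> self pos unfolding closed_sphere_curve_def traces_def closed_path_def pathstart_def pathfinish_def by simp
  then show ?thesis using len int unfolding J_def by blast
qed

section \<open>Fejer's second quadrature rule\<close>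

lemma sum_cos_arith:
  fixes a h :: real
  shows "2 * sin (h / 2) * (\<Sum>k<n. cos (a + real k * h)) = sin (a + (real n - 1 / 2) * h) - sin (a - h / 2)"
proof (induction n)
  case (Suc n)
  have "2 * sin (h / 2) * cos (a + real n * h) = sin (a + (real n + 1 / 2) * h) - sin (a + (real n - 1 / 2) * h)"
  proof -
    have e: "a + (real n + 1 / 2) * h = (a + real n * h) + h / 2" "a + (real n - 1 / 2) * h = (a + real n * h) - h / 2"
      by (simp_all add: algebra_simps)
    show ?thesis unfolding e sin_add sin_diff by simp
  qed
  then show ?case using Suc by (simp add: distrib_left algebra_simps)
qed (simp add: algebra_simps)

text \<open>
  Partial sums of the Fourier series of a square wave of height \<open>\<pi>/4\<close>.
\<close>

definition odd_sine_sum :: "nat \<Rightarrow> real \<Rightarrow> real" where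
  "odd_sine_sum m x = (\<Sum>k<m. sin (real (2 * k + 1) * x) / real (2 * k + 1))"

lemma odd_sine_sum_has_derivative:
  assumes "sin x \<noteq> 0"
  shows "(odd_sine_sum m has_real_derivative sin (2 * real m * x) / (2 * sin x)) (at x)"
proof -
  have "2 * sin (2 * x / 2) * (\<Sum>k<m. cos (x + real k * (2 * x))) = sin (x + (real m - 1 / 2) * (2 * x)) - sin (x - 2 * x / 2)"
    by (rule sum_cos_arith)
  then have "(\<Sum>k<m. cos (x + real k * (2 * x))) * (2 * sin x) = sin (2 * real m * x)"
    by (simp add: algebra_simps)
  then have "(\<Sum>k<m. cos (x + real k * (2 * x))) = sin (2 * real m * x) / (2 * sin x)"
    using assms by (simp add: eq_divide_eq)
  moreover have "(odd_sine_sum m has_real_derivative (\<Sum>k<m. cos (x + real k * (2 * x)))) (at x)"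
    unfolding odd_sine_sum_def[abs_def]
  proof (rule DERIV_sum)
    fix k
    have "((\<lambda>x. sin (real (2 * k + 1) * x) / real (2 * k + 1)) has_real_derivative
        (cos (real (2 * k + 1) * x) * real (2 * k + 1)) / real (2 * k + 1)) (at x)"
      by (rule DERIV_cdivide) (auto intro!: derivative_eq_intros)
    moreover have "cos (real (2 * k + 1) * x) * real (2 * k + 1) / real (2 * k + 1) = cos (x + real k * (2 * x))"
      by (subst nonzero_mult_div_cancel_right) (simp_all add: algebra_simps)
    ultimately show "((\<lambda>x. sin (real (2 * k + 1) * x) / real (2 * k + 1)) has_real_derivative cos (x + real k * (2 * x))) (at x)"
      by simp
  qed
  ultimately show ?thesis by simp
qed

lemma continuous_odd_sine_sum: "continuous_on A (odd_sine_sum m)"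
  unfolding odd_sine_sum_def[abs_def] by (intro continuous_intros) auto

lemma odd_sine_sum_0 [simp]: "odd_sine_sum m 0 = 0"
  by (simp add: odd_sine_sum_def)

lemma odd_sine_sum_reflect: "odd_sine_sum m (pi - x) = odd_sine_sum m x"
proof -
  have "sin (real (2 * k + 1) * (pi - x)) = sin (real (2 * k + 1) * x)" for k
  proof -
    have "real (2 * k + 1) * (pi - x) = (pi - real (2 * k + 1) * x) + 2 * real k * pi"
      by (simp add: algebra_simps)
    also have "sin \<dots> = sin (pi - real (2 * k + 1) * x)"
      unfolding sin_add[of _ "2 * real k * pi"] sin_2npi cos_2npi by simp
    finally show ?thesis by simp
  qed
  then show ?thesis unfolding odd_sine_sum_def by simp
qed

text \<open>
  The derivative of the partial sum is \<open>sin (2m\<theta>) / (2 sin \<theta>)\<close>, whose sign alternates from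
  one interval between nodes to the next, while the amplitude \<open>1 / (2 sin \<theta>)\<close> decreases up to
  \<open>\<pi>/2\<close>.  So the values at the nodes of even index
  increase, and each value at a node of odd index exceeds the one before it.  It is enough to bound the
  values at the first two nodes; the nodes beyond \<open>\<pi>/2\<close> are covered by symmetry.
\<close>

lemma odd_sine_sum_nodes:
  assumes m: "m > 0" and j: "0 < j" "j < 2 * m"
  shows "odd_sine_sum m (real j * pi / real (2 * m)) \<ge> 1 / 20"
proof -
  define d where "d = pi / real (2 * m)"
  have d0: "d > 0" using m by (simp add: d_def)
  have md: "2 * real m * d = pi" using m by (simp add: d_def)
  have half: "real i * d \<le> pi / 2" if "i \<le> m" for i
  proof -
    have "real i * d \<le> real m * d" using that d0 by simp
    then show ?thesis using md by simp
  qed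
  define S where "S = odd_sine_sum m"
  have S': "(S has_real_derivative sin (2 * real m * x) / (2 * sin x)) (at x)" if "0 < x" "x < pi" for x
    unfolding S_def using sin_gt_zero[OF that] by (intro odd_sine_sum_has_derivative) simp
  have Sc: "continuous_on A S" for A unfolding S_def by (rule continuous_odd_sine_sum)
  have osc: "sin (2 * real m * y) \<ge> 0" if "0 \<le> y" "y \<le> d" for y
  proof (rule sin_ge_zero)
    have "2 * real m * y \<le> 2 * real m * d" using that by (intro mult_left_mono) auto
    then show "2 * real m * y \<le> pi" using md by simp
  qed (use that in simp)
  have shift: "sin (2 * real m * (real i * d + y)) = (-1) ^ i * sin (2 * real m * y)" for i y
  proof -
    have "2 * real m * (real i * d + y) = real i * (2 * real m * d) + 2 * real m * y" by (simp add: algebra_simps)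
    then show ?thesis by (simp only: md sin_add sin_npi cos_npi mult_zero_left add_0_left)
  qed
  \<comment> \<open>An ascending step, on which the derivative is nonnegative.\<close>
  have odd: "S (real (2 * i) * d) \<le> S (real (2 * i + 1) * d)" if "2 * i + 1 \<le> m" for i
  proof -
    have "S (real (2 * i) * d + 0) \<le> S (real (2 * i) * d + d)"
    proof (rule DERIV_nonneg_imp_increasing_open[of 0 d "\<lambda>y. S (real (2 * i) * d + y)"])
      fix y assume y: "0 < y" "y < d"
      let ?x = "real (2 * i) * d + y"
      have x: "0 < ?x" "?x < pi"
      proof -
        show "0 < ?x" using y d0 by (intro add_nonneg_pos) auto
        have "?x < real (2 * i + 1) * d" using y by (simp add: algebra_simps)
        then show "?x < pi" using half[OF that] pi_gt_zero by linarith
      qed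
      have "((\<lambda>y. S (real (2 * i) * d + y)) has_real_derivative sin (2 * real m * ?x) / (2 * sin ?x) * 1) (at y)"
        by (rule DERIV_chain2[where f = S and g = "\<lambda>y. real (2 * i) * d + y"], rule S'[OF x]) (auto intro!: derivative_eq_intros)
      moreover have "sin (2 * real m * ?x) / (2 * sin ?x) * 1 \<ge> 0"
        using osc[of y] y sin_gt_zero[OF x] unfolding shift by simp
      ultimately show "\<exists>D. ((\<lambda>y. S (real (2 * i) * d + y)) has_real_derivative D) (at y) \<and> 0 \<le> D" by blast
    next
      show "continuous_on {0..d} (\<lambda>y. S (real (2 * i) * d + y))"
        by (rule continuous_on_compose2[OF Sc[of UNIV]]) (auto intro!: continuous_intros)
    qed (use d0 in simp)
    then show ?thesis by (simp add: algebra_simps)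
  qed
  \<comment> \<open>An ascending step and the next descending one, compared at equal distances \<open>y\<close> from their
    starting points.\<close>
  have pair: "S (real (2 * i) * d) + 2 * c / (2 * real m) \<le> S (real (2 * i + 2) * d)"
    if i: "2 * i + 2 \<le> m" and
      gap: "\<And>y. 0 < y \<Longrightarrow> y < d \<Longrightarrow> 2 * c \<le> 1 / sin (real (2 * i) * d + y) - 1 / sin (real (2 * i) * d + y + d)" for i c
  proof -
    let ?a = "real (2 * i) * d"
    define G where "G y = S (?a + y) + S (?a + d + y) + c * cos (2 * real m * y) / (2 * real m)" for y
    have "G 0 \<le> G d"
    proof (rule DERIV_nonneg_imp_increasing_open[of 0 d G])
      fix y assume y: "0 < y" "y < d"
      have "?a + d + y < real (2 * i + 2) * d" using y by (simp add: algebra_simps)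
      then have u: "?a + d + y < pi" using half[OF i] pi_gt_zero by linarith
      have "0 \<le> ?a" using d0 by simp
      then have x: "0 < ?a + y" "?a + y < pi" "0 < ?a + d + y" "?a + d + y < pi"
        using u y d0 by linarith+
      have s2: "sin (2 * real m * (?a + d + y)) = - sin (2 * real m * y)"
        using shift[of "2 * i + 1" y] by (simp add: algebra_simps)
      have s1: "sin (2 * real m * (?a + y)) = sin (2 * real m * y)" using shift[of "2 * i" y] by simp
      have d1: "((\<lambda>y. S (?a + y)) has_real_derivative sin (2 * real m * (?a + y)) / (2 * sin (?a + y)) * 1) (at y)"
        by (rule DERIV_chain2[where f = S and g = "\<lambda>y. ?a + y"], rule S'[OF x(1,2)]) (auto intro!: derivative_eq_intros)
      have d2: "((\<lambda>y. S (?a + d + y)) has_real_derivative sin (2 * real m * (?a + d + y)) / (2 * sin (?a + d + y)) * 1) (at y)"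
        by (rule DERIV_chain2[where f = S and g = "\<lambda>y. ?a + d + y"], rule S'[OF x(3,4)]) (auto intro!: derivative_eq_intros)
      have d3: "((\<lambda>y. c * cos (2 * real m * y) / (2 * real m)) has_real_derivative - c * sin (2 * real m * y)) (at y)"
        using m by (auto intro!: derivative_eq_intros)
      have D: "(G has_real_derivative sin (2 * real m * y) / (2 * sin (?a + y)) * 1 + - sin (2 * real m * y) / (2 * sin (?a + d + y)) * 1
          + - c * sin (2 * real m * y)) (at y)"
        unfolding G_def[abs_def] using DERIV_add[OF DERIV_add[OF d1 d2] d3] unfolding s1 s2 .
      have "sin (2 * real m * y) / (2 * sin (?a + y)) * 1 + - sin (2 * real m * y) / (2 * sin (?a + d + y)) * 1
          + - c * sin (2 * real m * y) = sin (2 * real m * y) * (1 / sin (?a + y) - 1 / sin (?a + y + d) - 2 * c) / 2"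
        by (simp add: algebra_simps diff_divide_distrib)
      also have "\<dots> \<ge> 0" using osc[of y] gap[OF y] y by simp
      finally show "\<exists>D. (G has_real_derivative D) (at y) \<and> 0 \<le> D" using D by blast
    next
      show "continuous_on {0..d} G" unfolding G_def[abs_def] using m
        by (intro continuous_intros continuous_on_compose2[OF Sc[of UNIV]]) auto
    qed (use d0 in simp)
    then have "S ?a + c / (2 * real m) \<le> S (?a + d + d) - c / (2 * real m)"
      unfolding G_def by (simp add: md)
    moreover have "?a + d + d = real (2 * i + 2) * d" by (simp add: algebra_simps)
    ultimately show ?thesis by (simp add: field_simps)
  qed
  have node1: "S d \<ge> 1 / 20"
  proof -
    define G where "G y = S y + (real m / pi) * cos (2 * real m * y) / (2 * real m)" for y
    have "G 0 \<le> G d"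
    proof (rule DERIV_nonneg_imp_increasing_open[of 0 d G])
      fix y assume y: "0 < y" "y < d"
      have yp: "y < pi" using half[of 1] m y pi_gt_zero by auto
      note d1 = S'[OF y(1) yp]
      have d3: "((\<lambda>y. (real m / pi) * cos (2 * real m * y) / (2 * real m)) has_real_derivative - (real m / pi) * sin (2 * real m * y)) (at y)"
        using m by (auto intro!: derivative_eq_intros)
      have "(G has_real_derivative sin (2 * real m * y) / (2 * sin y) + - (real m / pi) * sin (2 * real m * y)) (at y)"
        unfolding G_def[abs_def] by (rule DERIV_add[OF d1 d3])
      moreover have "sin (2 * real m * y) / (2 * sin y) + - (real m / pi) * sin (2 * real m * y)
        = sin (2 * real m * y) * (1 / (2 * sin y) - real m / pi)" by (simp add: algebra_simps)
      moreover have "1 / (2 * sin y) \<ge> real m / pi"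
      proof -
        have "sin y \<le> d" using sin_x_le_x[of y] y by simp
        then have "2 * real m * sin y \<le> 2 * real m * d" by (intro mult_left_mono) auto
        then have "real m * (2 * sin y) \<le> pi" unfolding md by (simp add: mult_ac)
        then show ?thesis using sin_gt_zero[OF y(1) yp] by (simp add: field_simps)
      qed
      then have "sin (2 * real m * y) * (1 / (2 * sin y) - real m / pi) \<ge> 0" using osc[of y] y by simp
      ultimately show "\<exists>D. (G has_real_derivative D) (at y) \<and> 0 \<le> D" by metis
    next
      show "continuous_on {0..d} G" unfolding G_def[abs_def] using m
        by (intro continuous_intros continuous_on_compose2[OF Sc[of UNIV]]) auto
    qed (use d0 in simp)
    then have "1 / pi \<le> S d" using m unfolding G_def by (simp add: md S_def)
    moreover have "1 / 20 \<le> 1 / pi" using pi_less_4 pi_gt_zero by (intro divide_left_mono) auto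
    ultimately show ?thesis by linarith
  qed
  have node2: "S (2 * d) \<ge> 1 / 20" if m2: "m \<ge> 2"
  proof -
    \<comment> \<open>Since \<open>d \<le> \<pi>/4\<close>, the addition theorem gives \<open>sin (y + d) \<ge> \<surd>2 sin y \<ge> 4/3 sin y\<close>.\<close>
    have gap: "2 * (real m / 16) \<le> 1 / sin (real (2 * 0) * d + y) - 1 / sin (real (2 * 0) * d + y + d)"
      if y: "0 < y" "y < d" for y
    proof -
      have q: "d \<le> pi / 4" using half[OF m2] by simp
      have sy: "sin y > 0" using y q pi_gt_zero by (intro sin_gt_zero) auto
      have "sqrt 2 / 2 \<le> cos d" using cos_mono_le_eq[of "pi / 4" d] q d0 pi_gt_zero by (simp add: cos_45)
      moreover have "cos d \<le> cos y" using y q pi_gt_zero by (intro cos_monotone_0_pi_le) auto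
      moreover have "sin y \<le> sin d" using y q pi_gt_zero by (intro sin_monotone_2pi_le) auto
      moreover have "4 / 3 \<le> sqrt (2::real)" by (rule real_le_rsqrt) (simp add: power2_eq_square)
      ultimately have c: "4 / 3 \<le> cos d + cos y" "sin y * cos y \<le> sin d * cos y"
        by (auto intro!: mult_right_mono cos_ge_zero simp: y)
      have "sin y * (4 / 3) \<le> sin y * (cos d + cos y)" using c sy by (intro mult_left_mono) auto
      also have "\<dots> \<le> sin (y + d)" using c unfolding sin_add by (simp add: algebra_simps)
      finally have "1 / sin (y + d) \<le> 1 / (sin y * (4 / 3))" using sy by (intro divide_left_mono) auto
      moreover have "1 / (4 * sin y) \<ge> real m / 8"
      proof -
        have "sin y \<le> d" using sin_x_le_x[of y] y by simp
        then have "2 * real m * sin y \<le> 2 * real m * d" using m by (intro mult_left_mono) auto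
        then have "2 * real m * sin y \<le> 4" using md pi_less_4 by linarith
        then show ?thesis using sy by (simp add: field_simps)
      qed
      moreover have "1 / (sin y * (4 / 3)) = 3 * (1 / (4 * sin y))" "1 / sin y = 4 * (1 / (4 * sin y))" by simp_all
      moreover define q where "q = 1 / (4 * sin y)"
      ultimately have "1 / sin (y + d) \<le> 3 * q" "real m / 8 \<le> q" "1 / sin y = 4 * q" by simp_all
      then have "2 * (real m / 16) \<le> 1 / sin y - 1 / sin (y + d)" by linarith
      then show ?thesis by simp
    qed
    have "1 / 16 \<le> S (2 * d)" using pair[of 0, OF _ gap] m2 by (simp add: S_def)
    then show ?thesis by simp
  qed
  have even: "1 / 20 \<le> S (real (2 * i + 2) * d)" if "2 * i + 2 \<le> m" for i
    using that
  proof (induction i)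
    case 0 then show ?case using node2 by simp
  next
    case (Suc i)
    have "S (real (2 * Suc i) * d) + 2 * 0 / (2 * real m) \<le> S (real (2 * Suc i + 2) * d)"
    proof (rule pair[OF Suc.prems])
      fix y assume y: "0 < y" "y < d"
      let ?x = "real (2 * Suc i) * d + y"
      have "?x + d \<le> real (2 * Suc i + 2) * d" using y by (simp add: algebra_simps)
      then have x: "?x + d \<le> pi / 2" using half[OF Suc.prems] by linarith
      have x0: "0 < ?x" using y d0 by (intro add_nonneg_pos) auto
      have "sin ?x \<le> sin (?x + d)" using x x0 d0 pi_gt_zero by (intro sin_monotone_2pi_le) auto
      moreover have "sin ?x > 0" using x x0 d0 pi_gt_zero by (intro sin_gt_zero) auto
      ultimately show "2 * 0 \<le> 1 / sin ?x - 1 / sin (?x + d)" by (simp add: frac_le)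
    qed
    then show ?case using Suc by simp
  qed
  have main: "1 / 20 \<le> S (real j * d)" if j: "0 < j" "j \<le> m" for j
  proof (cases "even j")
    case True
    then obtain i where "j = 2 * i + 2" using j by (metis dvd_def gr0_implies_Suc mult_Suc_right add.commute nat_0_less_mult_iff)
    then show ?thesis using even j by simp
  next
    case False
    then obtain i where i: "j = 2 * i + 1" by (rule oddE)
    show ?thesis
    proof (cases i)
      case 0 then show ?thesis using i node1 by simp
    next
      case (Suc k)
      then have "1 / 20 \<le> S (real (2 * i) * d)" using even[of k] i j by simp
      then show ?thesis using odd[of i] i j by simp
    qed
  qed
  show ?thesis
  proof (cases "j \<le> m")
    case True then show ?thesis using main[OF j(1)] by (simp add: S_def d_def)
  next
    case False
    have "1 / 20 \<le> S (real (2 * m - j) * d)" using False j by (intro main) auto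
    also have "real (2 * m - j) * d = pi - real j * d" using j md by (simp add: of_nat_diff algebra_simps)
    finally show ?thesis unfolding S_def odd_sine_sum_reflect by (simp add: d_def)
  qed
qed

lemma sum_cos_nodes:
  fixes r :: int
  assumes N: "N > 0" and r: "r \<noteq> 0" "\<bar>r\<bar> < 2 * int N"
  shows "(\<Sum>j<N. cos (of_int r * (real j * pi / real N))) = (1 - cos (of_int r * pi)) / 2"
proof -
  define x where "x = of_int r * pi / real N"
  have "sin (x / 2) \<noteq> 0"
  proof
    assume "sin (x / 2) = 0"
    then obtain i :: int where "x / 2 = of_int i * pi" using sin_zero_iff_int2 by blast
    then have "of_int r = (of_int (2 * i * int N) :: real)" using N by (simp add: x_def field_simps)
    then have e: "r = 2 * i * int N" by linarith
    then have "i \<noteq> 0" using r by auto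
    then have "1 * (2 * int N) \<le> \<bar>i\<bar> * (2 * int N)" by (intro mult_right_mono) auto
    also have "\<dots> = \<bar>r\<bar>" unfolding e by (simp add: abs_mult)
    finally show False using r by simp
  qed
  moreover have "2 * sin (x / 2) * (\<Sum>j<N. cos (0 + real j * x)) = 2 * sin (x / 2) * ((1 - cos (of_int r * pi)) / 2)"
  proof -
    have "(real N - 1 / 2) * x = of_int r * pi - x / 2" using N by (simp add: x_def field_simps)
    moreover have "sin (of_int r * pi) = 0" using sin_zero_iff_int2 by blast
    ultimately have "sin (0 + (real N - 1 / 2) * x) = - cos (of_int r * pi) * sin (x / 2)"
      by (simp add: sin_diff)
    then have "2 * sin (x / 2) * (\<Sum>j<N. cos (0 + real j * x)) = - cos (of_int r * pi) * sin (x / 2) - sin (0 - x / 2)"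
      by (simp only: sum_cos_arith)
    also have "\<dots> = 2 * sin (x / 2) * ((1 - cos (of_int r * pi)) / 2)" by (simp add: algebra_simps)
    finally show ?thesis .
  qed
  ultimately have "(\<Sum>j<N. cos (0 + real j * x)) = (1 - cos (of_int r * pi)) / 2" by simp
  then show ?thesis by (simp add: x_def mult_ac)
qed

lemma discrete_sine_orthogonality:
  assumes a: "0 < a" "a < N" and b: "0 < b" "b < N"
  shows "(\<Sum>j<N. sin (real a * (real j * pi / real N)) * sin (real b * (real j * pi / real N))) = (if a = b then real N / 2 else 0)"
proof -
  have N: "N > 0" using a by simp
  define D where "D r = (\<Sum>j<N. cos (of_int r * (real j * pi / real N)))" for r :: int
  have prod: "sin (real a * t) * sin (real b * t) = (cos (of_int (int a - int b) * t) - cos (of_int (int a + int b) * t)) / 2" for t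
    by (simp add: sin_times_sin left_diff_distrib distrib_right)
  then have e: "(\<Sum>j<N. sin (real a * (real j * pi / real N)) * sin (real b * (real j * pi / real N))) = (D (int a - int b) - D (int a + int b)) / 2"
    unfolding prod D_def by (simp add: sum_subtractf flip: sum_divide_distrib)
  have Dp: "D (int a + int b) = (1 - cos (of_int (int a + int b) * pi)) / 2"
    unfolding D_def using a b by (intro sum_cos_nodes N) auto
  show ?thesis
  proof (cases "a = b")
    case True
    have "cos (of_int (int a + int b) * pi) = 1" using cos_2npi[of b] True by (simp add: algebra_simps)
    then have "D (int a + int b) = 0" unfolding Dp by simp
    moreover have "D (int a - int b) = real N" by (simp add: D_def True)
    ultimately show ?thesis unfolding e using True by simp
  next
    case False
    have Dm: "D (int a - int b) = (1 - cos (of_int (int a - int b) * pi)) / 2"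
      unfolding D_def using a b False by (intro sum_cos_nodes N) auto
    have "cos (of_int (int a - int b) * pi) = cos (of_int (int a + int b) * pi)"
      by (simp add: left_diff_distrib distrib_right cos_diff cos_add)
    then show ?thesis unfolding e Dm Dp using False by simp
  qed
qed

text \<open>
  Times \<open>sin (j\<pi>/(2m))\<close>, this is the weight at the node \<open>cos (j\<pi>/(2m))\<close> of Fejer's second rule
  for the mean value over \<open>[-1, 1]\<close>.
\<close>

definition node_weight :: "nat \<Rightarrow> nat \<Rightarrow> real" where
  "node_weight m j = 1 / real m * odd_sine_sum m (real j * pi / real (2 * m))"

text \<open>
  For \<open>q = 0\<close> discrete orthogonality leaves one term of the odd sine sum, and this is the
  integral of \<open>sin (l x)\<close>.  The product formula for \<open>cos x sin (l x)\<close> lowers \<open>q\<close> at the cost of one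
  more frequency.
\<close>

lemma node_quadrature_trig:
  assumes m: "m > 0" and "l + q < 2 * m"
  shows "((\<lambda>x. cos x ^ q * sin (real l * x)) has_integral
     2 * (\<Sum>j<2 * m. node_weight m j * (cos (real j * pi / real (2 * m)) ^ q * sin (real l * (real j * pi / real (2 * m)))))) {0..pi}"
  using assms(2)
proof (induction q arbitrary: l)
  case 0
  let ?t = "\<lambda>j. real j * pi / real (2 * m)"
  show ?case
  proof (cases "l = 0")
    case False
    have "(\<Sum>j<2 * m. node_weight m j * sin (real l * ?t j))
       = (\<Sum>j<2 * m. \<Sum>k<m. 1 / (real m * real (2 * k + 1)) * (sin (real (2 * k + 1) * ?t j) * sin (real l * ?t j)))"
      unfolding node_weight_def odd_sine_sum_def sum_distrib_left sum_distrib_right by (simp add: field_simps)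
    also have "\<dots> = (\<Sum>k<m. 1 / (real m * real (2 * k + 1)) * (\<Sum>j<2 * m. sin (real (2 * k + 1) * ?t j) * sin (real l * ?t j)))"
      by (subst sum.swap) (simp only: sum_distrib_left)
    also have "\<dots> = (\<Sum>k<m. 1 / (real m * real (2 * k + 1)) * (if 2 * k + 1 = l then real (2 * m) / 2 else 0))"
      using False 0 by (intro sum.cong refl arg_cong2[where f = "(*)"] discrete_sine_orthogonality) auto
    also have "\<dots> = (\<Sum>k<m. if 2 * k + 1 = l then 1 / real l else 0)"
      using m by (intro sum.cong) auto
    also have "\<dots> = (if odd l then 1 / real l else 0)"
    proof (cases "odd l")
      case True
      then obtain i where i: "l = 2 * i + 1" by (rule oddE)
      then have "(\<Sum>k<m. if 2 * k + 1 = l then 1 / real l else 0) = (\<Sum>k<m. if k = i then 1 / real l else 0)"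
        by (intro sum.cong) auto
      then show ?thesis using i 0 by simp
    next
      case False
      then have "(\<Sum>k<m. if 2 * k + 1 = l then 1 / real l else 0) = (\<Sum>k<m. 0)"
        by (intro sum.cong) auto
      then show ?thesis using False by simp
    qed
    finally have Q: "2 * (\<Sum>j<2 * m. node_weight m j * sin (real l * ?t j)) = - cos (real l * pi) / real l - (- cos (real l * 0) / real l)"
      by (auto simp: cos_npi)
    have "((\<lambda>x. sin (real l * x)) has_integral (- cos (real l * pi) / real l - (- cos (real l * 0) / real l))) {0..pi}"
      using False by (intro fundamental_theorem_of_calculus)
        (auto intro!: derivative_eq_intros simp flip: has_real_derivative_iff_has_vector_derivative)
    then show ?thesis by (simp only: Q power_0 mult_1_left)
  qed simp
next
  case (Suc q)
  let ?t = "\<lambda>j. real j * pi / real (2 * m)"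
  show ?case
  proof (cases l)
    case (Suc i)
    have prod: "cos x ^ Suc q * sin (real l * x) = (cos x ^ q * sin (real (l + 1) * x) + cos x ^ q * sin (real i * x)) / 2" for x :: real
    proof -
      have "real (l + 1) * x = real l * x + x" "real i * x = real l * x - x"
        using Suc by (simp_all add: algebra_simps)
      then show ?thesis by (simp only: sin_add sin_diff power_Suc) (simp add: algebra_simps)
    qed
    have 1: "(l + 1) + q < 2 * m" "i + q < 2 * m" using Suc.prems Suc by auto
    have "((\<lambda>x. cos x ^ Suc q * sin (real l * x)) has_integral
      (2 * (\<Sum>j<2 * m. node_weight m j * (cos (?t j) ^ q * sin (real (l + 1) * ?t j)))
       + 2 * (\<Sum>j<2 * m. node_weight m j * (cos (?t j) ^ q * sin (real i * ?t j)))) / 2) {0..pi}"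
      unfolding prod by (intro has_integral_divide has_integral_add Suc.IH 1)
    moreover have "(2 * (\<Sum>j<2 * m. node_weight m j * (cos (?t j) ^ q * sin (real (l + 1) * ?t j)))
       + 2 * (\<Sum>j<2 * m. node_weight m j * (cos (?t j) ^ q * sin (real i * ?t j)))) / 2
       = 2 * (\<Sum>j<2 * m. node_weight m j * (cos (?t j) ^ Suc q * sin (real l * ?t j)))"
      unfolding prod by (simp add: sum.distrib distrib_left flip: sum_divide_distrib)
    ultimately show ?thesis by simp
  qed simp
qed

lemma node_quadrature:
  fixes P :: "real poly"
  assumes m: "m > 0" and P: "degree P + 2 \<le> 2 * m"
  shows "((\<lambda>x. poly P (cos x) * sin x) has_integral
     2 * (\<Sum>j<2 * m. node_weight m j * sin (real j * pi / real (2 * m)) * poly P (cos (real j * pi / real (2 * m))))) {0..pi}"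
proof -
  let ?t = "\<lambda>j. real j * pi / real (2 * m)"
  have "((\<lambda>x. \<Sum>q\<le>degree P. coeff P q * (cos x ^ q * sin (real 1 * x))) has_integral
     (\<Sum>q\<le>degree P. coeff P q * (2 * (\<Sum>j<2 * m. node_weight m j * (cos (?t j) ^ q * sin (real 1 * ?t j)))))) {0..pi}"
    using m P by (intro has_integral_sum has_integral_mult_right node_quadrature_trig) auto
  moreover have "(\<Sum>q\<le>degree P. coeff P q * (2 * (\<Sum>j<2 * m. node_weight m j * (cos (?t j) ^ q * sin (real 1 * ?t j)))))
     = 2 * (\<Sum>j<2 * m. node_weight m j * sin (?t j) * poly P (cos (?t j)))"
    unfolding poly_altdef sum_distrib_left by (subst sum.swap) (simp add: mult_ac)
  moreover have "(\<lambda>x. poly P (cos x) * sin x) = (\<lambda>x. \<Sum>q\<le>degree P. coeff P q * (cos x ^ q * sin (real 1 * x)))"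
    by (rule ext) (simp add: poly_altdef sum_distrib_right mult.assoc)
  ultimately show ?thesis by (simp only:)
qed

section \<open>Quadrature with prescribed part of the weights\<close>

text \<open>
  A contraction argument: since \<open>h\<close> vanishes at \<open>0\<close> and is Lipschitz, its values at \<open>w i / M\<close> and
  their variation are of order \<open>1/M\<close>, so for large \<open>M\<close> the right-hand side maps the box
  \<open>[0, 2B]\<close> into itself and halves distances.
\<close>

lemma perturbed_weights:
  fixes h :: "nat \<Rightarrow> nat \<Rightarrow> real \<Rightarrow> real" and b :: "nat \<Rightarrow> real"
  assumes fin: "finite J" and c: "0 < c" and b: "\<And>j. j \<in> J \<Longrightarrow> c \<le> b j \<and> b j \<le> B"
    and h0: "\<And>i j. i \<in> J \<Longrightarrow> j \<in> J \<Longrightarrow> h i j 0 = 0"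
    and lip: "\<And>i j r s. i \<in> J \<Longrightarrow> j \<in> J \<Longrightarrow> r \<in> {0..1/2} \<Longrightarrow> s \<in> {0..1/2} \<Longrightarrow>
       \<bar>h i j r - h i j s\<bar> \<le> L * \<bar>r - s\<bar>"
    and L: "0 \<le> L" and BB: "c \<le> B"
    and M: "M \<ge> 4 * B + 8 * real (card J) * B\<^sup>2 * L / c + 8 * real (card J) * B * L"
  shows "\<exists>w. \<forall>j\<in>J. w j = b j - (\<Sum>i\<in>J. w i * h i j (w i / M)) \<and> c / 2 \<le> w j \<and> w j \<le> 2 * B"
proof -
  have B: "0 < B" using c BB by linarith
  have t: "0 \<le> 8 * real (card J) * B\<^sup>2 * L / c" "0 \<le> 8 * real (card J) * B * L" using B L c by simp_all
  have M4: "4 * B \<le> M" and M1: "8 * real (card J) * B\<^sup>2 * L / c \<le> M" and M2: "8 * real (card J) * B * L \<le> M"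
    using M t B by linarith+
  have M0: "0 < M" using M4 B by linarith
  define G where "G w j = (if j \<in> J then b j - (\<Sum>i\<in>J. w i * h i j (w i / M)) else 0)" for w :: "nat \<Rightarrow> real" and j
  have rng: "u / M \<in> {0..1/2}" if "0 \<le> u" "u \<le> 2 * B" for u
    using that M4 M0 by (auto simp: field_simps)
  have hb: "\<bar>h i j (u / M)\<bar> \<le> 2 * B * L / M" if "i \<in> J" "j \<in> J" "0 \<le> u" "u \<le> 2 * B" for i j u
  proof -
    have "\<bar>h i j (u / M)\<bar> \<le> L * (u / M)"
      using lip[OF that(1,2) rng[OF that(3,4)], of 0] h0[OF that(1,2)] that M0 by simp
    also have "\<dots> \<le> L * (2 * B / M)" using that L M0 by (intro mult_left_mono divide_right_mono) auto
    finally show ?thesis by (simp add: mult_ac)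
  qed
  have close: "\<bar>G w j - b j\<bar> \<le> c / 2" if w: "\<forall>j. 0 \<le> w j \<and> w j \<le> 2 * B" and j: "j \<in> J" for w j
  proof -
    have "\<bar>G w j - b j\<bar> \<le> (\<Sum>i\<in>J. \<bar>w i * h i j (w i / M)\<bar>)" using j by (simp add: G_def sum_abs)
    also have "\<dots> \<le> (\<Sum>i\<in>J. 2 * B * (2 * B * L / M))"
      unfolding abs_mult using w hb[OF _ j] B by (intro sum_mono mult_mono) auto
    also have "\<dots> = (8 * real (card J) * B\<^sup>2 * L / c) * (c / 2 / M)" using c by (simp add: power2_eq_square)
    also have "\<dots> \<le> M * (c / 2 / M)" using M1 M0 c by (intro mult_right_mono) auto
    also have "\<dots> = c / 2" using M0 by simp
    finally show ?thesis .
  qed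
  have range: "c / 2 \<le> G w j \<and> G w j \<le> 2 * B" if w: "\<forall>j. 0 \<le> w j \<and> w j \<le> 2 * B" and j: "j \<in> J" for w j
    using close[OF w j] b[OF j] BB by linarith
  have in_range: "0 \<le> G w j \<and> G w j \<le> 2 * B" if w: "\<forall>j. 0 \<le> w j \<and> w j \<le> 2 * B" for w j
  proof (cases "j \<in> J")
    case True then show ?thesis using range[OF w True] c by linarith
  next
    case False then show ?thesis using B by (simp add: G_def)
  qed
  have contr: "\<bar>G x j - G y j\<bar> \<le> d / 2"
    if x: "\<forall>j. 0 \<le> x j \<and> x j \<le> 2 * B" and y: "\<forall>j. 0 \<le> y j \<and> y j \<le> 2 * B"
      and d: "\<And>i. i \<in> J \<Longrightarrow> \<bar>x i - y i\<bar> \<le> d" and d0: "0 \<le> d" for x y d j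
    proof (cases "j \<in> J")
      case True
      have each: "\<bar>u * h i j (u / M) - v * h i j (v / M)\<bar> \<le> 4 * B * L / M * d"
        if i: "i \<in> J" and u: "u = x i" and v: "v = y i" for i u v
      proof -
        have u': "0 \<le> u" "u \<le> 2 * B" "0 \<le> v" "v \<le> 2 * B" using x y unfolding u v by auto
        have "u * h i j (u / M) - v * h i j (v / M) = (u - v) * h i j (u / M) + v * (h i j (u / M) - h i j (v / M))"
          by (simp add: algebra_simps)
        then have "\<bar>u * h i j (u / M) - v * h i j (v / M)\<bar> \<le> \<bar>u - v\<bar> * \<bar>h i j (u / M)\<bar> + v * \<bar>h i j (u / M) - h i j (v / M)\<bar>"
          using u' by (metis abs_mult abs_of_nonneg abs_triangle_ineq)
        also have "\<dots> \<le> d * (2 * B * L / M) + (2 * B) * (L * \<bar>u / M - v / M\<bar>)"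
          using d[OF i] hb[OF i True u'(1,2)] lip[OF i True rng[OF u'(1,2)] rng[OF u'(3,4)]] u' d0 u v
          by (intro add_mono mult_mono) auto
        also have "\<bar>u / M - v / M\<bar> = \<bar>u - v\<bar> / M" using M0 by (simp flip: diff_divide_distrib)
        also have "d * (2 * B * L / M) + (2 * B) * (L * (\<bar>u - v\<bar> / M)) \<le> d * (2 * B * L / M) + (2 * B) * (L * (d / M))"
          using d[OF i] B L M0 u v by (intro add_left_mono mult_left_mono divide_right_mono) auto
        also have "\<dots> = 4 * B * L / M * d" by simp
        finally show ?thesis .
      qed
      have "\<bar>G x j - G y j\<bar> =
        \<bar>\<Sum>i\<in>J. x i * h i j (x i / M) - y i * h i j (y i / M)\<bar>"
        using True unfolding G_def sum_subtractf by simp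
      also have "\<dots> \<le> (\<Sum>i\<in>J. 4 * B * L / M * d)"
        by (rule order_trans[OF sum_abs]) (intro sum_mono each refl)
      also have "\<dots> = (8 * real (card J) * B * L) * (1 / M) * (1 / 2 * d)" by simp
      also have "\<dots> \<le> M * (1 / M) * (1 / 2 * d)" using M2 M0 d0 by (intro mult_right_mono) auto
      also have "\<dots> = d / 2" using M0 by simp
      finally show ?thesis .
    next
      case False
      then show ?thesis using d0 by (simp add: G_def)
    qed
  \<comment> \<open>Picard iteration from \<open>0\<close>; the steps decrease geometrically, so every component converges.\<close>
  define W where "W n = (G ^^ n) (\<lambda>_. 0)" for n
  have W_Suc: "W (Suc n) = G (W n)" for n by (simp add: W_def)
  have Wr: "\<forall>j. 0 \<le> W n j \<and> W n j \<le> 2 * B" for n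
  proof (induction n)
    case 0 then show ?case using B by (simp add: W_def)
  next
    case (Suc n) then show ?case unfolding W_Suc using in_range by blast
  qed
  have step: "\<bar>W (Suc n) j - W n j\<bar> \<le> 2 * B * (1 / 2) ^ n" for n j
  proof (induction n arbitrary: j)
    case 0
    have "0 \<le> W (Suc 0) j \<and> W (Suc 0) j \<le> 2 * B" using Wr by blast
    then show ?case by (simp add: W_def)
  next
    case (Suc n)
    have "\<bar>G (W (Suc n)) j - G (W n) j\<bar> \<le> 2 * B * (1 / 2) ^ n / 2"
      using Suc.IH B by (intro contr Wr) auto
    then show ?case by (simp add: W_Suc)
  qed
  have "\<exists>l. (\<lambda>n. W n j) \<longlonglongrightarrow> l" for j
  proof -
    have "summable (\<lambda>n. 2 * B * (1 / 2) ^ n)" by (intro summable_mult summable_geometric) simp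
    then have "summable (\<lambda>n. W (Suc n) j - W n j)"
      by (rule summable_comparison_test[OF _, rotated]) (use step in auto)
    then have "(\<lambda>n. \<Sum>k<n. W (Suc k) j - W k j) \<longlonglongrightarrow> (\<Sum>k. W (Suc k) j - W k j)"
      by (rule summable_LIMSEQ)
    moreover have "(\<Sum>k<n. W (Suc k) j - W k j) = W n j" for n
      by (subst sum_lessThan_telescope) (simp add: W_def)
    ultimately show ?thesis by auto
  qed
  then obtain w where lim: "\<And>j. (\<lambda>n. W n j) \<longlonglongrightarrow> w j" by metis
  have wr: "\<forall>j. 0 \<le> w j \<and> w j \<le> 2 * B"
    using LIMSEQ_le_const[OF lim] LIMSEQ_le_const2[OF lim] Wr by blast
  have fp: "G w j = w j" for j
  proof -
    have "\<bar>G w j - w j\<bar> \<le> e" if e: "e > 0" for e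
    proof -
      have "\<forall>i. \<forall>\<^sub>F n in sequentially. \<bar>W n i - w i\<bar> < e / 2"
        using lim e unfolding tendsto_iff dist_real_def by (metis half_gt_zero)
      then have "\<forall>\<^sub>F n in sequentially. \<forall>i\<in>J. \<bar>W n i - w i\<bar> < e / 2"
        using fin by (simp add: eventually_ball_finite_distrib)
      moreover have "\<forall>\<^sub>F n in sequentially. \<bar>W (Suc n) j - w j\<bar> < e / 2"
        using LIMSEQ_Suc[OF lim[of j]] e unfolding tendsto_iff dist_real_def by (metis half_gt_zero)
      ultimately have "\<forall>\<^sub>F n in sequentially. (\<forall>i\<in>J. \<bar>W n i - w i\<bar> < e / 2) \<and> \<bar>W (Suc n) j - w j\<bar> < e / 2"
        by (rule eventually_conj)
      then obtain n where n: "\<forall>i\<in>J. \<bar>W n i - w i\<bar> < e / 2" "\<bar>W (Suc n) j - w j\<bar> < e / 2"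
        using eventually_happens' by force
      have "\<bar>G (W n) j - G w j\<bar> \<le> e / 2 / 2"
        using n(1) e by (intro contr Wr wr) (auto intro: less_imp_le)
      then show ?thesis using n(2) e unfolding W_Suc by linarith
    qed
    then show ?thesis by (metis abs_le_zero_iff eq_iff_diff_eq_0 field_le_epsilon add_0)
  qed
  have "w j = b j - (\<Sum>i\<in>J. w i * h i j (w i / M)) \<and> c / 2 \<le> w j \<and> w j \<le> 2 * B" if j: "j \<in> J" for j
  proof -
    have "w j = G w j" using fp by simp
    then show ?thesis using range[of w j, OF wr j] j by (simp add: G_def)
  qed
  then show ?thesis by blast
qed

text \<open>
  The height above the equatorial plane of the point with angle \<open>u\<close> on a circle of Euclidean radius
  \<open>r\<close> whose spherical centre has colatitude \<open>\<theta>\<close>.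
\<close>

abbreviation tilted_height :: "real \<Rightarrow> real \<Rightarrow> real \<Rightarrow> real" where
  "tilted_height \<theta> r u \<equiv> sqrt (1 - r\<^sup>2) * cos \<theta> - r * sin \<theta> * cos u"

definition tilted_mean :: "real \<Rightarrow> real \<Rightarrow> real poly \<Rightarrow> real" where
  "tilted_mean \<theta> r P = 1 / (2 * pi) * integral {0..2 * pi} (\<lambda>u. poly P (tilted_height \<theta> r u))"

lemma poly_lipschitz_unit_interval:
  fixes P :: "real poly"
  shows "\<exists>C\<ge>0. \<forall>x y. \<bar>x\<bar> \<le> 1 \<longrightarrow> \<bar>y\<bar> \<le> 1 \<longrightarrow> \<bar>poly P x - poly P y\<bar> \<le> C * \<bar>x - y\<bar>"
proof (induction P)
  case 0 then show ?case by (intro exI[of _ 0]) simp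
next
  case (pCons a P)
  then obtain C where C: "C \<ge> 0" "\<And>x y. \<bar>x\<bar> \<le> 1 \<Longrightarrow> \<bar>y\<bar> \<le> 1 \<Longrightarrow> \<bar>poly P x - poly P y\<bar> \<le> C * \<bar>x - y\<bar>" by blast
  define E where "E = \<bar>poly P 0\<bar> + C"
  have E: "\<bar>poly P y\<bar> \<le> E" if "\<bar>y\<bar> \<le> 1" for y
  proof -
    have "\<bar>poly P y - poly P 0\<bar> \<le> C * 1" using C(2)[OF that, of 0] mult_left_mono[OF that C(1)] by simp
    then show ?thesis unfolding E_def by linarith
  qed
  show ?case
  proof (intro exI[of _ "C + E"] conjI allI impI)
    show "0 \<le> C + E" using C(1) by (simp add: E_def)
    fix x y :: real assume xy: "\<bar>x\<bar> \<le> 1" "\<bar>y\<bar> \<le> 1"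
    have "poly (pCons a P) x - poly (pCons a P) y = x * (poly P x - poly P y) + (x - y) * poly P y" by (simp add: algebra_simps)
    also have "\<bar>\<dots>\<bar> \<le> \<bar>x\<bar> * \<bar>poly P x - poly P y\<bar> + \<bar>x - y\<bar> * \<bar>poly P y\<bar>"
      by (rule order_trans[OF abs_triangle_ineq]) (simp add: abs_mult)
    also have "\<dots> \<le> 1 * (C * \<bar>x - y\<bar>) + \<bar>x - y\<bar> * E"
      using xy C E by (intro add_mono mult_mono) auto
    finally show "\<bar>poly (pCons a P) x - poly (pCons a P) y\<bar> \<le> (C + E) * \<bar>x - y\<bar>" by (simp add: algebra_simps)
  qed
qed

lemma sqrt_one_minus_square_lipschitz:
  fixes r s :: real
  assumes r: "r \<in> {0..1/2}" and s: "s \<in> {0..1/2}"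
  shows "\<bar>sqrt (1 - r\<^sup>2) - sqrt (1 - s\<^sup>2)\<bar> \<le> \<bar>r - s\<bar>"
proof -
  have half: "sqrt (1 - r\<^sup>2) \<ge> 1 / 2 \<and> 1 - r\<^sup>2 \<ge> 0" if "r \<in> {0..1/2}" for r :: real
  proof -
    have "r\<^sup>2 \<le> (1 / 2)\<^sup>2" using that by (intro power_mono) auto
    then have q: "(1 / 2)\<^sup>2 \<le> 1 - r\<^sup>2" by (simp add: power_divide)
    then have "1 / 2 \<le> sqrt (1 - r\<^sup>2)" by (rule real_le_rsqrt)
    moreover have "0 \<le> 1 - r\<^sup>2" using q by (rule order_trans[rotated]) simp
    ultimately show ?thesis by simp
  qed
  have "(sqrt (1 - r\<^sup>2) - sqrt (1 - s\<^sup>2)) * (sqrt (1 - r\<^sup>2) + sqrt (1 - s\<^sup>2)) = (s - r) * (s + r)"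
    using half[OF r] half[OF s] by (simp add: algebra_simps power2_eq_square flip: real_sqrt_mult)
  then have "\<bar>sqrt (1 - r\<^sup>2) - sqrt (1 - s\<^sup>2)\<bar> * \<bar>sqrt (1 - r\<^sup>2) + sqrt (1 - s\<^sup>2)\<bar> = \<bar>s - r\<bar> * \<bar>s + r\<bar>"
    by (simp flip: abs_mult)
  moreover have "\<bar>sqrt (1 - r\<^sup>2) - sqrt (1 - s\<^sup>2)\<bar> * 1 \<le> \<bar>sqrt (1 - r\<^sup>2) - sqrt (1 - s\<^sup>2)\<bar> * \<bar>sqrt (1 - r\<^sup>2) + sqrt (1 - s\<^sup>2)\<bar>"
    using half[OF r] half[OF s] by (intro mult_left_mono) auto
  moreover have "\<bar>s - r\<bar> * \<bar>s + r\<bar> \<le> \<bar>s - r\<bar> * 1" using r s by (intro mult_left_mono) auto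
  ultimately show ?thesis by (simp add: abs_minus_commute)
qed

lemma tilted_height_bound:
  fixes r :: real
  assumes "\<bar>r\<bar> \<le> 1"
  shows "\<bar>tilted_height \<theta> r u\<bar> \<le> 1"
proof -
  have r1: "r\<^sup>2 \<le> 1" using assms by (simp add: abs_square_le_1)
  define a where "a = sqrt (1 - r\<^sup>2)"
  have a: "a\<^sup>2 = 1 - r\<^sup>2" using r1 by (simp add: a_def)
  have "(a * cos \<theta> - r * sin \<theta> * cos u)\<^sup>2 + (a * sin \<theta> + r * cos u * cos \<theta>)\<^sup>2
     = (a\<^sup>2 + r\<^sup>2 * (cos u)\<^sup>2) * ((sin \<theta>)\<^sup>2 + (cos \<theta>)\<^sup>2)" by algebra
  also have "\<dots> = a\<^sup>2 + r\<^sup>2 * (cos u)\<^sup>2" by simp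
  also have "\<dots> \<le> 1"
  proof -
    have "(cos u)\<^sup>2 \<le> 1" by (simp add: abs_square_le_1)
    then have "r\<^sup>2 * (cos u)\<^sup>2 \<le> r\<^sup>2 * 1" by (intro mult_left_mono) auto
    then show ?thesis using a by simp
  qed
  finally have "(a * cos \<theta> - r * sin \<theta> * cos u)\<^sup>2 \<le> 1" using zero_le_power2[of "a * sin \<theta> + r * cos u * cos \<theta>"] by linarith
  then show ?thesis unfolding a_def abs_square_le_1 .
qed

lemma tilted_mean_integrable:
  "(\<lambda>u. poly P (tilted_height \<theta> r u)) integrable_on {a..b}"
  by (intro integrable_continuous_real continuous_intros)

lemma tilted_mean_0: "tilted_mean \<theta> 0 P = poly P (cos \<theta>)"
  by (simp add: tilted_mean_def)

lemma tilted_mean_add: "tilted_mean \<theta> r (P + Q) = tilted_mean \<theta> r P + tilted_mean \<theta> r Q"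
  unfolding tilted_mean_def poly_add
  by (subst Henstock_Kurzweil_Integration.integral_add[OF tilted_mean_integrable tilted_mean_integrable])
    (simp add: distrib_left)

lemma tilted_mean_smult: "tilted_mean \<theta> r (smult c P) = c * tilted_mean \<theta> r P"
  unfolding tilted_mean_def poly_smult by simp

lemma tilted_mean_sum: "tilted_mean \<theta> r (\<Sum>j\<in>J. P j) = (\<Sum>j\<in>J. tilted_mean \<theta> r (P j))"
proof (induction J rule: infinite_finite_induct)
  case (insert j J) then show ?case by (simp add: tilted_mean_add)
qed (simp_all add: tilted_mean_def)

lemma tilted_mean_lipschitz:
  "\<exists>C\<ge>0. \<forall>\<theta>. \<forall>r\<in>{0..1/2}. \<forall>s\<in>{0..1/2}. \<bar>tilted_mean \<theta> r P - tilted_mean \<theta> s P\<bar> \<le> C * \<bar>r - s\<bar>"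
proof -
  obtain C where C: "C \<ge> 0" "\<And>x y. \<bar>x\<bar> \<le> 1 \<Longrightarrow> \<bar>y\<bar> \<le> 1 \<Longrightarrow> \<bar>poly P x - poly P y\<bar> \<le> C * \<bar>x - y\<bar>"
    using poly_lipschitz_unit_interval[of P] by blast
  show ?thesis
  proof (intro exI[of _ "2 * C"] conjI allI ballI)
    fix \<theta> r s :: real assume r: "r \<in> {0..1/2}" and s: "s \<in> {0..1/2}"
    let ?z = "\<lambda>r u. tilted_height \<theta> r u"
    have pt: "\<bar>poly P (?z r u) - poly P (?z s u)\<bar> \<le> 2 * C * \<bar>r - s\<bar>" for u
    proof -
      have "\<bar>?z r u - ?z s u\<bar> = \<bar>(sqrt (1 - r\<^sup>2) - sqrt (1 - s\<^sup>2)) * cos \<theta> - (r - s) * (sin \<theta> * cos u)\<bar>"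
        by (simp add: algebra_simps)
      also have "\<dots> \<le> \<bar>sqrt (1 - r\<^sup>2) - sqrt (1 - s\<^sup>2)\<bar> * \<bar>cos \<theta>\<bar> + \<bar>r - s\<bar> * (\<bar>sin \<theta>\<bar> * \<bar>cos u\<bar>)"
        by (rule order_trans[OF abs_triangle_ineq4]) (simp add: abs_mult)
      also have "\<dots> \<le> \<bar>r - s\<bar> * 1 + \<bar>r - s\<bar> * (1 * 1)"
        using sqrt_one_minus_square_lipschitz[OF r s] by (intro add_mono mult_mono) auto
      finally have "\<bar>?z r u - ?z s u\<bar> \<le> 2 * \<bar>r - s\<bar>" by simp
      then have "C * \<bar>?z r u - ?z s u\<bar> \<le> C * (2 * \<bar>r - s\<bar>)" using C(1) by (rule mult_left_mono)
      moreover have "\<bar>poly P (?z r u) - poly P (?z s u)\<bar> \<le> C * \<bar>?z r u - ?z s u\<bar>"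
        using r s by (intro C(2) tilted_height_bound) auto
      ultimately show ?thesis by simp
    qed
    have "tilted_mean \<theta> r P - tilted_mean \<theta> s P = 1 / (2 * pi) * integral {0..2 * pi} (\<lambda>u. poly P (?z r u) - poly P (?z s u))"
      unfolding tilted_mean_def
      by (subst Henstock_Kurzweil_Integration.integral_diff[OF tilted_mean_integrable tilted_mean_integrable])
        (simp add: right_diff_distrib)
    moreover have "\<bar>integral {0..2 * pi} (\<lambda>u. poly P (?z r u) - poly P (?z s u))\<bar> \<le> 2 * C * \<bar>r - s\<bar> * (2 * pi - 0)"
    proof (rule integral_bound[of 0 "2 * pi" "\<lambda>u. poly P (?z r u) - poly P (?z s u)" "2 * C * \<bar>r - s\<bar>", unfolded real_norm_def])
      show "continuous_on {0..2 * pi} (\<lambda>u. poly P (?z r u) - poly P (?z s u))" by (intro continuous_intros)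
    qed (use pt in simp_all)
    then have "1 / (2 * pi) * \<bar>integral {0..2 * pi} (\<lambda>u. poly P (?z r u) - poly P (?z s u))\<bar> \<le> 1 / (2 * pi) * (2 * C * \<bar>r - s\<bar> * (2 * pi - 0))"
      by (intro mult_left_mono) auto
    ultimately show "\<bar>tilted_mean \<theta> r P - tilted_mean \<theta> s P\<bar> \<le> 2 * C * \<bar>r - s\<bar>"
      by (simp add: abs_mult)
  qed (use C in simp)
qed

lemma lagrange_interpolation:
  fixes A :: "real set"
  assumes fin: "finite A"
  shows "\<exists>q :: real \<Rightarrow> real poly. \<forall>P. degree P < card A \<longrightarrow> P = (\<Sum>a\<in>A. smult (poly P a) (q a))"
proof -
  define q where "q a = smult (1 / (\<Prod>b\<in>A - {a}. a - b)) (\<Prod>b\<in>A - {a}. [:- b, 1:])" for a :: real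
  have val: "poly (q a) b = (if a = b then 1 else 0)" if "a \<in> A" "b \<in> A" for a b
  proof (cases "a = b")
    case True
    have "(\<Prod>b\<in>A - {a}. a - b) \<noteq> 0" using fin by (simp add: prod_zero_iff)
    then show ?thesis using True by (simp add: q_def poly_prod)
  next
    case False
    have "(\<Prod>c\<in>A - {a}. b - c) = 0" using fin that False by (simp add: prod_zero_iff)
    then show ?thesis using False by (simp add: q_def poly_prod)
  qed
  have deg: "degree (q a) < card A" if "a \<in> A" for a
  proof -
    have "degree (q a) \<le> degree (\<Prod>b\<in>A - {a}. [:- b, 1:])" unfolding q_def by (rule degree_smult_le)
    also have "\<dots> \<le> (\<Sum>b\<in>A - {a}. (degree \<circ> (\<lambda>b. [:- b, 1:])) b)" using fin by (intro degree_prod_sum_le) auto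
    also have "\<dots> = card (A - {a})" by simp
    also have "\<dots> < card A" using fin that by (rule card_Diff1_less)
    finally show ?thesis .
  qed
  have "P = (\<Sum>a\<in>A. smult (poly P a) (q a))" if P: "degree P < card A" for P
  proof (rule poly_eqI_degree[of A])
    fix x assume x: "x \<in> A"
    have "poly (\<Sum>a\<in>A. smult (poly P a) (q a)) x = (\<Sum>a\<in>A. if a = x then poly P a else 0)"
      unfolding poly_sum using val[OF _ x] by (intro sum.cong) auto
    then show "poly P x = poly (\<Sum>a\<in>A. smult (poly P a) (q a)) x" using fin x by simp
  next
    have "card A > 0" using P by simp
    show "degree (\<Sum>a\<in>A. smult (poly P a) (q a)) < card A"
    proof (rule le_less_trans[OF degree_sum_le[OF fin, of _ "card A - 1"]])
      fix a assume "a \<in> A"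
      then show "degree (smult (poly P a) (q a)) \<le> card A - 1" using deg[of a] degree_smult_le[of "poly P a" "q a"] by simp
    qed (use \<open>card A > 0\<close> in simp)
  qed (use P in auto)
  then show ?thesis by blast
qed

definition colatitude :: "nat \<Rightarrow> nat \<Rightarrow> real" where
  "colatitude m j = real j * pi / real (2 * m)"

lemma colatitude_range:
  assumes "j \<in> {1..<2 * m}" shows "0 < colatitude m j" "colatitude m j < pi" "0 < sin (colatitude m j)"
proof -
  show 1: "0 < colatitude m j" using assms by (simp add: colatitude_def)
  have "real j * pi < real (2 * m) * pi" using assms by (intro mult_strict_right_mono) auto
  then show 2: "colatitude m j < pi" using assms by (simp add: colatitude_def field_simps)
  show "0 < sin (colatitude m j)" using 1 2 by (rule sin_gt_zero)
qed

lemma inj_on_cos_colatitude: "inj_on (\<lambda>j. cos (colatitude m j)) {1..<2 * m}"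
proof (rule inj_onI)
  fix i j assume i: "i \<in> {1..<2 * m}" and j: "j \<in> {1..<2 * m}" and e: "cos (colatitude m i) = cos (colatitude m j)"
  have "colatitude m i = colatitude m j"
    using cos_inj_pi[OF _ _ _ _ e] colatitude_range[OF i] colatitude_range[OF j] by simp
  then show "i = j" using i by (simp add: colatitude_def)
qed

text \<open>
  Each circle of latitude counts with its radius, and its \<open>M\<close> beads with the sum \<open>w j\<close> of theirs.
  The factor \<open>20 m\<close> leaves at least half of every quadrature weight to the beads.
\<close>

abbreviation exact_with_beads :: "nat \<Rightarrow> real \<Rightarrow> (nat \<Rightarrow> real) \<Rightarrow> bool" where
  "exact_with_beads m M w \<equiv> \<forall>P. degree P + 2 \<le> 2 * m \<longrightarrow>
     (\<Sum>j\<in>{1..<2 * m}. sin (colatitude m j) * poly P (cos (colatitude m j)) + w j * tilted_mean (colatitude m j) (w j / M) P)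
     = 20 * real m * integral {0..pi} (\<lambda>\<theta>. poly P (cos \<theta>) * sin \<theta>)"

text \<open>
  With \<open>b j\<close> the excess of \<open>40 m\<close> times Fejer's weight over \<open>sin \<theta>\<^sub>j\<close>, point masses \<open>b j\<close> would
  complete the rule.  Beads of total weight \<open>w j\<close> commit the error
  \<open>w j (tilted_mean - point value)\<close>; expanding this error in the Lagrange basis \<open>q j\<close> of the
  nodes turns exactness into the fixed point equation of \<open>perturbed_weights\<close>.
\<close>

lemma weighted_latitudes:
  assumes m: "m > 0"
  shows "\<exists>\<beta> B M0. 0 < \<beta> \<and> (\<forall>M\<ge>M0. \<exists>w. (\<forall>j\<in>{1..<2 * m}. \<beta> \<le> w j \<and> w j \<le> B) \<and> exact_with_beads m M w)"
proof -
  define J where "J = {1..<2 * m}"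
  define z where "z j = cos (colatitude m j)" for j
  have fin: "finite J" and J0: "J \<noteq> {}" using m by (auto simp: J_def)
  define b where "b j = (40 * real m * node_weight m j - 1) * sin (colatitude m j)" for j
  define \<beta> where "\<beta> = Min ((\<lambda>j. sin (colatitude m j)) ` J)"
  define B where "B = Max (b ` J)"
  have \<beta>: "0 < \<beta>" unfolding \<beta>_def using fin J0 colatitude_range(3) by (auto simp: J_def)
  have b: "\<beta> \<le> b j \<and> b j \<le> B" if j: "j \<in> J" for j
  proof
    have "40 * real m * node_weight m j \<ge> 2"
      using odd_sine_sum_nodes[OF m, of j] j m by (simp add: J_def node_weight_def)
    then have "1 * sin (colatitude m j) \<le> b j"
      unfolding b_def using colatitude_range(3)[of j m] j by (intro mult_right_mono) (auto simp: J_def)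
    moreover have "\<beta> \<le> sin (colatitude m j)" unfolding \<beta>_def using fin j by simp
    ultimately show "\<beta> \<le> b j" by simp
    show "b j \<le> B" unfolding B_def using fin j by simp
  qed
  have BB: "\<beta> \<le> B" using b J0 by fastforce
  have inj: "inj_on z J" unfolding z_def[abs_def] J_def by (rule inj_on_cos_colatitude)
  obtain q0 :: "real \<Rightarrow> real poly" where q0: "\<And>P. degree P < card (z ` J) \<Longrightarrow> P = (\<Sum>a\<in>z ` J. smult (poly P a) (q0 a))"
    using lagrange_interpolation[of "z ` J"] fin by auto
  define q where "q j = q0 (z j)" for j
  have q: "P = (\<Sum>j\<in>J. smult (poly P (z j)) (q j))" if "degree P + 2 \<le> 2 * m" for P
  proof -
    have "card (z ` J) = card J" by (rule card_image[OF inj])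
    then have "degree P < card (z ` J)" using that m by (simp only: J_def card_atLeastLessThan)
    from q0[OF this] show ?thesis by (simp add: sum.reindex[OF inj] q_def)
  qed
  define h where "h i j r = tilted_mean (colatitude m i) r (q j) - poly (q j) (z i)" for i j r
  have "\<forall>j. \<exists>C\<ge>0. \<forall>\<theta>. \<forall>r\<in>{0..1/2}. \<forall>s\<in>{0..1/2}. \<bar>tilted_mean \<theta> r (q j) - tilted_mean \<theta> s (q j)\<bar> \<le> C * \<bar>r - s\<bar>"
    using tilted_mean_lipschitz by blast
  then obtain C where C: "\<And>j. C j \<ge> 0" "\<And>j \<theta> r s. r \<in> {0..1/2} \<Longrightarrow> s \<in> {0..1/2} \<Longrightarrow>
      \<bar>tilted_mean \<theta> r (q j) - tilted_mean \<theta> s (q j)\<bar> \<le> C j * \<bar>r - s\<bar>" by metis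
  define L where "L = (\<Sum>j\<in>J. C j)"
  have L: "0 \<le> L" unfolding L_def using C(1) by (intro sum_nonneg) auto
  have h0: "h i j 0 = 0" for i j by (simp add: h_def tilted_mean_0 z_def)
  have lip: "\<bar>h i j r - h i j s\<bar> \<le> L * \<bar>r - s\<bar>" if "i \<in> J" "j \<in> J" "r \<in> {0..1/2}" "s \<in> {0..1/2}" for i j r s
  proof -
    have "\<bar>h i j r - h i j s\<bar> \<le> C j * \<bar>r - s\<bar>" unfolding h_def using C(2)[OF that(3,4)] by simp
    also have "\<dots> \<le> L * \<bar>r - s\<bar>" unfolding L_def using fin that C(1) by (intro mult_right_mono member_le_sum) auto
    finally show ?thesis .
  qed
  define M0 where "M0 = 4 * B + 8 * real (card J) * B\<^sup>2 * L / \<beta> + 8 * real (card J) * B * L"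
  have "\<exists>w. (\<forall>j\<in>J. \<beta> / 2 \<le> w j \<and> w j \<le> 2 * B) \<and>
     (\<forall>P. degree P + 2 \<le> 2 * m \<longrightarrow>
        (\<Sum>j\<in>J. sin (colatitude m j) * poly P (z j) + w j * tilted_mean (colatitude m j) (w j / M) P)
        = 20 * real m * integral {0..pi} (\<lambda>\<theta>. poly P (cos \<theta>) * sin \<theta>))" if M: "M \<ge> M0" for M
  proof -
    have "\<exists>w. \<forall>j\<in>J. w j = b j - (\<Sum>i\<in>J. w i * h i j (w i / M)) \<and> \<beta> / 2 \<le> w j \<and> w j \<le> 2 * B"
    proof (rule perturbed_weights[OF fin \<beta> _ _ _ L BB M[unfolded M0_def]])
      show "\<beta> \<le> b j \<and> b j \<le> B" if "j \<in> J" for j by (rule b[OF that])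
      show "h i j 0 = 0" for i j by (rule h0)
      show "\<bar>h i j r - h i j s\<bar> \<le> L * \<bar>r - s\<bar>" if "i \<in> J" "j \<in> J" "r \<in> {0..1/2}" "s \<in> {0..1/2}" for i j r s
        by (rule lip[OF that])
    qed
    then obtain w where "\<forall>j\<in>J. w j = b j - (\<Sum>i\<in>J. w i * h i j (w i / M)) \<and> \<beta> / 2 \<le> w j \<and> w j \<le> 2 * B" ..
    then have weq: "\<And>j. j \<in> J \<Longrightarrow> w j = b j - (\<Sum>i\<in>J. w i * h i j (w i / M))"
      and wr: "\<forall>j\<in>J. \<beta> / 2 \<le> w j \<and> w j \<le> 2 * B" by blast+
    have "(\<Sum>j\<in>J. sin (colatitude m j) * poly P (z j) + w j * tilted_mean (colatitude m j) (w j / M) P)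
        = 20 * real m * integral {0..pi} (\<lambda>\<theta>. poly P (cos \<theta>) * sin \<theta>)" if P: "degree P + 2 \<le> 2 * m" for P
    proof -
      have expand: "tilted_mean \<theta> r P = (\<Sum>j\<in>J. poly P (z j) * tilted_mean \<theta> r (q j))" for \<theta> r
        by (subst q[OF P]) (simp add: tilted_mean_sum tilted_mean_smult)
      have expand0: "poly P x = (\<Sum>j\<in>J. poly P (z j) * poly (q j) x)" for x
        by (subst q[OF P]) (simp add: poly_sum)
      have "(\<Sum>j\<in>J. w j * poly P (z j)) = (\<Sum>j\<in>J. (b j - (\<Sum>i\<in>J. w i * h i j (w i / M))) * poly P (z j))"
        by (intro sum.cong refl arg_cong2[where f = "(*)"] weq)
      also have "\<dots> = (\<Sum>j\<in>J. b j * poly P (z j)) - (\<Sum>j\<in>J. \<Sum>i\<in>J. w i * (poly P (z j) * h i j (w i / M)))"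
        unfolding left_diff_distrib sum_subtractf sum_distrib_right by (simp add: mult_ac)
      also have "(\<Sum>j\<in>J. \<Sum>i\<in>J. w i * (poly P (z j) * h i j (w i / M)))
          = (\<Sum>i\<in>J. w i * (\<Sum>j\<in>J. poly P (z j) * h i j (w i / M)))"
        by (subst sum.swap) (simp add: sum_distrib_left)
      also have "\<dots> = (\<Sum>i\<in>J. w i * (tilted_mean (colatitude m i) (w i / M) P - poly P (z i)))"
        unfolding h_def right_diff_distrib sum_subtractf expand[symmetric] expand0[symmetric] ..
      finally have 1: "(\<Sum>j\<in>J. w j * tilted_mean (colatitude m j) (w j / M) P) = (\<Sum>j\<in>J. b j * poly P (z j))"
        by (simp add: right_diff_distrib sum_subtractf)
      have "(\<Sum>j\<in>J. sin (colatitude m j) * poly P (z j) + w j * tilted_mean (colatitude m j) (w j / M) P)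
         = (\<Sum>j\<in>J. 40 * real m * (node_weight m j * sin (colatitude m j) * poly P (z j)))"
        unfolding sum.distrib 1 unfolding sum.distrib[symmetric] by (rule sum.cong) (simp_all add: b_def algebra_simps)
      also have "\<dots> = 20 * real m * (2 * (\<Sum>j\<in>J. node_weight m j * sin (colatitude m j) * poly P (z j)))"
        by (simp add: sum_distrib_left mult_ac)
      also have "(\<Sum>j\<in>J. node_weight m j * sin (colatitude m j) * poly P (z j)) = (\<Sum>j<2 * m. node_weight m j * sin (colatitude m j) * poly P (z j))"
        by (rule sum.mono_neutral_left) (auto simp: J_def colatitude_def Suc_le_eq)
      also have "2 * \<dots> = integral {0..pi} (\<lambda>\<theta>. poly P (cos \<theta>) * sin \<theta>)"
        using integral_unique[OF node_quadrature[OF m P]] unfolding z_def colatitude_def by simp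
      finally show ?thesis .
    qed
    with wr show ?thesis by blast
  qed
  moreover have "0 < \<beta> / 2" using \<beta> by simp
  ultimately show ?thesis unfolding J_def z_def by blast
qed

section \<open>Moments of the sphere\<close>

definition monom3 :: "nat \<Rightarrow> nat \<Rightarrow> nat \<Rightarrow> real ^ 3 \<Rightarrow> real" where
  "monom3 a b c x = (x $ 1) ^ a * (x $ 2) ^ b * (x $ 3) ^ c"

definition equator_moment :: "nat \<Rightarrow> nat \<Rightarrow> real" where
  "equator_moment a b = integral {0..2 * pi} (\<lambda>\<phi>. cos \<phi> ^ a * sin \<phi> ^ b)"

definition polar_moment :: "nat \<Rightarrow> nat \<Rightarrow> real" where
  "polar_moment p c = integral {0..pi} (\<lambda>\<theta>. cos \<theta> ^ c * sin \<theta> ^ p)"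

abbreviation angle_step :: "nat \<Rightarrow> nat \<Rightarrow> real" where
  "angle_step M k \<equiv> real k * (2 * pi / real M)"

text \<open>
  Equally spaced points integrate trigonometric polynomials of degree less than \<open>M\<close> exactly.  The
  extra factor with frequency \<open>l\<close> and phase \<open>\<beta>\<close> makes the induction on the exponents possible:
  it absorbs one factor \<open>cos x\<close> or \<open>sin x\<close> at a time.
\<close>

lemma rotation_quadrature:
  fixes l :: int
  assumes "\<bar>l\<bar> + int a + int b < int M"
  shows "((\<lambda>x. cos x ^ a * sin x ^ b * cos (of_int l * x + \<beta>)) has_integral
     2 * pi / real M * (\<Sum>k<M. cos (\<alpha> + angle_step M k) ^ a * sin (\<alpha> + angle_step M k) ^ b
        * cos (of_int l * (\<alpha> + angle_step M k) + \<beta>))) {0..2 * pi}"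
  using assms
proof (induction "a + b" arbitrary: a b l \<beta>)
  case 0
  then have M: "M > 0" and ab: "a = 0" "b = 0" by auto
  let ?x = "\<lambda>k. \<alpha> + angle_step M k"
  show ?case
  proof (cases "l = 0")
    case True
    then show ?thesis using M ab has_integral_const_real[of "cos \<beta>" 0 "2 * pi"] by (simp add: mult.assoc)
  next
    case False
    define h where "h = of_int l * (2 * pi / real M)"
    have "sin (h / 2) \<noteq> 0"
    proof
      assume "sin (h / 2) = 0"
      then obtain i :: int where "h / 2 = of_int i * pi" using sin_zero_iff_int2 by blast
      then have "of_int l = (of_int (i * int M) :: real)" using M by (simp add: h_def field_simps)
      then have e: "l = i * int M" by linarith
      then have "i \<noteq> 0" using False by auto
      then have "1 * int M \<le> \<bar>i\<bar> * int M" by (intro mult_right_mono) auto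
      then show False using 0 e by (simp add: abs_mult)
    qed
    moreover have "2 * sin (h / 2) * (\<Sum>k<M. cos ((of_int l * \<alpha> + \<beta>) + real k * h)) = 0"
    proof -
      have "(of_int l * \<alpha> + \<beta>) + (real M - 1 / 2) * h = ((of_int l * \<alpha> + \<beta>) - h / 2) + 2 * pi * of_int l"
        using M by (simp add: h_def field_simps)
      then have "sin ((of_int l * \<alpha> + \<beta>) + (real M - 1 / 2) * h) = sin ((of_int l * \<alpha> + \<beta>) - h / 2)"
        using sin_cos_eq_iff by metis
      then show ?thesis by (simp only: sum_cos_arith)
    qed
    ultimately have "(\<Sum>k<M. cos ((of_int l * \<alpha> + \<beta>) + real k * h)) = 0" by simp
    then have S: "(\<Sum>k<M. cos (of_int l * ?x k + \<beta>)) = 0" by (simp add: h_def algebra_simps)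
    have "((\<lambda>x. cos (of_int l * x + \<beta>)) has_integral
       (sin (of_int l * (2 * pi) + \<beta>) / of_int l - sin (of_int l * 0 + \<beta>) / of_int l)) {0..2 * pi}"
      using False by (intro fundamental_theorem_of_calculus)
        (auto intro!: derivative_eq_intros simp flip: has_real_derivative_iff_has_vector_derivative)
    moreover have "sin (of_int l * (2 * pi) + \<beta>) = sin (of_int l * 0 + \<beta>)"
      using sin_cos_eq_iff[of "of_int l * (2 * pi) + \<beta>" "of_int l * 0 + \<beta>"] by (auto simp: algebra_simps)
    ultimately show ?thesis using S ab by simp
  qed
next
  case (Suc n)
  let ?x = "\<lambda>k. \<alpha> + angle_step M k"
  show ?case
  proof (cases a)
    case (Suc a')
    have prod: "cos x ^ a * sin x ^ b * cos (of_int l * x + \<beta>) =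
       1 / 2 * (cos x ^ a' * sin x ^ b * cos (of_int (l + 1) * x + \<beta>) + cos x ^ a' * sin x ^ b * cos (of_int (l - 1) * x + \<beta>))" for x :: real
    proof -
      have "of_int (l + 1) * x + \<beta> = (of_int l * x + \<beta>) + x" "of_int (l - 1) * x + \<beta> = (of_int l * x + \<beta>) - x"
        by (simp_all add: algebra_simps)
      then show ?thesis by (simp only: cos_add cos_diff Suc power_Suc) (simp add: algebra_simps)
    qed
    have n: "n = a' + b" and b1: "\<bar>l + 1\<bar> + int a' + int b < int M" "\<bar>l - 1\<bar> + int a' + int b < int M"
      using Suc.hyps(2) Suc.prems Suc by auto
    note IH = has_integral_mult_right[OF has_integral_add[OF Suc.hyps(1)[OF n b1(1), of \<beta>] Suc.hyps(1)[OF n b1(2), of \<beta>]], of "1 / 2"]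
    show ?thesis unfolding prod by (rule has_integral_eq_rhs[OF IH]) (simp add: sum.distrib sum_distrib_left algebra_simps)
  next
    case 0
    then obtain b' where b: "b = Suc b'" using Suc.hyps(2) by (cases b) auto
    have prod: "cos x ^ a * sin x ^ b * cos (of_int l * x + \<beta>) =
       1 / 2 * (cos x ^ a * sin x ^ b' * cos (of_int (l + 1) * x + (\<beta> - pi / 2)) - cos x ^ a * sin x ^ b' * cos (of_int (l - 1) * x + (\<beta> - pi / 2)))" for x :: real
    proof -
      have c: "cos (x - pi / 2) = sin x" for x :: real by (simp add: cos_diff)
      have "of_int (l + 1) * x + (\<beta> - pi / 2) = ((of_int l * x + \<beta>) + x) - pi / 2" "of_int (l - 1) * x + (\<beta> - pi / 2) = ((of_int l * x + \<beta>) - x) - pi / 2"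
        by (simp_all add: algebra_simps)
      then have "cos (of_int (l + 1) * x + (\<beta> - pi / 2)) = sin ((of_int l * x + \<beta>) + x)" "cos (of_int (l - 1) * x + (\<beta> - pi / 2)) = sin ((of_int l * x + \<beta>) - x)"
        by (simp_all only: c)
      then show ?thesis by (simp only: sin_add sin_diff b power_Suc) (simp add: algebra_simps)
    qed
    have n: "n = a + b'" and b1: "\<bar>l + 1\<bar> + int a + int b' < int M" "\<bar>l - 1\<bar> + int a + int b' < int M"
      using Suc.hyps(2) Suc.prems b by auto
    note IH = has_integral_mult_right[OF has_integral_diff[OF Suc.hyps(1)[OF n b1(1), of "\<beta> - pi / 2"] Suc.hyps(1)[OF n b1(2), of "\<beta> - pi / 2"]], of "1 / 2"]
    show ?thesis unfolding prod by (rule has_integral_eq_rhs[OF IH]) (simp add: sum_subtractf sum_distrib_left algebra_simps)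
  qed
qed

lemma equator_moment_rotation:
  assumes "a + b < M"
  shows "(\<Sum>k<M. cos (\<alpha> + angle_step M k) ^ a * sin (\<alpha> + angle_step M k) ^ b)
     = real M * equator_moment a b / (2 * pi)"
proof -
  have "((\<lambda>\<phi>. cos \<phi> ^ a * sin \<phi> ^ b) has_integral
     2 * pi / real M * (\<Sum>k<M. cos (\<alpha> + angle_step M k) ^ a * sin (\<alpha> + angle_step M k) ^ b)) {0..2 * pi}"
    using rotation_quadrature[of 0 a b M 0 \<alpha>] assms by simp
  from integral_unique[OF this] show ?thesis using assms by (simp add: equator_moment_def)
qed

text \<open>
  A half turn changes the sign of the integrand.
\<close>

lemma equator_moment_odd:
  assumes "odd (a + b)" shows "equator_moment a b = 0"
proof -
  define M where "M = Suc (a + b)"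
  define S where "S \<alpha> = (\<Sum>k<M. cos (\<alpha> + angle_step M k) ^ a * sin (\<alpha> + angle_step M k) ^ b)" for \<alpha>
  have "cos (pi + x) ^ a * sin (pi + x) ^ b = - (cos x ^ a * sin x ^ b)" for x :: real
  proof -
    have "cos (pi + x) ^ a * sin (pi + x) ^ b = (- 1) ^ (a + b) * (cos x ^ a * sin x ^ b)"
      by (simp add: cos_add sin_add power_add power_minus[of "cos x"] power_minus[of "sin x"])
    then show ?thesis using assms by simp
  qed
  then have "S pi = - S 0" unfolding S_def by (simp flip: sum_negf)
  moreover have "S pi = S 0" unfolding S_def by (simp only: equator_moment_rotation M_def less_Suc_eq_le order_refl)
  ultimately have "S 0 = 0" by simp
  then show ?thesis using equator_moment_rotation[of a b M 0] by (simp add: S_def M_def)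
qed

lemma DERIV_cos_power_sin_power:
  "((\<lambda>x. cos x ^ (a + 1) * sin x ^ (b + 1)) has_real_derivative
     real (b + 1) * (cos x ^ (a + 2) * sin x ^ b) - real (a + 1) * (cos x ^ a * sin x ^ (b + 2))) (at x within S)"
proof -
  have c: "((\<lambda>x. cos x ^ (a + 1)) has_real_derivative real (a + 1) * (- sin x * cos x ^ a)) (at x within S)"
    using DERIV_power[OF DERIV_cos[of x, THEN has_field_derivative_at_within, of S], where n = "a + 1"] by simp
  have s: "((\<lambda>x. sin x ^ (b + 1)) has_real_derivative real (b + 1) * (cos x * sin x ^ b)) (at x within S)"
    using DERIV_power[OF DERIV_sin[of x, THEN has_field_derivative_at_within, of S], where n = "b + 1"] by simp
  show ?thesis by (rule DERIV_cong[OF DERIV_mult[OF c s]]) (simp add: algebra_simps power2_eq_square)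
qed

lemma has_integral_cos_sin_power:
  assumes "a \<le> b"
  shows "((\<lambda>x. cos x ^ 1 * sin x ^ p) has_integral (sin b ^ (p + 1) / real (p + 1) - sin a ^ (p + 1) / real (p + 1))) {a..b}"
proof (rule fundamental_theorem_of_calculus[OF assms])
  fix x
  have "((\<lambda>x. sin x ^ (p + 1) / real (p + 1)) has_real_derivative real (p + 1) * (cos x * sin x ^ p) / real (p + 1)) (at x within {a..b})"
    using DERIV_cdivide[OF DERIV_power[OF DERIV_sin[of x, THEN has_field_derivative_at_within, of "{a..b}"], where n = "p + 1"], of "real (p + 1)"] by simp
  moreover have "real (p + 1) * (cos x * sin x ^ p) / real (p + 1) = cos x ^ 1 * sin x ^ p" by (simp del: of_nat_add)
  ultimately show "((\<lambda>x. sin x ^ (p + 1) / real (p + 1)) has_vector_derivative cos x ^ 1 * sin x ^ p) (at x within {a..b})"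
    by (simp only: has_real_derivative_iff_has_vector_derivative)
qed

text \<open>
  Integrate the derivative of \<open>cos\<^sup>a\<^sup>+\<^sup>1 x sin\<^sup>b\<^sup>+\<^sup>1 x\<close> over a period, and use \<open>cos\<^sup>2 + sin\<^sup>2 = 1\<close>.
\<close>

lemma equator_moment_rec: "real (a + b + 2) * equator_moment (a + 2) b = real (a + 1) * equator_moment a b"
proof -
  have i: "(\<lambda>x. cos x ^ a * sin x ^ b) integrable_on {0..2 * pi}" for a b
    by (intro integrable_continuous_real continuous_intros)
  have "((\<lambda>x. real (b + 1) * (cos x ^ (a + 2) * sin x ^ b) - real (a + 1) * (cos x ^ a * sin x ^ (b + 2))) has_integral
     (cos (2 * pi) ^ (a + 1) * sin (2 * pi) ^ (b + 1) - cos 0 ^ (a + 1) * sin 0 ^ (b + 1))) {0..2 * pi}"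
    by (intro fundamental_theorem_of_calculus)
      (simp_all only: DERIV_cos_power_sin_power flip: has_real_derivative_iff_has_vector_derivative, simp_all)
  then have "integral {0..2 * pi} (\<lambda>x. real (b + 1) * (cos x ^ (a + 2) * sin x ^ b) - real (a + 1) * (cos x ^ a * sin x ^ (b + 2))) = 0"
    by (simp add: integral_unique)
  then have 1: "real (b + 1) * equator_moment (a + 2) b = real (a + 1) * equator_moment a (b + 2)"
    unfolding equator_moment_def
    by (subst (asm) Henstock_Kurzweil_Integration.integral_diff) (auto intro!: integrable_on_mult_right i simp del: power_Suc of_nat_add)
  have 2: "equator_moment a b = equator_moment (a + 2) b + equator_moment a (b + 2)"
    unfolding equator_moment_def
  proof (subst Henstock_Kurzweil_Integration.integral_add[OF i i, symmetric], rule arg_cong[where f = "integral _"], rule ext)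
    fix x :: real
    have "cos x ^ (a + 2) * sin x ^ b + cos x ^ a * sin x ^ (b + 2) = cos x ^ a * sin x ^ b * ((cos x)\<^sup>2 + (sin x)\<^sup>2)"
      unfolding power_add by (simp only: algebra_simps)
    then show "cos x ^ a * sin x ^ b = cos x ^ (a + 2) * sin x ^ b + cos x ^ a * sin x ^ (b + 2)" by simp
  qed
  have "real (a + 1) * equator_moment a b = real (a + 1) * equator_moment (a + 2) b + real (b + 1) * equator_moment (a + 2) b"
    unfolding 2 distrib_left 1 ..
  then show ?thesis by (simp add: algebra_simps)
qed

text \<open>
  As for the equator; here the boundary terms vanish because \<open>sin\<close> does at \<open>0\<close> and \<open>\<pi>\<close>.
\<close>

lemma polar_moment_rec:
  "real (p + c + 2) * polar_moment p (c + 2) = real (c + 1) * polar_moment p c" (is ?A)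
  "real (p + c + 2) * polar_moment (p + 2) c = real (p + 1) * polar_moment p c" (is ?B)
proof -
  have i: "(\<lambda>x. cos x ^ c * sin x ^ p) integrable_on {0..pi}" for p c
    by (intro integrable_continuous_real continuous_intros)
  have "((\<lambda>x. real (p + 1) * (cos x ^ (c + 2) * sin x ^ p) - real (c + 1) * (cos x ^ c * sin x ^ (p + 2))) has_integral
     (cos pi ^ (c + 1) * sin pi ^ (p + 1) - cos 0 ^ (c + 1) * sin 0 ^ (p + 1))) {0..pi}"
    by (intro fundamental_theorem_of_calculus)
      (simp_all only: DERIV_cos_power_sin_power flip: has_real_derivative_iff_has_vector_derivative, simp_all)
  then have "integral {0..pi} (\<lambda>x. real (p + 1) * (cos x ^ (c + 2) * sin x ^ p) - real (c + 1) * (cos x ^ c * sin x ^ (p + 2))) = 0"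
    by (simp add: integral_unique)
  then have 1: "real (p + 1) * polar_moment p (c + 2) = real (c + 1) * polar_moment (p + 2) c"
    unfolding polar_moment_def
    by (subst (asm) Henstock_Kurzweil_Integration.integral_diff) (auto intro!: integrable_on_mult_right i simp del: power_Suc of_nat_add)
  have 2: "polar_moment p c = polar_moment (p + 2) c + polar_moment p (c + 2)"
    unfolding polar_moment_def
  proof (subst Henstock_Kurzweil_Integration.integral_add[OF i i, symmetric], rule arg_cong[where f = "integral _"], rule ext)
    fix x :: real
    have "cos x ^ c * sin x ^ (p + 2) + cos x ^ (c + 2) * sin x ^ p = cos x ^ c * sin x ^ p * ((sin x)\<^sup>2 + (cos x)\<^sup>2)"
      unfolding power_add by (simp only: algebra_simps)
    then show "cos x ^ c * sin x ^ p = cos x ^ c * sin x ^ (p + 2) + cos x ^ (c + 2) * sin x ^ p" by simp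
  qed
  have "real (c + 1) * polar_moment p c = real (p + 1) * polar_moment p (c + 2) + real (c + 1) * polar_moment p (c + 2)"
    unfolding 2 distrib_left 1 ..
  then show ?A by (simp add: algebra_simps)
  have "real (p + 1) * polar_moment p c = real (p + 1) * polar_moment (p + 2) c + real (c + 1) * polar_moment (p + 2) c"
    unfolding 2 distrib_left 1 ..
  then show ?B by (simp add: algebra_simps)
qed

lemma polar_moment_1: "polar_moment p 1 = 0"
  using integral_unique[OF has_integral_cos_sin_power[of 0 pi p]] unfolding polar_moment_def by simp

lemma equator_moment_1: "equator_moment 1 b = 0"
  using integral_unique[OF has_integral_cos_sin_power[of 0 "2 * pi" b]] unfolding equator_moment_def by simp

definition sphere_moment :: "nat \<Rightarrow> nat \<Rightarrow> nat \<Rightarrow> real" where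
  "sphere_moment a b c = polar_moment (a + b + 1) c * equator_moment a b / (4 * pi)"

text \<open>
  The two recursions have the same shape in the first and in the third exponent.  This is what makes
  the moments symmetric, although spherical coordinates single out the third axis.
\<close>

lemma sphere_moment_rec:
  "sphere_moment (a + 2) b c = real (a + 1) / real (a + b + c + 3) * sphere_moment a b c" (is ?A)
  "sphere_moment a b (c + 2) = real (c + 1) / real (a + b + c + 3) * sphere_moment a b c" (is ?B)
proof -
  have "real (a + b + c + 3) * polar_moment (a + b + 3) c = real (a + b + 2) * polar_moment (a + b + 1) c"
    using polar_moment_rec(2)[of "a + b + 1" c] by (simp add: algebra_simps numeral_3_eq_3)
  then have "real (a + b + c + 3) * (polar_moment (a + b + 3) c * equator_moment (a + 2) b) =
      polar_moment (a + b + 1) c * (real (a + b + 2) * equator_moment (a + 2) b)" by (metis mult.assoc mult.commute)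
  also have "\<dots> = real (a + 1) * (polar_moment (a + b + 1) c * equator_moment a b)" unfolding equator_moment_rec by simp
  finally have "polar_moment (a + b + 3) c * equator_moment (a + 2) b = real (a + 1) / real (a + b + c + 3) * (polar_moment (a + b + 1) c * equator_moment a b)"
    by (simp add: eq_divide_eq mult.commute del: of_nat_add)
  moreover have e: "a + 2 + b + 1 = a + b + 3" by simp
  ultimately show ?A unfolding sphere_moment_def e by (simp only: times_divide_eq_right)
  have "real (a + b + c + 3) * polar_moment (a + b + 1) (c + 2) = real (c + 1) * polar_moment (a + b + 1) c"
    using polar_moment_rec(1)[of "a + b + 1" c] by (simp add: algebra_simps numeral_3_eq_3)
  then have "polar_moment (a + b + 1) (c + 2) = real (c + 1) / real (a + b + c + 3) * polar_moment (a + b + 1) c"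
    by (simp add: eq_divide_eq mult.commute del: of_nat_add)
  then show ?B unfolding sphere_moment_def by simp
qed

text \<open>
  By the recursions both exponents reduce to \<open>0\<close> or \<open>1\<close>, and the moment vanishes if one of them
  is \<open>1\<close>.
\<close>

lemma sphere_moment_swap: "sphere_moment a b c = sphere_moment c b a"
proof -
  have z1: "sphere_moment 1 b c = 0" "sphere_moment a b 1 = 0" for a c
    unfolding sphere_moment_def by (simp_all only: equator_moment_1 polar_moment_1 mult_zero_right mult_zero_left div_0)
  have base: "sphere_moment 0 b c = sphere_moment c b 0" for c
  proof (induction c rule: induct_nat_012)
    case (ge2 c)
    have "sphere_moment 0 b (c + 2) = sphere_moment (c + 2) b 0" unfolding sphere_moment_rec ge2(1) by (simp add: add.commute)
    then show ?case by simp
  qed (simp_all only: z1 flip: One_nat_def)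
  show ?thesis
  proof (induction a arbitrary: c rule: induct_nat_012)
    case 0 then show ?case by (rule base)
  next
    case 1 then show ?case by (simp only: z1 flip: One_nat_def)
  next
    case (ge2 a)
    have "sphere_moment (a + 2) b c = sphere_moment c b (a + 2)" unfolding sphere_moment_rec ge2(1)[of c] by (simp add: add_ac)
    then show ?case by simp
  qed
qed

lemma continuous_spherical_point: "continuous_on S (\<lambda>p. spherical_point (fst p) (snd p))"
  using continuous_on_subset[OF continuous_on_spherical_point, of S] by (simp add: case_prod_beta)

lemma sphere_integral:
  assumes f: "continuous_on UNIV f"
  shows "(\<integral>x. f x \<partial>sphere_measure) =
    integral (cbox (0, 0) (pi, 2 * pi)) (\<lambda>p. sin (fst p) / (4 * pi) * f (spherical_point (fst p) (snd p)))"
proof -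
  let ?S = "cbox (0, 0) (pi, 2 * pi) :: (real \<times> real) set"
  let ?F = "\<lambda>p. sin (fst p) / (4 * pi) * f (spherical_point (fst p) (snd p))"
  define g where "g p = indicator ?S p * (sin (fst p) / (4 * pi))" for p :: "real \<times> real"
  have spm: "(\<lambda>p. spherical_point (fst p) (snd p)) \<in> borel_measurable borel"
    by (rule borel_measurable_continuous_onI[OF continuous_spherical_point])
  have fm: "f \<in> borel_measurable borel" by (rule borel_measurable_continuous_onI[OF f])
  have contF: "continuous_on ?S ?F"
    by (intro continuous_intros continuous_on_compose2[OF f continuous_spherical_point]) auto
  have gm: "g \<in> borel_measurable borel"
    unfolding g_def[abs_def]
    by (intro borel_measurable_times borel_measurable_indicator borel_measurable_continuous_onI continuous_intros) auto
  have g0: "0 \<le> g p" for p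
    unfolding g_def by (auto simp: indicator_def sin_ge_zero cbox_Pair_eq)
  have dens: "(\<lambda>(\<theta>, \<phi>). ennreal (sin \<theta> / (4 * pi)) * indicator ({0..pi} \<times> {0..2 * pi}) (\<theta>, \<phi>)) = (\<lambda>p. ennreal (g p))"
    by (auto simp: g_def indicator_def cbox_Pair_eq)
  have "(\<integral>x. f x \<partial>sphere_measure) = (\<integral>p. f (spherical_point (fst p) (snd p)) \<partial>density lborel (\<lambda>p. ennreal (g p)))"
    unfolding sphere_measure_def dens case_prod_beta
    by (rule integral_distr) (use spm fm in simp_all)
  also have "\<dots> = (\<integral>p. g p *\<^sub>R f (spherical_point (fst p) (snd p)) \<partial>lborel)"
    by (rule integral_density) (use gm g0 measurable_compose[OF spm fm] in simp_all)
  also have "\<dots> = (LINT p:?S|lborel. ?F p)"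
    unfolding set_lebesgue_integral_def g_def by (simp add: mult.assoc)
  also have "\<dots> = integral ?S ?F"
    by (rule set_borel_integral_eq_integral) (unfold set_integrable_def, rule borel_integrable_compact[OF compact_cbox contF])
  finally show ?thesis .
qed

lemma continuous_monom3: "continuous_on S (monom3 a b c)"
  unfolding monom3_def[abs_def] by (intro continuous_intros)

lemma sphere_integral_monom3: "(\<integral>x. monom3 a b c x \<partial>sphere_measure) = sphere_moment a b c"
proof -
  let ?F = "\<lambda>p. sin (fst p) / (4 * pi) * monom3 a b c (spherical_point (fst p) (snd p))"
  have contF: "continuous_on (cbox (0, 0) (pi, 2 * pi)) ?F"
    by (intro continuous_intros continuous_on_compose2[OF continuous_monom3[of UNIV] continuous_spherical_point]) auto
  have "(\<integral>x. monom3 a b c x \<partial>sphere_measure) = integral (cbox (0, 0) (pi, 2 * pi)) ?F"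
    by (rule sphere_integral[OF continuous_monom3])
  also have "\<dots> = integral (cbox 0 pi) (\<lambda>\<theta>. integral (cbox 0 (2 * pi)) (\<lambda>\<phi>. ?F (\<theta>, \<phi>)))"
    by (rule integral_prod_continuous[OF contF])
  also have "(\<lambda>\<theta>. integral (cbox 0 (2 * pi)) (\<lambda>\<phi>. ?F (\<theta>, \<phi>))) = (\<lambda>\<theta>. (cos \<theta> ^ c * sin \<theta> ^ (a + b + 1)) * (equator_moment a b / (4 * pi)))"
  proof
    fix \<theta> :: real
    have "(\<lambda>\<phi>. ?F (\<theta>, \<phi>)) = (\<lambda>\<phi>. (cos \<theta> ^ c * sin \<theta> ^ (a + b + 1)) / (4 * pi) * (cos \<phi> ^ a * sin \<phi> ^ b))"
      by (simp add: monom3_def spherical_point_def power_mult_distrib power_add mult_ac)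
    then have "integral (cbox 0 (2 * pi)) (\<lambda>\<phi>. ?F (\<theta>, \<phi>)) = (cos \<theta> ^ c * sin \<theta> ^ (a + b + 1)) / (4 * pi) * equator_moment a b"
      by (simp only: integral_mult_right box_real equator_moment_def)
    then show "integral (cbox 0 (2 * pi)) (\<lambda>\<phi>. ?F (\<theta>, \<phi>)) = (cos \<theta> ^ c * sin \<theta> ^ (a + b + 1)) * (equator_moment a b / (4 * pi))"
      by simp
  qed
  also have "integral (cbox 0 pi) \<dots> = sphere_moment a b c"
    by (simp add: sphere_moment_def polar_moment_def)
  finally show ?thesis .
qed

section \<open>Circles of latitude with beads\<close>

text \<open>
  On the section, \<open>cos u\<close> and \<open>sin u\<close> satisfy a nontrivial linear equation besides
  \<open>cos\<^sup>2 u + sin\<^sup>2 u = 1\<close>; eliminating either of them gives a nonzero quadratic for the other.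
\<close>

lemma finite_circle_section:
  assumes "n \<bullet> p \<noteq> d \<or> n \<bullet> a \<noteq> 0 \<or> n \<bullet> b \<noteq> 0"
  shows "finite {x \<in> range (circle_point (p, a, b)). n \<bullet> x = d}"
proof -
  define A B D where "A = n \<bullet> p - d" and "B = n \<bullet> a" and "D = n \<bullet> b"
  define P where "P = [:A\<^sup>2 - D\<^sup>2, 2 * A * B, B\<^sup>2 + D\<^sup>2:]"
  define Q where "Q = [:A\<^sup>2 - B\<^sup>2, 2 * A * D, B\<^sup>2 + D\<^sup>2:]"
  have "A \<noteq> 0 \<or> B \<noteq> 0 \<or> D \<noteq> 0" using assms by (auto simp: A_def B_def D_def)
  then have "P \<noteq> 0" "Q \<noteq> 0" by (auto simp: P_def Q_def sum_power2_eq_zero_iff)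
  then have fin: "finite ({x. poly P x = 0} \<times> {y. poly Q y = 0})"
    by (intro finite_cartesian_product poly_roots_finite)
  have "{x \<in> range (circle_point (p, a, b)). n \<bullet> x = d} \<subseteq>
      (\<lambda>(x, y). p + x *\<^sub>R a + y *\<^sub>R b) ` ({x. poly P x = 0} \<times> {y. poly Q y = 0})"
  proof
    fix x assume "x \<in> {x \<in> range (circle_point (p, a, b)). n \<bullet> x = d}"
    then obtain u where x: "x = p + cos u *\<^sub>R a + sin u *\<^sub>R b" and d: "n \<bullet> x = d" by auto
    have e: "A + cos u * B + sin u * D = 0"
      using d unfolding x A_def B_def D_def by (simp add: inner_add_right)
    have cs: "(cos u)\<^sup>2 + (sin u)\<^sup>2 = 1" by simp
    have "A\<^sup>2 - D\<^sup>2 + cos u * (2 * A * B + cos u * (B\<^sup>2 + D\<^sup>2)) = 0" using e cs by algebra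
    moreover have "A\<^sup>2 - B\<^sup>2 + sin u * (2 * A * D + sin u * (B\<^sup>2 + D\<^sup>2)) = 0" using e cs by algebra
    ultimately have "poly P (cos u) = 0" "poly Q (sin u) = 0" by (simp_all add: P_def Q_def)
    then show "x \<in> (\<lambda>(x, y). p + x *\<^sub>R a + y *\<^sub>R b) ` ({x. poly P x = 0} \<times> {y. poly Q y = 0})"
      unfolding x by (intro image_eqI[of _ _ "(cos u, sin u)"]) auto
  qed
  then show ?thesis using fin finite_imageI finite_subset by blast
qed

definition orthonormal3 :: "real ^ 3 \<Rightarrow> real ^ 3 \<Rightarrow> real ^ 3 \<Rightarrow> bool" where
  "orthonormal3 n e f \<longleftrightarrow> n \<bullet> n = 1 \<and> e \<bullet> e = 1 \<and> f \<bullet> f = 1 \<and> n \<bullet> e = 0 \<and> n \<bullet> f = 0 \<and> e \<bullet> f = 0"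

lemma circle_frame_orthonormal3:
  assumes "orthonormal3 n e f" "r > 0" "d\<^sup>2 + r\<^sup>2 = 1"
  shows "circle_frame (d *\<^sub>R n, r *\<^sub>R e, r *\<^sub>R f)" "circle_radius (d *\<^sub>R n, r *\<^sub>R e, r *\<^sub>R f) = r"
    "n \<bullet> circle_point (d *\<^sub>R n, r *\<^sub>R e, r *\<^sub>R f) u = d"
  using assms unfolding orthonormal3_def by (simp_all add: norm_eq_sqrt_inner inner_add_right)

text \<open>
  If the second plane contained the whole first circle, its normal would be orthogonal to \<open>e\<close> and
  \<open>f\<close>, hence equal to \<open>n\<close> or \<open>- n\<close>.
\<close>

lemma finite_circle_Int:
  assumes o: "orthonormal3 n e f" "orthonormal3 n' e' f'" and r: "r > 0" "r' > 0"
    and d: "d\<^sup>2 + r\<^sup>2 = 1" "d'\<^sup>2 + r'\<^sup>2 = 1"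
    and ne: "(n', d') \<noteq> (n, d)" "(n', d') \<noteq> (- n, - d)"
  shows "finite (range (circle_point (d *\<^sub>R n, r *\<^sub>R e, r *\<^sub>R f)) \<inter> range (circle_point (d' *\<^sub>R n', r' *\<^sub>R e', r' *\<^sub>R f')))"
proof -
  have "n' \<bullet> (d *\<^sub>R n) \<noteq> d' \<or> n' \<bullet> (r *\<^sub>R e) \<noteq> 0 \<or> n' \<bullet> (r *\<^sub>R f) \<noteq> 0"
  proof (rule ccontr)
    assume "\<not> ?thesis"
    then have z: "d * (n' \<bullet> n) = d'" "n' \<bullet> e = 0" "n' \<bullet> f = 0" using r by auto
    define m where "m = cross3 e f"
    have m1: "norm m = 1"
      using norm_cross_dot[of e f] o(1) unfolding orthonormal3_def m_def by (simp add: norm_eq_sqrt_inner abs_square_eq_1)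
    have on: "n \<bullet> e = 0" "n \<bullet> f = 0" "norm n = 1" "norm n' = 1" using o unfolding orthonormal3_def by (simp_all add: norm_eq_sqrt_inner)
    have par: "x = m \<or> x = - m" if "x \<bullet> e = 0" "x \<bullet> f = 0" "norm x = 1" for x
    proof -
      have "cross3 x m = 0" unfolding m_def Lagrange using that by simp
      then have "collinear {0, x, m}" by (simp add: cross_eq_0)
      moreover have "x \<noteq> 0" "m \<noteq> 0" using that m1 by auto
      ultimately obtain c where c: "m = c *\<^sub>R x" unfolding collinear_lemma by blast
      then have "\<bar>c\<bar> = 1" using m1 that by simp
      then have "c = 1 \<or> c = -1" by linarith
      then show ?thesis using c by auto
    qed
    have "n' = n \<or> n' = - n" using par[OF z(2,3) on(4)] par[OF on(1-3)] by auto
    moreover have "n \<bullet> n = 1" using o unfolding orthonormal3_def by simp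
    ultimately show False using z ne by auto
  qed
  then have "finite {x \<in> range (circle_point (d *\<^sub>R n, r *\<^sub>R e, r *\<^sub>R f)). n' \<bullet> x = d'}"
    by (rule finite_circle_section)
  moreover have "range (circle_point (d *\<^sub>R n, r *\<^sub>R e, r *\<^sub>R f)) \<inter> range (circle_point (d' *\<^sub>R n', r' *\<^sub>R e', r' *\<^sub>R f'))
     \<subseteq> {x \<in> range (circle_point (d *\<^sub>R n, r *\<^sub>R e, r *\<^sub>R f)). n' \<bullet> x = d'}"
    using circle_frame_orthonormal3(3)[OF o(2) r(2) d(2)] by auto
  ultimately show ?thesis by (rule finite_subset[rotated])
qed

definition swap13 :: "real ^ 3 \<Rightarrow> real ^ 3" where
  "swap13 x = vector [x $ 3, x $ 2, x $ 1]"

lemma swap13_nth [simp]: "swap13 x $ 1 = x $ 3" "swap13 x $ 2 = x $ 2" "swap13 x $ 3 = x $ 1"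
  by (simp_all add: swap13_def)

lemma swap13_inner: "swap13 x \<bullet> swap13 y = x \<bullet> y"
  by (simp add: inner_vec_def sum_3)

lemma swap13_add: "swap13 (x + y) = swap13 x + swap13 y"
  and swap13_scaleR: "swap13 (c *\<^sub>R x) = c *\<^sub>R swap13 x"
  by (simp_all add: vec_eq_iff forall_3)

lemma orthonormal3_swap13: "orthonormal3 n e f \<Longrightarrow> orthonormal3 (swap13 n) (swap13 e) (swap13 f)"
  by (simp add: orthonormal3_def swap13_inner)

lemma circle_point_swap13:
  "circle_point (swap13 p, swap13 a, swap13 b) u = swap13 (circle_point (p, a, b) u)"
  by (simp add: swap13_add swap13_scaleR)

lemma monom3_swap13: "monom3 a b c (swap13 x) = monom3 c b a x"
  by (simp add: monom3_def)

definition theta_dir :: "real \<Rightarrow> real \<Rightarrow> real ^ 3" where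
  "theta_dir \<theta> \<phi> = vector [cos \<theta> * cos \<phi>, cos \<theta> * sin \<phi>, - sin \<theta>]"

definition phi_dir :: "real \<Rightarrow> real ^ 3" where
  "phi_dir \<phi> = vector [- sin \<phi>, cos \<phi>, 0]"

lemma orthonormal3_spherical: "orthonormal3 (spherical_point \<theta> \<phi>) (theta_dir \<theta> \<phi>) (phi_dir \<phi>)"
proof -
  have t: "(sin \<theta>)\<^sup>2 + (cos \<theta>)\<^sup>2 = 1" and p: "(sin \<phi>)\<^sup>2 + (cos \<phi>)\<^sup>2 = 1" by simp_all
  have "sin \<theta> * cos \<phi> * (sin \<theta> * cos \<phi>) + sin \<theta> * sin \<phi> * (sin \<theta> * sin \<phi>) + cos \<theta> * cos \<theta> = 1"
    using t p by algebra
  moreover have "cos \<theta> * cos \<phi> * (cos \<theta> * cos \<phi>) + cos \<theta> * sin \<phi> * (cos \<theta> * sin \<phi>) + sin \<theta> * sin \<theta> = 1"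
    using t p by algebra
  moreover have "sin \<phi> * sin \<phi> + cos \<phi> * cos \<phi> = 1" using p by algebra
  moreover have "sin \<theta> * cos \<phi> * (cos \<theta> * cos \<phi>) + sin \<theta> * sin \<phi> * (cos \<theta> * sin \<phi>) - cos \<theta> * sin \<theta> = 0"
    using p by algebra
  ultimately show ?thesis
    by (simp add: orthonormal3_def spherical_point_def theta_dir_def phi_dir_def inner_vec_def sum_3)
qed

lemma orthonormal3_axes: "orthonormal3 (vector [0, 0, 1]) (vector [1, 0, 0]) (vector [0, 1, 0])"
  by (simp add: orthonormal3_def inner_vec_def sum_3)

abbreviation latitude :: "real \<Rightarrow> circle" where
  "latitude \<theta> \<equiv> (cos \<theta> *\<^sub>R vector [0, 0, 1], sin \<theta> *\<^sub>R vector [1, 0, 0], sin \<theta> *\<^sub>R vector [0, 1, 0])"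

text \<open>
  The circle of Euclidean radius \<open>r\<close> about the direction \<open>(\<theta>, \<phi>)\<close>.
\<close>

abbreviation bead :: "real \<Rightarrow> real \<Rightarrow> real \<Rightarrow> circle" where
  "bead \<theta> \<phi> r \<equiv> (sqrt (1 - r\<^sup>2) *\<^sub>R spherical_point \<theta> \<phi>, r *\<^sub>R theta_dir \<theta> \<phi>, r *\<^sub>R phi_dir \<phi>)"

lemma circle_point_latitude: "circle_point (latitude \<theta>) u = spherical_point \<theta> u"
  by (simp add: vec_eq_iff forall_3 spherical_point_def)

lemma circle_point_bead:
  "circle_point (bead \<theta> \<phi> r) u $ 1 = (sqrt (1 - r\<^sup>2) * sin \<theta> + r * cos u * cos \<theta>) * cos \<phi> - r * sin u * sin \<phi>"
  "circle_point (bead \<theta> \<phi> r) u $ 2 = (sqrt (1 - r\<^sup>2) * sin \<theta> + r * cos u * cos \<theta>) * sin \<phi> + r * sin u * cos \<phi>"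
  "circle_point (bead \<theta> \<phi> r) u $ 3 = tilted_height \<theta> r u"
  by (simp_all add: spherical_point_def theta_dir_def phi_dir_def algebra_simps)

text \<open>
  The average over all longitudes of the monomial with exponents \<open>a, b, c\<close>, for \<open>a + b = 2e\<close>, is a
  multiple of this polynomial in \<open>z\<close>.
\<close>

definition zonal_poly :: "nat \<Rightarrow> nat \<Rightarrow> real poly" where
  "zonal_poly e c = [:1, 0, -1:] ^ e * monom 1 c"

lemma poly_zonal_poly: "poly (zonal_poly e c) z = (1 - z\<^sup>2) ^ e * z ^ c"
  by (simp add: zonal_poly_def poly_monom power2_eq_square)

lemma degree_zonal_poly: "degree (zonal_poly e c) \<le> 2 * e + c"
proof -
  have "degree (zonal_poly e c) \<le> degree ([:1, 0, -1::real:] ^ e) + degree (monom (1::real) c)"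
    unfolding zonal_poly_def by (rule degree_mult_le)
  also have "degree ([:1, 0, -1::real:] ^ e) \<le> degree [:1, 0, -1::real:] * e" by (rule degree_power_le)
  also have "degree (monom (1::real) c) \<le> c" by (rule degree_monom_le)
  finally show ?thesis by simp
qed

lemma monom3_latitude:
  "integral {0..2 * pi} (\<lambda>u. monom3 a b c (circle_point (latitude \<theta>) u)) = sin \<theta> ^ (a + b) * cos \<theta> ^ c * equator_moment a b"
proof -
  have "(\<lambda>u. monom3 a b c (circle_point (latitude \<theta>) u)) = (\<lambda>u. (sin \<theta> ^ (a + b) * cos \<theta> ^ c) * (cos u ^ a * sin u ^ b))"
    unfolding circle_point_latitude by (simp add: monom3_def spherical_point_def power_mult_distrib power_add mult_ac)
  then show ?thesis by (simp only: integral_mult_right equator_moment_def)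
qed

text \<open>
  At a fixed angle \<open>u\<close>, the corresponding points of the \<open>M\<close> beads are equally spaced on a circle of
  latitude, which has radius \<open>\<bar>R\<bar>\<close>.
\<close>

lemma monom3_beads_point:
  assumes M: "a + b < M" and r: "\<bar>r\<bar> \<le> 1"
  shows "\<exists>R. R\<^sup>2 = 1 - (tilted_height \<theta> r u)\<^sup>2 \<and>
    (\<Sum>k<M. monom3 a b c (circle_point (bead \<theta> (angle_step M k) r) u))
    = real M * equator_moment a b / (2 * pi) * (R ^ (a + b) * (tilted_height \<theta> r u) ^ c)"
proof -
  define q where "q = sqrt (1 - r\<^sup>2)"
  have q2: "q\<^sup>2 + r\<^sup>2 = 1" using r by (simp add: q_def abs_square_le_1)
  define X Y Z where "X = q * sin \<theta> + r * cos u * cos \<theta>" and "Y = r * sin u" and "Z = q * cos \<theta> - r * sin \<theta> * cos u"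
  obtain R \<alpha> where R: "X = R * cos \<alpha>" "Y = R * sin \<alpha>" using polar_Ex by blast
  have t: "(sin \<theta>)\<^sup>2 + (cos \<theta>)\<^sup>2 = 1" and p: "(sin u)\<^sup>2 + (cos u)\<^sup>2 = 1" and s: "(sin \<alpha>)\<^sup>2 + (cos \<alpha>)\<^sup>2 = 1" by simp_all
  have "X\<^sup>2 + Y\<^sup>2 + Z\<^sup>2 = 1" unfolding X_def Y_def Z_def using q2 t p by algebra
  then have R2: "R\<^sup>2 = 1 - Z\<^sup>2" unfolding R using s by algebra
  have "monom3 a b c (circle_point (bead \<theta> \<phi> r) u) = R ^ (a + b) * Z ^ c * (cos (\<alpha> + \<phi>) ^ a * sin (\<alpha> + \<phi>) ^ b)" for \<phi>
  proof -
    have 1: "circle_point (bead \<theta> \<phi> r) u $ 1 = R * cos (\<alpha> + \<phi>)"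
      unfolding circle_point_bead unfolding q_def[symmetric] unfolding X_def[symmetric] Y_def[symmetric] unfolding R by (simp add: cos_add algebra_simps)
    have 2: "circle_point (bead \<theta> \<phi> r) u $ 2 = R * sin (\<alpha> + \<phi>)"
      unfolding circle_point_bead unfolding q_def[symmetric] unfolding X_def[symmetric] Y_def[symmetric] unfolding R by (simp add: sin_add algebra_simps)
    have 3: "circle_point (bead \<theta> \<phi> r) u $ 3 = Z" unfolding circle_point_bead Z_def q_def ..
    show ?thesis unfolding monom3_def 1 2 3 by (simp add: power_mult_distrib power_add mult_ac)
  qed
  then have "(\<Sum>k<M. monom3 a b c (circle_point (bead \<theta> (angle_step M k) r) u))
     = R ^ (a + b) * Z ^ c * (\<Sum>k<M. cos (\<alpha> + angle_step M k) ^ a * sin (\<alpha> + angle_step M k) ^ b)"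
    by (simp only: sum_distrib_left)
  also have "\<dots> = R ^ (a + b) * Z ^ c * (real M * equator_moment a b / (2 * pi))"
    by (simp only: equator_moment_rotation[OF M])
  also have "\<dots> = real M * equator_moment a b / (2 * pi) * (R ^ (a + b) * Z ^ c)" by simp
  finally show ?thesis using R2 unfolding Z_def q_def by blast
qed

text \<open>
  For odd \<open>a + b\<close> both sides vanish, whatever the polynomial on the right.
\<close>

lemma monom3_beads:
  assumes M: "a + b < M" and r: "\<bar>r\<bar> \<le> 1"
  shows "(\<Sum>k<M. integral {0..2 * pi} (\<lambda>u. monom3 a b c (circle_point (bead \<theta> (angle_step M k) r) u)))
    = real M * equator_moment a b * tilted_mean \<theta> r (zonal_poly ((a + b) div 2) c)"
proof -
  let ?Z = "\<lambda>u. tilted_height \<theta> r u"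
  have pt: "(\<Sum>k<M. monom3 a b c (circle_point (bead \<theta> (angle_step M k) r) u))
     = real M * equator_moment a b / (2 * pi) * poly (zonal_poly ((a + b) div 2) c) (?Z u)" for u
  proof -
    obtain R where R: "R\<^sup>2 = 1 - (?Z u)\<^sup>2" and
      S: "(\<Sum>k<M. monom3 a b c (circle_point (bead \<theta> (angle_step M k) r) u))
      = real M * equator_moment a b / (2 * pi) * (R ^ (a + b) * ?Z u ^ c)"
      using monom3_beads_point[OF M r] by blast
    show ?thesis
    proof (cases "even (a + b)")
      case True
      then obtain e where e: "a + b = 2 * e" by (rule evenE)
      have "R ^ (a + b) = (1 - (?Z u)\<^sup>2) ^ ((a + b) div 2)" unfolding e power_mult R by simp
      then show ?thesis unfolding S poly_zonal_poly by simp
    next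
      case False
      then show ?thesis unfolding S by (simp add: equator_moment_odd)
    qed
  qed
  have "(\<lambda>u. monom3 a b c (circle_point C u)) integrable_on {0..2 * pi}" for C
    by (intro integrable_continuous_real continuous_on_compose2[OF continuous_monom3[of UNIV] continuous_circle_point]) auto
  then have "(\<Sum>k<M. integral {0..2 * pi} (\<lambda>u. monom3 a b c (circle_point (bead \<theta> (angle_step M k) r) u)))
     = integral {0..2 * pi} (\<lambda>u. \<Sum>k<M. monom3 a b c (circle_point (bead \<theta> (angle_step M k) r) u))"
    by (intro Henstock_Kurzweil_Integration.integral_sum[symmetric]) (auto simp del: circle_point.simps)
  also have "\<dots> = real M * equator_moment a b / (2 * pi) * integral {0..2 * pi} (\<lambda>u. poly (zonal_poly ((a + b) div 2) c) (?Z u))"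
    unfolding pt by (rule integral_mult_right)
  finally show ?thesis by (simp add: tilted_mean_def)
qed

text \<open>
  Index \<open>k = 0\<close> is the circle of latitude itself, the indices \<open>k = 1, \<dots>, M\<close> are its beads.
\<close>

definition bead_family :: "nat \<Rightarrow> nat \<Rightarrow> (nat \<Rightarrow> real) \<Rightarrow> nat \<Rightarrow> nat \<Rightarrow> circle" where
  "bead_family m M w j k = (case k of 0 \<Rightarrow> latitude (colatitude m j)
     | Suc i \<Rightarrow> bead (colatitude m j) (angle_step M i) (w j / real M))"

definition bead_family_sum :: "nat \<Rightarrow> nat \<Rightarrow> (nat \<Rightarrow> real) \<Rightarrow> (real ^ 3 \<Rightarrow> real) \<Rightarrow> real" where
  "bead_family_sum m M w f = (\<Sum>j\<in>{1..<2 * m}. \<Sum>k\<le>M.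
     arc_integral (bead_family m M w j k) 0 (2 * pi) f)"

lemma bead_family_sum_monom3:
  assumes m: "m > 0" and M: "a + b < M" and deg: "a + b + c + 2 \<le> 2 * m"
    and w: "\<And>j. j \<in> {1..<2 * m} \<Longrightarrow> 0 < w j \<and> w j \<le> real M"
    and quad: "exact_with_beads m (real M) w"
  shows "bead_family_sum m M w (monom3 a b c) = 80 * pi * real m * sphere_moment a b c"
proof -
  let ?t = "colatitude m" and ?E = "equator_moment a b" and ?P = "zonal_poly ((a + b) div 2) c"
  have M0: "real M \<noteq> 0" using M by simp
  have lat: "circle_radius (latitude (?t j)) = sin (?t j)" if "j \<in> {1..<2 * m}" for j
    using colatitude_range(3)[OF that] by (intro circle_frame_orthonormal3(2)[OF orthonormal3_axes]) auto
  have rr: "0 < w j / real M \<and> w j / real M \<le> 1" if "j \<in> {1..<2 * m}" for j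
    using w[OF that] M by simp
  have bd: "circle_radius (bead (?t j) \<phi> (w j / real M)) = w j / real M" if "j \<in> {1..<2 * m}" for j \<phi>
  proof (rule circle_frame_orthonormal3(2)[OF orthonormal3_spherical])
    have "(w j / real M)\<^sup>2 \<le> 1" using rr[OF that] by (intro power_le_one) auto
    then show "(sqrt (1 - (w j / real M)\<^sup>2))\<^sup>2 + (w j / real M)\<^sup>2 = 1" by simp
  qed (use rr[OF that] in simp)
  have zp: "?E * (sin \<theta> ^ (a + b) * cos \<theta> ^ c) = ?E * poly ?P (cos \<theta>)" for \<theta> :: real
  proof (cases "even (a + b)")
    case True
    then obtain e where e: "a + b = 2 * e" by (rule evenE)
    then show ?thesis unfolding poly_zonal_poly e power_mult by (simp add: sin_squared_eq)
  qed (simp add: equator_moment_odd)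
  have dP: "degree ?P + 2 \<le> 2 * m" using degree_zonal_poly[of "(a + b) div 2" c] deg by linarith
  have "bead_family_sum m M w (monom3 a b c) = (\<Sum>j\<in>{1..<2 * m}. ?E * (sin (?t j) * poly ?P (cos (?t j)) + w j * tilted_mean (?t j) (w j / real M) ?P))"
    unfolding bead_family_sum_def
  proof (rule sum.cong[OF refl])
    fix j assume j: "j \<in> {1..<2 * m}"
    have r1: "\<bar>w j / real M\<bar> \<le> 1" using rr[OF j] by (simp only: abs_of_pos)
    have "(\<Sum>k\<le>M. arc_integral (bead_family m M w j k) 0 (2 * pi) (monom3 a b c))
      = sin (?t j) * (?E * (sin (?t j) ^ (a + b) * cos (?t j) ^ c)) + w j / real M * (real M * ?E * tilted_mean (?t j) (w j / real M) ?P)"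
      unfolding sum.atMost_shift bead_family_def nat.case lat[OF j] bd[OF j] monom3_latitude sum_distrib_left[symmetric] monom3_beads[OF M r1]
      by simp
    also have "\<dots> = ?E * (sin (?t j) * poly ?P (cos (?t j)) + w j * tilted_mean (?t j) (w j / real M) ?P)"
      unfolding zp using M0 by (simp add: algebra_simps)
    finally show "(\<Sum>k\<le>M. arc_integral (bead_family m M w j k) 0 (2 * pi) (monom3 a b c))
      = ?E * (sin (?t j) * poly ?P (cos (?t j)) + w j * tilted_mean (?t j) (w j / real M) ?P)" .
  qed
  also have "\<dots> = ?E * (20 * real m * integral {0..pi} (\<lambda>\<theta>. poly ?P (cos \<theta>) * sin \<theta>))"
    unfolding sum_distrib_left[symmetric] quad[rule_format, OF dP] ..
  also have "\<dots> = 20 * real m * integral {0..pi} (\<lambda>\<theta>. ?E * poly ?P (cos \<theta>) * sin \<theta>)"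
    by (simp add: mult.assoc)
  also have "(\<lambda>\<theta>. ?E * poly ?P (cos \<theta>) * sin \<theta>) = (\<lambda>\<theta>. ?E * (cos \<theta> ^ c * sin \<theta> ^ (a + b + 1)))"
    unfolding zp[symmetric] by (simp add: mult_ac)
  finally show ?thesis unfolding sphere_moment_def polar_moment_def by simp
qed

text \<open>
  The circle of Euclidean radius \<open>r\<close> that the plane \<open>n \<bullet> x = d\<close> cuts out of the unit sphere.
\<close>

definition tilted_circle :: "real ^ 3 \<Rightarrow> real \<Rightarrow> real \<Rightarrow> circle \<Rightarrow> bool" where
  "tilted_circle n d r C \<longleftrightarrow> (\<exists>e f. C = (d *\<^sub>R n, r *\<^sub>R e, r *\<^sub>R f) \<and> orthonormal3 n e f) \<and> r > 0 \<and> d\<^sup>2 + r\<^sup>2 = 1"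

lemma tilted_circle_frame: "tilted_circle n d r C \<Longrightarrow> circle_frame C"
  unfolding tilted_circle_def using circle_frame_orthonormal3(1) by blast

lemma tilted_circle_radius: "tilted_circle n d r C \<Longrightarrow> circle_radius C = r"
  unfolding tilted_circle_def using circle_frame_orthonormal3(2) by blast

lemma tilted_circle_Int:
  assumes "tilted_circle n d r C" "tilted_circle n' d' r' C'" "(n', d') \<noteq> (n, d)" "(n', d') \<noteq> (- n, - d)"
  shows "finite (range (circle_point C) \<inter> range (circle_point C'))"
  using assms finite_circle_Int unfolding tilted_circle_def by blast

lemma tilted_circle_Int_radius:
  assumes C: "tilted_circle n d r C" "tilted_circle n' d' r' C'" and r: "r \<noteq> r'"
  shows "finite (range (circle_point C) \<inter> range (circle_point C'))"
proof (rule tilted_circle_Int[OF C])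
  have "d'\<^sup>2 \<noteq> d\<^sup>2"
  proof
    assume "d'\<^sup>2 = d\<^sup>2"
    then have "r'\<^sup>2 = r\<^sup>2" using C unfolding tilted_circle_def by linarith
    then show False using C r unfolding tilted_circle_def by (simp add: power2_eq_iff_nonneg)
  qed
  then show "(n', d') \<noteq> (n, d)" "(n', d') \<noteq> (- n, - d)" by auto
qed

fun swap_circle :: "circle \<Rightarrow> circle" where
  "swap_circle (p, a, b) = (swap13 p, swap13 a, swap13 b)"

lemma circle_point_swap_circle: "circle_point (swap_circle C) u = swap13 (circle_point C u)"
  by (cases C) (simp only: swap_circle.simps circle_point_swap13)

lemma tilted_circle_swap: "tilted_circle n d r C \<Longrightarrow> tilted_circle (swap13 n) d r (swap_circle C)"
  unfolding tilted_circle_def by (auto simp: swap13_scaleR intro: orthonormal3_swap13)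

lemma tilted_circle_latitude:
  "0 < sin \<theta> \<Longrightarrow> tilted_circle (vector [0, 0, 1]) (cos \<theta>) (sin \<theta>) (latitude \<theta>)"
  unfolding tilted_circle_def using orthonormal3_axes by auto

lemma tilted_circle_bead:
  "0 < r \<Longrightarrow> r \<le> 1 \<Longrightarrow> tilted_circle (spherical_point \<theta> \<phi>) (sqrt (1 - r\<^sup>2)) r (bead \<theta> \<phi> r)"
  unfolding tilted_circle_def using orthonormal3_spherical by (auto simp: power_le_one)

lemma spherical_point_eq_iff:
  assumes "spherical_point \<theta> \<phi> = spherical_point \<theta>' \<phi>'" "0 < \<theta>" "\<theta> < pi" "0 < \<theta>'" "\<theta>' < pi"
  shows "\<theta> = \<theta>' \<and> (\<exists>n::int. \<phi> = \<phi>' + 2 * pi * of_int n)"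
proof -
  have e: "sin \<theta> * cos \<phi> = sin \<theta>' * cos \<phi>'" "sin \<theta> * sin \<phi> = sin \<theta>' * sin \<phi>'" "cos \<theta> = cos \<theta>'"
    using arg_cong[OF assms(1), of "\<lambda>x. x $ 1"] arg_cong[OF assms(1), of "\<lambda>x. x $ 2"] arg_cong[OF assms(1), of "\<lambda>x. x $ 3"]
    by (simp_all add: spherical_point_def)
  have t: "\<theta> = \<theta>'" using cos_inj_pi[OF _ _ _ _ e(3)] assms by simp
  have "sin \<theta> \<noteq> 0" using sin_gt_zero[of \<theta>] assms by simp
  then have "sin \<phi> = sin \<phi>' \<and> cos \<phi> = cos \<phi>'" using e t by simp
  then show ?thesis using t sin_cos_eq_iff by blast
qed

lemma bead_angle_inj:
  assumes "angle_step M i = angle_step M k + 2 * pi * of_int n" "i < M" "k < M"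
  shows "i = k"
proof -
  have M: "real M > 0" using assms by simp
  from arg_cong[OF assms(1), of "\<lambda>x. x * real M"]
  have "2 * pi * real i = 2 * pi * (real k + real M * of_int n)" using M by (simp add: algebra_simps)
  then have "real i = real k + real M * of_int n" by simp
  then have "(of_int (int i) :: real) = of_int (int k + int M * n)" by simp
  then have e: "int i = int k + int M * n" by (simp only: of_int_eq_iff)
  then have "int i mod int M = int k mod int M" by simp
  then show ?thesis using assms by simp
qed

definition bead_radius :: "nat \<Rightarrow> nat \<Rightarrow> (nat \<Rightarrow> real) \<Rightarrow> nat \<Rightarrow> nat \<Rightarrow> real" where
  "bead_radius m M w j k = (case k of 0 \<Rightarrow> sin (colatitude m j) | Suc i \<Rightarrow> w j / real M)"

lemma bead_family_tilted:
  assumes j: "j \<in> {1..<2 * m}" and r: "0 < w j / real M" "w j / real M < 1"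
  shows "\<exists>n d. tilted_circle n d (bead_radius m M w j k) (bead_family m M w j k)"
proof (cases k)
  case 0
  then show ?thesis using tilted_circle_latitude[OF colatitude_range(3)[OF j]]
    by (auto simp: bead_radius_def bead_family_def)
next
  case (Suc i)
  then show ?thesis using tilted_circle_bead[OF r(1) less_imp_le[OF r(2)]]
    unfolding bead_radius_def bead_family_def nat.case Suc by blast
qed

text \<open>
  Circles of different radius are settled at once, and beads are smaller than every circle of latitude.
  Two beads with the same plane would have the same centre, because both heights \<open>d\<close> are positive.
\<close>

lemma bead_family_Int:
  assumes j: "j \<in> {1..<2 * m}" "j' \<in> {1..<2 * m}" and k: "k \<le> M" "k' \<le> M" and ne: "(j, k) \<noteq> (j', k')"
    and r: "\<And>i j. i \<in> {1..<2 * m} \<Longrightarrow> j \<in> {1..<2 * m} \<Longrightarrow> 0 < w j / real M \<and> w j / real M < sin (colatitude m i)"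
  shows "finite (range (circle_point (bead_family m M w j k)) \<inter> range (circle_point (bead_family m M w j' k')))"
proof -
  have r1: "0 < w i / real M" "w i / real M < 1" if "i \<in> {1..<2 * m}" for i
    using r[OF that that] sin_le_one[of "colatitude m i"] by linarith+
  obtain n d n' d' where C: "tilted_circle n d (bead_radius m M w j k) (bead_family m M w j k)"
    and C': "tilted_circle n' d' (bead_radius m M w j' k') (bead_family m M w j' k')"
    using bead_family_tilted[OF j(1), of w M k] bead_family_tilted[OF j(2), of w M k'] r1 j by blast
  show ?thesis
  proof (cases "bead_radius m M w j k = bead_radius m M w j' k'")
    case False then show ?thesis by (rule tilted_circle_Int_radius[OF C C'])
  next
    case eq: True
    show ?thesis
    proof (cases k)
      case 0
      then have "k' = 0" using eq r[OF j(1) j(2)] by (cases k') (auto simp: bead_radius_def)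
      then have "j \<noteq> j'" using ne 0 by simp
      then have c: "cos (colatitude m j') \<noteq> cos (colatitude m j)"
        using inj_onD[OF inj_on_cos_colatitude] j by metis
      have "(vector [0, 0, 1] :: real ^ 3) \<noteq> - vector [0, 0, 1]" by (simp add: vec_eq_iff forall_3)
      then show ?thesis unfolding 0 \<open>k' = 0\<close> bead_family_def nat.case
        using c by (intro tilted_circle_Int[OF tilted_circle_latitude tilted_circle_latitude] colatitude_range(3) j) auto
    next
      case (Suc i)
      then obtain i' where Suc': "k' = Suc i'" using eq r[OF j(2) j(1)] by (cases k') (auto simp: bead_radius_def)
      let ?\<phi> = "\<lambda>i. angle_step M i"
      have "spherical_point (colatitude m j') (?\<phi> i') \<noteq> spherical_point (colatitude m j) (?\<phi> i)"
      proof
        assume "spherical_point (colatitude m j') (?\<phi> i') = spherical_point (colatitude m j) (?\<phi> i)"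
        from spherical_point_eq_iff[OF this] colatitude_range[OF j(1)] colatitude_range[OF j(2)]
        obtain n :: int where "colatitude m j' = colatitude m j" "?\<phi> i' = ?\<phi> i + 2 * pi * of_int n" by blast
        then have "j' = j" "i' = i" using bead_angle_inj k Suc Suc' j by (auto simp: colatitude_def)
        then show False using ne Suc Suc' by simp
      qed
      moreover have "0 < sqrt (1 - (w i / real M)\<^sup>2)" if "i \<in> {1..<2 * m}" for i
        using r1[OF that] by (simp add: power_less_one_iff)
      then have "sqrt (1 - (w j' / real M)\<^sup>2) \<noteq> - sqrt (1 - (w j / real M)\<^sup>2)"
        using j by (metis add.inverse_inverse less_asym neg_0_less_iff_less neg_less_0_iff_less)
      ultimately show ?thesis unfolding Suc Suc' bead_family_def nat.case
        by (intro tilted_circle_Int[OF tilted_circle_bead tilted_circle_bead] r1 less_imp_le[OF r1(2)] j) auto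
    qed
  qed
qed

text \<open>
  The bead contains a point of height \<open>cos \<theta>\<close>: solving for its angle requires
  \<open>(1 - \<surd>(1 - r\<^sup>2)) \<bar>cos \<theta>\<bar> \<le> r sin \<theta>\<close>, which follows from \<open>1 - \<surd>(1 - r\<^sup>2) \<le> r\<^sup>2\<close> and
  \<open>r \<le> sin \<theta>\<close>.
\<close>

lemma bead_meets_latitude:
  assumes s: "0 < sin \<theta>" and r: "0 < r" "r \<le> sin \<theta>"
  shows "\<exists>u v. circle_point (latitude \<theta>) u = circle_point (bead \<theta> \<phi> r) v"
proof -
  have r1: "r \<le> 1" using r sin_le_one[of \<theta>] by linarith
  then have r2: "r\<^sup>2 \<le> 1" using r by (intro power_le_one) auto
  define q where "q = sqrt (1 - r\<^sup>2)"
  have q: "q\<^sup>2 = 1 - r\<^sup>2" "0 \<le> q" "q \<le> 1" using r2 by (simp_all add: q_def)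
  have "q * q \<le> q * 1" using q by (intro mult_left_mono) auto
  then have q1: "1 - q \<le> r\<^sup>2" using q(1) by (simp add: power2_eq_square)
  define x where "x = - (1 - q) * cos \<theta> / (r * sin \<theta>)"
  have "\<bar>(1 - q) * cos \<theta>\<bar> \<le> r * sin \<theta>"
  proof -
    have "\<bar>(1 - q) * cos \<theta>\<bar> \<le> r\<^sup>2 * 1" unfolding abs_mult using q q1 by (intro mult_mono) auto
    also have "\<dots> \<le> r * sin \<theta>" using r by (simp add: power2_eq_square)
    finally show ?thesis .
  qed
  then have "\<bar>x\<bar> \<le> 1" using r s by (simp add: x_def abs_mult abs_minus_commute divide_le_eq_1_pos)
  then obtain v where v: "cos v = x" using cos_arccos_abs by blast
  define y where "y = circle_point (bead \<theta> \<phi> r) v"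
  have "r * sin \<theta> * cos v = - (1 - q) * cos \<theta>" unfolding v x_def using r s by simp
  then have y3: "y $ 3 = cos \<theta>" unfolding y_def circle_point_bead unfolding q_def[symmetric] by (simp add: algebra_simps)
  have "norm y = 1" unfolding y_def
    by (rule norm_circle_point[OF tilted_circle_frame[OF tilted_circle_bead[OF r(1) r1]]])
  then have "(y $ 1)\<^sup>2 + (y $ 2)\<^sup>2 + (cos \<theta>)\<^sup>2 = 1"
    unfolding norm_eq_1 inner_vec_def sum_3 y3[symmetric] by (simp add: power2_eq_square)
  then have "(y $ 1)\<^sup>2 + (y $ 2)\<^sup>2 = (sin \<theta>)\<^sup>2" using sin_cos_squared_add[of \<theta>] by linarith
  then have "(y $ 1 / sin \<theta>)\<^sup>2 + (y $ 2 / sin \<theta>)\<^sup>2 = 1"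
    using s by (simp add: power_divide flip: add_divide_distrib)
  then obtain u where "y $ 1 / sin \<theta> = cos u" "y $ 2 / sin \<theta> = sin u" using sincos_total_2pi_le by blast
  then have "spherical_point \<theta> u = y" using s y3 by (simp add: spherical_point_def vec_eq_iff forall_3 field_simps)
  then show ?thesis unfolding circle_point_latitude y_def by blast
qed

lemma bead_family_sum_add_scaled:
  fixes g h :: "real ^ 3 \<Rightarrow> real"
  assumes g: "continuous_on UNIV g" and h: "continuous_on UNIV h"
  shows "bead_family_sum m M w (\<lambda>x. c * g x + h x) = c * bead_family_sum m M w g + bead_family_sum m M w h"
proof -
  have i: "(\<lambda>u. f (circle_point C u)) integrable_on {0..2 * pi}" if "continuous_on UNIV f" for f :: "real ^ 3 \<Rightarrow> real" and C
    by (intro integrable_continuous_real continuous_on_compose2[OF that continuous_circle_point]) auto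
  have "integral {0..2 * pi} (\<lambda>u. c * g (circle_point C u) + h (circle_point C u)) =
      c * integral {0..2 * pi} (\<lambda>u. g (circle_point C u)) + integral {0..2 * pi} (\<lambda>u. h (circle_point C u))" for C
    using Henstock_Kurzweil_Integration.integral_add[OF integrable_on_mult_right[OF i[OF g]] i[OF h]]
    by (simp del: circle_point.simps)
  then show ?thesis unfolding bead_family_sum_def
    by (simp add: sum.distrib sum_distrib_left distrib_left mult_ac del: circle_point.simps)
qed

lemma sphere_integral_add_scaled:
  fixes g h :: "real ^ 3 \<Rightarrow> real"
  assumes g: "continuous_on UNIV g" and h: "continuous_on UNIV h"
  shows "(\<integral>x. c * g x + h x \<partial>sphere_measure) = c * (\<integral>x. g x \<partial>sphere_measure) + (\<integral>x. h x \<partial>sphere_measure)"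
proof -
  let ?S = "cbox (0, 0) (pi, 2 * pi) :: (real \<times> real) set"
  let ?F = "\<lambda>f p. sin (fst p) / (4 * pi) * f (spherical_point (fst p) (snd p))"
  have i: "?F f integrable_on ?S" if "continuous_on UNIV f" for f :: "real ^ 3 \<Rightarrow> real"
    by (intro integrable_continuous continuous_intros continuous_on_compose2[OF that continuous_spherical_point]) auto
  have "continuous_on UNIV (\<lambda>x. c * g x + h x)" by (rule continuous_on_add[OF continuous_on_mult_left[OF g] h])
  then have "(\<integral>x. c * g x + h x \<partial>sphere_measure) = integral ?S (?F (\<lambda>x. c * g x + h x))"
    by (rule sphere_integral)
  also have "?F (\<lambda>x. c * g x + h x) = (\<lambda>p. c * ?F g p + ?F h p)" by (simp add: algebra_simps)
  also have "integral ?S \<dots> = c * integral ?S (?F g) + integral ?S (?F h)"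
    using Henstock_Kurzweil_Integration.integral_add[OF integrable_on_mult_right[OF i[OF g]] i[OF h]] by simp
  finally show ?thesis by (simp only: sphere_integral[OF g] sphere_integral[OF h])
qed

lemma prod_UNIV_3: "prod f (UNIV :: 3 set) = f 1 * f 2 * f 3" for f :: "3 \<Rightarrow> real"
  unfolding UNIV_3 by (simp add: ac_simps)

lemma linear_on_polys_upto:
  fixes \<Lambda> :: "(real ^ 3 \<Rightarrow> real) \<Rightarrow> real"
  assumes lin: "\<And>c g h. continuous_on UNIV g \<Longrightarrow> continuous_on UNIV h \<Longrightarrow> \<Lambda> (\<lambda>x. c * g x + h x) = c * \<Lambda> g + \<Lambda> h"
    and lin': "\<And>c g h. continuous_on UNIV g \<Longrightarrow> continuous_on UNIV h \<Longrightarrow> \<Lambda>' (\<lambda>x. c * g x + h x) = c * \<Lambda>' g + \<Lambda>' h"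
    and eq: "\<And>a b c. a + b + c \<le> t \<Longrightarrow> \<Lambda> (monom3 a b c) = \<Lambda>' (monom3 a b c)"
    and f: "f \<in> polys_upto t"
  shows "\<Lambda> f = \<Lambda>' f"
proof -
  let ?m = "\<lambda>k :: 3 \<Rightarrow> nat. monom3 (k 1) (k 2) (k 3)"
  obtain c :: "(3 \<Rightarrow> nat) \<Rightarrow> real" where f_eq: "f = (\<lambda>x. \<Sum>k | (\<Sum>i\<in>UNIV. k i) \<le> t. c k * (\<Prod>i\<in>UNIV. (x $ i) ^ k i))"
    using f unfolding polys_upto_def mem_Collect_eq by (elim exE)
  have step: "\<Lambda> (\<lambda>x. \<Sum>k\<in>K. c k * ?m k x) = \<Lambda>' (\<lambda>x. \<Sum>k\<in>K. c k * ?m k x)"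
    if "finite K" "K \<subseteq> {k. (\<Sum>i\<in>UNIV. k i) \<le> t}" for K
    using that
  proof (induction K)
    case empty
    have "\<Lambda> (\<lambda>x. 0) = 0" "\<Lambda>' (\<lambda>x. 0) = 0"
      using lin[OF continuous_on_const continuous_on_const, of 1 0 0] lin'[OF continuous_on_const continuous_on_const, of 1 0 0] by simp_all
    then show ?case by simp
  next
    case (insert k K)
    have "k 1 + k 2 + k 3 \<le> t" using insert.prems by (simp add: sum_3)
    then have 1: "\<Lambda> (?m k) = \<Lambda>' (?m k)" by (rule eq)
    have 2: "continuous_on UNIV (?m k)" "continuous_on UNIV (\<lambda>x. \<Sum>k\<in>K. c k * ?m k x)"
      by (rule continuous_monom3) (rule continuous_on_sum, rule continuous_on_mult_left, rule continuous_monom3)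
    have IH: "\<Lambda> (\<lambda>x. \<Sum>k\<in>K. c k * ?m k x) = \<Lambda>' (\<lambda>x. \<Sum>k\<in>K. c k * ?m k x)"
      by (rule insert.IH) (use insert.prems in blast)
    note sum_insert = sum.insert[OF insert.hyps(1,2)]
    have "\<Lambda> (\<lambda>x. c k * ?m k x + (\<Sum>k\<in>K. c k * ?m k x)) = c k * \<Lambda> (?m k) + \<Lambda> (\<lambda>x. \<Sum>k\<in>K. c k * ?m k x)"
      by (rule lin[OF 2])
    also have "\<dots> = c k * \<Lambda>' (?m k) + \<Lambda>' (\<lambda>x. \<Sum>k\<in>K. c k * ?m k x)" by (simp only: 1 IH)
    also have "\<dots> = \<Lambda>' (\<lambda>x. c k * ?m k x + (\<Sum>k\<in>K. c k * ?m k x))"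
      by (rule lin'[OF 2, symmetric])
    finally show ?case unfolding sum_insert .
  qed
  have prod: "(\<Prod>i\<in>UNIV. (x $ i) ^ k i) = ?m k x" for x :: "real ^ 3" and k
    unfolding monom3_def by (rule prod_UNIV_3)
  show ?thesis unfolding f_eq prod by (rule step[OF finite_exponents order_refl])
qed

section \<open>Design curves of length of order t\<close>

text \<open>
  The first family of beaded circles of latitude has \<open>M\<close> beads on each, its counterpart about the
  first axis \<open>M'\<close>.  The exchange of coordinates permutes the monomials and preserves their sphere
  moments, so the second family is exact along with the first, and so is their union.  With
  \<open>M = M'\<close> a bead centred on the plane of symmetry could coincide with its own mirror image.
\<close>

lemma design_curve_exists:
  "\<exists>\<gamma>. design_curve t \<gamma> \<and> curve_length \<gamma> = 160 * pi * real (t + 1)"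
proof -
  define m where "m = t + 1"
  have m: "m > 0" by (simp add: m_def)
  define J where "J = {1..<2 * m}"
  have J: "finite J" "m \<in> J" by (auto simp: J_def m_def)
  define \<sigma> where "\<sigma> = Min ((\<lambda>j. sin (colatitude m j)) ` J)"
  have \<sigma>: "0 < \<sigma>" unfolding \<sigma>_def using J colatitude_range(3)[of _ m] by (subst Min_gr_iff) (auto simp: J_def)
  have \<sigma>_le: "\<sigma> \<le> sin (colatitude m j)" if "j \<in> J" for j unfolding \<sigma>_def using J that by simp
  obtain \<beta> B M0 where \<beta>: "0 < \<beta>" and weights: "\<And>M. M \<ge> M0 \<Longrightarrow> \<exists>w. (\<forall>j\<in>{1..<2 * m}. \<beta> \<le> w j \<and> w j \<le> B) \<and> exact_with_beads m M w"
    using weighted_latitudes[OF m] by blast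
  \<comment> \<open>\<open>B\<close> bounds the bead weights from above and \<open>\<sigma>\<close> the radii of the circles of latitude from
    below, so \<open>B < \<sigma> M\<close> makes every bead smaller than every circle of latitude.\<close>
  have large: "\<exists>M::nat. t < M \<and> M0 \<le> real M \<and> B < \<sigma> * real M \<and> B \<le> real M \<and> K < \<beta> * real M" for K
  proof -
    have "\<forall>\<^sub>F M::nat in sequentially. t < M \<and> M0 \<le> real M \<and> B / \<sigma> < real M \<and> B \<le> real M \<and> K / \<beta> < real M"
      by (intro eventually_conj eventually_gt_at_top
        filterlim_real_sequentially[unfolded filterlim_at_top, rule_format]
        filterlim_real_sequentially[unfolded filterlim_at_top_dense, rule_format])
    then obtain M :: nat where "t < M \<and> M0 \<le> real M \<and> B / \<sigma> < real M \<and> B \<le> real M \<and> K / \<beta> < real M"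
      using eventually_happens' by force
    then show ?thesis using \<sigma> \<beta> by (intro exI[of _ M]) (auto simp: field_simps)
  qed
  obtain M where M: "t < M" "M0 \<le> real M" "B < \<sigma> * real M" "B \<le> real M" using large by blast
  \<comment> \<open>By the last inequality the beads of the second family are smaller than those of the first.\<close>
  obtain M' where M': "t < M'" "M0 \<le> real M'" "B < \<sigma> * real M'" "B \<le> real M'" "B * real M < \<beta> * real M'"
    using large by blast
  obtain w where w: "\<forall>j\<in>{1..<2 * m}. \<beta> \<le> w j \<and> w j \<le> B"
    and quad: "exact_with_beads m (real M) w"
    using weights[OF M(2)] by blast
  obtain w' where w': "\<forall>j\<in>{1..<2 * m}. \<beta> \<le> w' j \<and> w' j \<le> B"
    and quad': "exact_with_beads m (real M') w'"
    using weights[OF M'(2)] by blast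
  have Mp: "real M > 0" "real M' > 0" using M(1) M'(1) by auto
  have small: "0 < v j / real K \<and> v j / real K < sin (colatitude m i)"
    if "i \<in> {1..<2 * m}" "j \<in> {1..<2 * m}" "real K > 0" "\<forall>j\<in>{1..<2 * m}. \<beta> \<le> v j \<and> v j \<le> B" "B < \<sigma> * real K" for i j K v
  proof -
    have "v j < \<sigma> * real K" "0 < v j" using that \<beta> by force+
    then have "v j / real K < \<sigma>" "0 < v j / real K" using that by (simp_all add: divide_less_eq)
    then show ?thesis using \<sigma>_le[of i] that by (simp add: J_def)
  qed
  have r: "0 < w j / real M \<and> w j / real M < sin (colatitude m i)" if "i \<in> {1..<2 * m}" "j \<in> {1..<2 * m}" for i j
    by (rule small[OF that Mp(1) w M(3)])
  have r': "0 < w' j / real M' \<and> w' j / real M' < sin (colatitude m i)" if "i \<in> {1..<2 * m}" "j \<in> {1..<2 * m}" for i j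
    by (rule small[OF that Mp(2) w' M'(3)])
  have smaller: "w' i / real M' < w j / real M" if "i \<in> {1..<2 * m}" "j \<in> {1..<2 * m}" for i j
  proof -
    have "w' i * real M \<le> B * real M" using w' that by (intro mult_right_mono) auto
    also have "\<dots> < \<beta> * real M'" by (rule M'(5))
    also have "\<dots> \<le> w j * real M'" using w that by (intro mult_right_mono) auto
    finally show ?thesis using Mp by (simp add: field_simps)
  qed
  have lt1: "w j / real M < 1" "w' j / real M' < 1" if "j \<in> {1..<2 * m}" for j
    using r[OF that that] r'[OF that that] sin_le_one[of "colatitude m j"] by linarith+
  define F where "F = bead_family m M w"
  define F' where "F' j k = swap_circle (bead_family m M' w' j k)" for j k
  define C where "C = (\<lambda>(s, j, k). if s then F' j k else F j k)"
  define I where "I = {False} \<times> J \<times> {..M} \<union> {True} \<times> J \<times> {..M'}"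
  have tilted: "\<exists>n d. tilted_circle n d (bead_radius m M w j k) (F j k)" if "j \<in> J" for j k
  proof -
    have j: "j \<in> {1..<2 * m}" using that by (simp only: J_def)
    show ?thesis unfolding F_def using bead_family_tilted[of j m w M k, OF j conjunct1[OF r[OF j j]] lt1(1)[OF j]] .
  qed
  have tilted0': "\<exists>n d. tilted_circle n d (bead_radius m M' w' j k) (bead_family m M' w' j k)" if "j \<in> J" for j k
  proof -
    have j: "j \<in> {1..<2 * m}" using that by (simp only: J_def)
    show ?thesis using bead_family_tilted[of j m w' M' k, OF j conjunct1[OF r'[OF j j]] lt1(2)[OF j]] .
  qed
  have tilted': "\<exists>n d. tilted_circle n d (bead_radius m M' w' j k) (F' j k)" if "j \<in> J" for j k
    using tilted0'[OF that, of k] tilted_circle_swap unfolding F'_def by blast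
  have frame: "circle_frame (C i)" if "i \<in> I" for i
  proof -
    obtain s j k where sjk: "i = (s, j, k)" by (cases i)
    then have "j \<in> J" using that by (auto simp: I_def)
    then have "circle_frame (F j k)" "circle_frame (F' j k)"
      using tilted[of j k] tilted'[of j k] tilted_circle_frame by blast+
    then show ?thesis unfolding sjk C_def by simp
  qed
  have crossFF': "finite (range (circle_point (F j k)) \<inter> range (circle_point (F' j' k')))"
    if j: "j \<in> J" "j' \<in> J" and k: "k \<le> M" "k' \<le> M'" for j k j' k'
  proof (cases "k = 0 \<and> k' = 0")
    case True
    have "(swap13 (vector [0, 0, 1])) \<noteq> vector [0, 0, 1]" "(swap13 (vector [0, 0, 1])) \<noteq> - vector [0, 0, 1]"
      by (simp_all add: vec_eq_iff forall_3)
    then show ?thesis using True j unfolding F_def F'_def bead_family_def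
      by (auto intro!: tilted_circle_Int[OF tilted_circle_latitude tilted_circle_swap[OF tilted_circle_latitude]] colatitude_range(3) simp: J_def simp del: circle_point.simps swap_circle.simps)
  next
    case False
    have "bead_radius m M w j k \<noteq> bead_radius m M' w' j' k'"
      using False r[of j' j] r'[of j j'] smaller[of j' j] j
      by (cases k; cases k') (auto simp: bead_radius_def J_def)
    then show ?thesis using tilted[OF j(1), of k] tilted'[OF j(2), of k'] tilted_circle_Int_radius by blast
  qed
  have inv: "swap13 (swap13 x) = x" for x by (simp add: vec_eq_iff forall_3)
  have rangeF': "range (circle_point (F' j k)) = swap13 ` range (circle_point (bead_family m M' w' j k))" for j k
    unfolding F'_def by (auto simp: circle_point_swap_circle simp del: circle_point.simps)
  have cross: "finite (range (circle_point (C i)) \<inter> range (circle_point (C i')))" if "i \<in> I" "i' \<in> I" "i \<noteq> i'" for i i'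
  proof -
    obtain s j k where i: "i = (s, j, k)" by (cases i)
    obtain s' j' k' where i': "i' = (s', j', k')" by (cases i')
    have jk: "j \<in> J" "j' \<in> J" "k \<le> (if s then M' else M)" "k' \<le> (if s' then M' else M)"
      using that unfolding i i' I_def by auto
    consider "\<not> s" "\<not> s'" | "\<not> s" "s'" | "s" "\<not> s'" | "s" "s'" by blast
    then show ?thesis
    proof cases
      case 1
      then show ?thesis using jk that(3) bead_family_Int[of j m j' k M k' w] r unfolding i i' C_def F_def J_def by simp
    next
      case 2 then show ?thesis using crossFF' jk unfolding i i' C_def by simp
    next
      case 3 then show ?thesis using crossFF'[of j' j k' k] jk unfolding i i' C_def by (simp add: Int_commute)
    next
      case 4
      have "inj swap13" using inv by (metis injI)
      then have "range (circle_point (F' j k)) \<inter> range (circle_point (F' j' k')) =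
          swap13 ` (range (circle_point (bead_family m M' w' j k)) \<inter> range (circle_point (bead_family m M' w' j' k')))"
        unfolding rangeF' by (rule image_Int[symmetric])
      moreover have "finite (range (circle_point (bead_family m M' w' j k)) \<inter> range (circle_point (bead_family m M' w' j' k')))"
        using 4 jk that(3) bead_family_Int[of j m j' k M' k' w'] r' unfolding i i' J_def by simp
      ultimately show ?thesis using 4 unfolding i i' C_def by simp
    qed
  qed
  have half: "colatitude m m = pi / 2" using m by (simp add: colatitude_def)
  have lat: "C (False, j, 0) = latitude (colatitude m j)" "C (True, j, 0) = swap_circle (latitude (colatitude m j))" for j
    by (simp_all add: C_def F_def F'_def bead_family_def)
  \<comment> \<open>The great circles orthogonal to the two axes meet all circles of latitude of the other family.\<close>
  have meet1: "\<exists>u v. circle_point (C (True, m, 0)) u = circle_point (C (False, j, 0)) v" for j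
  proof -
    have "circle_point (C (True, m, 0)) (colatitude m j) = circle_point (C (False, j, 0)) (pi / 2)"
      unfolding lat circle_point_swap_circle circle_point_latitude half
      by (simp add: vec_eq_iff forall_3 spherical_point_def)
    then show ?thesis by blast
  qed
  have meet2: "\<exists>u v. circle_point (C (False, m, 0)) u = circle_point (C (True, j, 0)) v" for j
  proof -
    have "circle_point (C (False, m, 0)) (colatitude m j) = circle_point (C (True, j, 0)) (pi / 2)"
      unfolding lat circle_point_swap_circle circle_point_latitude half
      by (simp add: vec_eq_iff forall_3 spherical_point_def)
    then show ?thesis by blast
  qed
  have meet3: "\<exists>u v. circle_point (C (s, j, 0)) u = circle_point (C (s, j, k)) v" if j: "j \<in> J" for s j k
  proof (cases k)
    case 0 then show ?thesis by blast
  next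
    case (Suc i)
    have j': "j \<in> {1..<2 * m}" using j by (simp add: J_def)
    note s0 = colatitude_range(3)[OF j']
    show ?thesis
    proof (cases s)
      case False
      have "\<exists>u v. circle_point (latitude (colatitude m j)) u = circle_point (bead (colatitude m j) (angle_step M i) (w j / real M)) v"
        using r[OF j' j'] s0 by (intro bead_meets_latitude) auto
      then show ?thesis using False unfolding C_def F_def bead_family_def Suc by (simp del: circle_point.simps)
    next
      case True
      have "\<exists>u v. circle_point (latitude (colatitude m j)) u = circle_point (bead (colatitude m j) (angle_step M' i) (w' j / real M')) v"
        using r'[OF j' j'] s0 by (intro bead_meets_latitude) auto
      then have "\<exists>u v. swap13 (circle_point (latitude (colatitude m j)) u) = swap13 (circle_point (bead (colatitude m j) (angle_step M' i) (w' j / real M')) v)"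
        by metis
      then show ?thesis using True unfolding C_def F'_def bead_family_def Suc
        by (simp add: circle_point_swap_circle del: circle_point.simps swap_circle.simps)
    qed
  qed
  have link: "linked C I"
  proof -
    define I1 where "I1 = {(True, m, 0 :: nat)} \<union> {False} \<times> J \<times> {0}"
    define I2 where "I2 = I1 \<union> {True} \<times> J \<times> {0}"
    have "linked C I1" unfolding I1_def
    proof (rule linked_Un[OF _ linked.single])
      fix x assume "x \<in> {False} \<times> J \<times> {0 :: nat}"
      then obtain j where x: "x = (False, j, 0)" by auto
      show "\<exists>i\<in>{(True, m, 0)}. \<exists>u v. circle_point (C i) u = circle_point (C x) v"
        unfolding x by (rule bexI[of _ "(True, m, 0)"], rule meet1) simp
    qed (use J in simp)
    then have "linked C I2" unfolding I2_def
    proof (rule linked_Un[rotated])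
      fix x assume "x \<in> {True} \<times> J \<times> {0 :: nat}"
      then obtain j where x: "x = (True, j, 0)" by auto
      show "\<exists>i\<in>I1. \<exists>u v. circle_point (C i) u = circle_point (C x) v"
        unfolding x by (rule bexI[of _ "(False, m, 0)"], rule meet2) (use J in \<open>simp add: I1_def\<close>)
    qed (use J in simp)
    then have "linked C (I2 \<union> I)"
    proof (rule linked_Un[rotated])
      fix x assume "x \<in> I"
      then obtain s j k where x: "x = (s, j, k)" "j \<in> J" by (auto simp: I_def)
      show "\<exists>i\<in>I2. \<exists>u v. circle_point (C i) u = circle_point (C x) v"
        unfolding x(1) by (rule bexI[of _ "(s, j, 0)"], rule meet3[OF x(2)]) (use x(2) in \<open>cases s; simp add: I1_def I2_def\<close>)
    qed (use J in \<open>simp add: I_def\<close>)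
    moreover have "I2 \<union> I = I" using J(2) by (auto simp: I_def I1_def I2_def)
    ultimately show ?thesis by simp
  qed
  from circles_tour[OF link frame cross] obtain \<gamma> where \<gamma>: "closed_sphere_curve \<gamma>"
    and len0: "curve_length \<gamma> = 2 * pi * (\<Sum>i\<in>I. circle_radius (C i))"
    and int: "\<And>f. continuous_on UNIV f \<Longrightarrow>
      curve_integral \<gamma> f = (\<Sum>i\<in>I. arc_integral (C i) 0 (2 * pi) f)"
    by blast
  have sumI: "(\<Sum>i\<in>I. h i) = (\<Sum>j\<in>J. \<Sum>k\<le>M. h (False, j, k)) + (\<Sum>j\<in>J. \<Sum>k\<le>M'. h (True, j, k))" for h :: "bool \<times> nat \<times> nat \<Rightarrow> real"
  proof -
    have slice: "(\<Sum>i\<in>{s} \<times> J \<times> K. h i) = (\<Sum>j\<in>J. \<Sum>k\<in>K. h (s, j, k))" for s and K :: "nat set"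
    proof -
      have "{s} \<times> J \<times> K = Pair s ` (J \<times> K)" by auto
      then have "(\<Sum>i\<in>{s} \<times> J \<times> K. h i) = (\<Sum>x\<in>J \<times> K. h (s, x))"
        by (simp add: sum.reindex inj_on_def)
      also have "\<dots> = (\<Sum>(j, k)\<in>J \<times> K. h (s, j, k))" by (simp add: case_prod_unfold)
      finally show ?thesis by (simp add: sum.cartesian_product)
    qed
    have "(\<Sum>i\<in>I. h i) = (\<Sum>i\<in>{False} \<times> J \<times> {..M}. h i) + (\<Sum>i\<in>{True} \<times> J \<times> {..M'}. h i)"
      unfolding I_def using J(1) by (intro sum.union_disjoint) auto
    then show ?thesis by (simp only: slice)
  qed
  have total: "curve_integral \<gamma> f = bead_family_sum m M w f + bead_family_sum m M' w' (\<lambda>x. f (swap13 x))"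
    if f: "continuous_on UNIV f" for f
  proof -
    have rad: "circle_radius (F' j k) = circle_radius (bead_family m M' w' j k)" if "j \<in> J" for j k
    proof -
      obtain n d where "tilted_circle n d (bead_radius m M' w' j k) (bead_family m M' w' j k)"
        using tilted0'[OF \<open>j \<in> J\<close>, of k] by blast
      then show ?thesis unfolding F'_def using tilted_circle_radius tilted_circle_swap by metis
    qed
    show ?thesis unfolding int[OF f] sumI bead_family_sum_def J_def[symmetric]
      using rad by (simp add: C_def F_def F'_def circle_point_swap_circle del: circle_point.simps swap_circle.simps)
  qed
  have cont_swap: "continuous_on UNIV swap13"
  proof -
    have "swap13 = (\<lambda>x. (x $ 3) *\<^sub>R axis 1 1 + (x $ 2) *\<^sub>R axis 2 1 + (x $ 1) *\<^sub>R axis 3 1)"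
      by (auto simp: vec_eq_iff forall_3 axis_def)
    then show ?thesis by (rule ssubst) (intro continuous_intros)
  qed
  have cs: "continuous_on UNIV (\<lambda>x. f (swap13 x))" if "continuous_on UNIV f" for f :: "real ^ 3 \<Rightarrow> real"
    by (rule continuous_on_compose2[OF that cont_swap]) auto
  have wM: "0 < w j \<and> w j \<le> real M" "0 < w' j \<and> w' j \<le> real M'" if "j \<in> {1..<2 * m}" for j
    using w w' that \<beta> M(4) M'(4) by force+
  have moment: "curve_integral \<gamma> (monom3 a b c) = 160 * pi * real m * sphere_moment a b c" if "a + b + c \<le> t" for a b c
  proof -
    have "bead_family_sum m M w (monom3 a b c) = 80 * pi * real m * sphere_moment a b c"
      using that M(1) wM by (intro bead_family_sum_monom3 m quad) (auto simp: m_def)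
    moreover have "bead_family_sum m M' w' (monom3 c b a) = 80 * pi * real m * sphere_moment c b a"
      using that M'(1) wM by (intro bead_family_sum_monom3 m quad') (auto simp: m_def)
    ultimately show ?thesis unfolding total[OF continuous_monom3] monom3_swap13 sphere_moment_swap[of c b a] by simp
  qed
  have poly_int: "curve_integral \<gamma> f = 160 * pi * real m * (\<integral>x. f x \<partial>sphere_measure)" if f: "f \<in> polys_upto t" for f
  proof (rule linear_on_polys_upto[OF _ _ _ f])
    fix c and g h :: "real ^ 3 \<Rightarrow> real" assume gh: "continuous_on UNIV g" "continuous_on UNIV h"
    have "continuous_on UNIV (\<lambda>x. c * g x + h x)" by (rule continuous_on_add[OF continuous_on_mult_left[OF gh(1)] gh(2)])
    then show "curve_integral \<gamma> (\<lambda>x. c * g x + h x) = c * curve_integral \<gamma> g + curve_integral \<gamma> h"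
      unfolding total[OF gh(1)] total[OF gh(2)]
      by (simp add: total bead_family_sum_add_scaled[OF gh] bead_family_sum_add_scaled[OF cs[OF gh(1)] cs[OF gh(2)]] distrib_left)
    show "160 * pi * real m * (\<integral>x. c * g x + h x \<partial>sphere_measure) =
       c * (160 * pi * real m * (\<integral>x. g x \<partial>sphere_measure)) + 160 * pi * real m * (\<integral>x. h x \<partial>sphere_measure)"
      unfolding sphere_integral_add_scaled[OF gh] by (simp add: algebra_simps)
  next
    fix a b c assume "a + b + c \<le> t"
    then show "curve_integral \<gamma> (monom3 a b c) = 160 * pi * real m * (\<integral>x. monom3 a b c x \<partial>sphere_measure)"
      unfolding sphere_integral_monom3 by (rule moment)
  qed
  have len: "curve_length \<gamma> = 160 * pi * real m"
  proof -
    have m1: "monom3 0 0 0 = (\<lambda>x. 1)" by (simp add: monom3_def[abs_def])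
    have "curve_length \<gamma> = curve_integral \<gamma> (monom3 0 0 0)"
      unfolding m1 curve_length_def curve_integral_def by simp
    also have "\<dots> = 160 * pi * real m * sphere_moment 0 0 0" by (rule moment) simp
    also have "sphere_moment 0 0 0 = 1"
    proof -
      have "(\<integral>x. monom3 0 0 0 x \<partial>sphere_measure) = 1"
        unfolding m1 using emeasure_sphere_measure_space by (simp add: measure_def)
      then show ?thesis by (simp add: sphere_integral_monom3)
    qed
    finally show ?thesis by simp
  qed
  have "design_curve t \<gamma>" unfolding design_curve_def
    using \<gamma> poly_int len m by simp
  then show ?thesis using len unfolding m_def by blast
qed

theorem theorem1p2:
  shows "\<exists>\<gamma> :: nat \<Rightarrow> real \<Rightarrow> real ^ 3.
           (\<forall>t\<ge>1. design_curve t (\<gamma> t)) \<and>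
           (\<exists>c C :: real. 0 < c \<and> c \<le> C \<and>
              (\<forall>t\<ge>1. c * real t \<le> curve_length (\<gamma> t) \<and> curve_length (\<gamma> t) \<le> C * real t))"
proof -
  obtain \<gamma> :: "nat \<Rightarrow> real \<Rightarrow> real ^ 3" where \<gamma>: "\<And>t. design_curve t (\<gamma> t) \<and> curve_length (\<gamma> t) = 160 * pi * real (t + 1)"
    using design_curve_exists by metis
  have "160 * pi * real t \<le> curve_length (\<gamma> t) \<and> curve_length (\<gamma> t) \<le> 320 * pi * real t" if "t \<ge> 1" for t
  proof -
    have "160 * pi * real t \<le> 160 * pi * real (t + 1)" by (intro mult_left_mono) auto
    moreover have "160 * pi * real (t + 1) \<le> 160 * pi * (2 * real t)" using that by (intro mult_left_mono) auto
    ultimately show ?thesis using \<gamma>[of t] by simp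
  qed
  then show ?thesis using \<gamma>
    by (intro exI[of _ \<gamma>] conjI exI[of _ "160 * pi"] exI[of _ "320 * pi"]) auto
qed

end
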